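(* Let $G$ be one of $\mathrm{SL}(n,\mathbb C)$, $\mathrm{SO}(n,\mathbb C)$, $\mathrm{Sp}(n,\mathbb C)$, let $c\in\mathbb C^*$, and let $\{\cdot,\cdot\}$ be the Poisson bracket on $\mathbb C[X_G^0(\mathbb Z^2)]$ induced by the symplectic form $\omega$ defined using the bilinear form $\mathfrak B=c\cdot\mathfrak T$, where $\mathfrak T(A,B)=\mathrm{Tr}(AB)$ is the trace form. For $g\in\mathbb Z^2$ let $\tau_g:X_G^0(\mathbb Z^2)\to\mathbb C$ be defined by $\tau_g([\rho])=\mathrm{Tr}\,\rho(g)$. Then for any $p,q,r,s\in\mathbb Z$, $$\{\tau_{(p,q)},\tau_{(r,s)}\}=\frac1c\begin{vmatrix} p & q \\ r & s \end{vmatrix}\left(\tau_{(p+r,q+s)}-\frac{\tau_{(p,q)}\tau_{(r,s)}}{n}\right)\quad\text{for } G=\mathrm{SL}(n,\mathbb C),$$ and $$\{\tau_{(p,q)},\tau_{(r,s)}\}=\frac1{2c}\begin{vmatrix} p & q \\ r & s \end{vmatrix}\left(\tau_{(p+r,q+s)}-\tau_{(p-r,q-s)}\right)\quad\text{for } G=\mathrm{SO}(n,\mathbb C),\ \mathrm{Sp}(n,\mathbb C).$$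
   Context: $\mathrm{Sp}(n,\mathbb C)$ is the group of $2n\times2n$ matrices preserving a symplectic form. Traces are taken in the standard representations $\mathrm{SL}(n,\mathbb C),\mathrm{SO}(n,\mathbb C)\subset \mathrm{GL}(n,\mathbb C)$ and $\mathrm{Sp}(n,\mathbb C)\subset\mathrm{GL}(2n,\mathbb C)$, and in the corresponding Lie algebras $\mathfrak g$. $X_G(\mathbb Z^2)=\mathrm{Hom}(\mathbb Z^2,G)//G$ is the categorical (GIT) quotient by conjugation. For a maximal torus $\mathbb T\subset G$ with Lie algebra $\mathfrak t$ and Weyl group $W$, $\chi:\mathbb T^2/W\to X_G(\mathbb Z^2)$ is induced by $\mathbb T^2=\mathrm{Hom}(\mathbb Z^2,\mathbb T)\subset\mathrm{Hom}(\mathbb Z^2,G)$, and $X_G^0(\mathbb Z^2)=\chi(\mathbb T^2/W)$. Definition of $\omega$. Let $X_G'(\mathbb Z^2)\subset X_G^0(\mathbb Z^2)$ be the set of classes of representations whose image is Zariski dense in a maximal torus. For such $[\rho]$ the natural map $H^1(\mathbb Z^2,\mathrm{Ad}\,\rho)\to T_{[\rho]}X_G(\mathbb Z^2)$, induced by the differential of the quotient map $\mathrm{Hom}(\mathbb Z^2,G)\to X_G(\mathbb Z^2)$, is an isomorphism. Here coefficients are in $\mathfrak g$ twisted by $\mathrm{Ad}\circ\rho$. The pairing $\omega$ on this space is the cup product $H^1\times H^1\to H^2(\mathbb Z^2,\mathrm{Ad}\,\rho\otimes\mathrm{Ad}\,\rho)$ followed by the map to $H^2(\mathbb Z^2,\mathbb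 C)=\mathbb C$ induced by $\mathfrak B$, where a $2$-cocycle $z$ is sent to $z(e_1,e_2)-z(e_2,e_1)$ for the standard basis $e_1,e_2$ of $\mathbb Z^2$. Under $\chi$, $\omega$ pulls back to the form induced by the invariant $2$-form on $\mathbb T\times\mathbb T$ given on $\mathfrak t\times\mathfrak t$ by $((v_1,w_1),(v_2,w_2))\mapsto\mathfrak B(v_1,w_2)-\mathfrak B(v_2,w_1)$. The Poisson bracket is $\{f,g\}=\omega(H_f,H_g)$, where $H_f$ is the Hamiltonian vector field of $f$, defined by $\omega(H_f,\cdot)=df$. The identities of regular functions are determined by their values on the dense set $X_G'(\mathbb Z^2)$. *)

theory Defs
  imports "HOL-Analysis.Analysis"
begin

section \<open>Regular functions\<close>

inductive_set algebra_gen :: "('a \<Rightarrow> complex) set \<Rightarrow> ('a \<Rightarrow> complex) set"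
  for F :: "('a \<Rightarrow> complex) set" where
  const: "(\<lambda>_. a) \<in> algebra_gen F"
| gen: "f \<in> F \<Longrightarrow> f \<in> algebra_gen F"
| add: "f \<in> algebra_gen F \<Longrightarrow> g \<in> algebra_gen F \<Longrightarrow> (\<lambda>x. f x + g x) \<in> algebra_gen F"
| mult: "f \<in> algebra_gen F \<Longrightarrow> g \<in> algebra_gen F \<Longrightarrow> (\<lambda>x. f x * g x) \<in> algebra_gen F"

definition matrix_poly :: "(complex^'n^'n \<Rightarrow> complex) set" where
  "matrix_poly = algebra_gen {\<lambda>A. A $ i $ j | i j. True}"

definition zariski_dense_in :: "(complex^'n^'n) set \<Rightarrow> (complex^'n^'n) set \<Rightarrow> bool" where
  "zariski_dense_in S T \<longleftrightarrow>
     S \<subseteq> T \<and> (\<forall>P\<in>matrix_poly. (\<forall>A\<in>S. P A = 0) \<longrightarrow> (\<forall>A\<in>T. P A = 0))"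


section \<open>The classical groups and their Lie algebras\<close>

definition SL :: "(complex^'n^'n) set" where
  "SL = {A. det A = 1}"

definition sl :: "(complex^'n^'n) set" where
  "sl = {A. trace A = 0}"

definition SO :: "(complex^'n^'n) set" where
  "SO = {A. transpose A ** A = mat 1 \<and> det A = 1}"

definition so :: "(complex^'n^'n) set" where
  "so = {A. transpose A + A = 0}"

text \<open>Symplectic forms are given by their Gram matrices.\<close>

definition symplectic_form :: "complex^'n^'n \<Rightarrow> bool" where
  "symplectic_form J \<longleftrightarrow> transpose J = - J \<and> invertible J"

definition Sp :: "complex^'n^'n \<Rightarrow> (complex^'n^'n) set" where
  "Sp J = {A. transpose A ** J ** A = J}"

definition sp :: "complex^'n^'n \<Rightarrow> (complex^'n^'n) set" where
  "sp J = {A. transpose A ** J + J ** A = 0}"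


section \<open>Maximal tori\<close>

text \<open>The group of \<open>k\<close>-tuples of nonzero complex numbers, each tuple continued by \<open>1\<close>.\<close>

definition Gm :: "nat \<Rightarrow> (nat \<Rightarrow> complex) set" where
  "Gm k = {z. (\<forall>i. z i \<noteq> 0) \<and> (\<forall>i\<ge>k. z i = 1)}"

definition laurent_poly :: "nat \<Rightarrow> ((nat \<Rightarrow> complex) \<Rightarrow> complex) set" where
  "laurent_poly k = algebra_gen ({\<lambda>z. z i | i. i < k} \<union> {\<lambda>z. inverse (z i) | i. i < k})"

text \<open>A torus is a subgroup isomorphic to some \<open>Gm k\<close> as an algebraic group: the last two
  clauses say that the isomorphism and its inverse pull regular functions back to regular
  functions. They also force \<open>T\<close> to be Zariski closed. All groups here lie in \<open>SL\<close>, so that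
  polynomials in the entries give all regular functions, without inverting the determinant.\<close>

definition torus :: "(complex^'n^'n) set \<Rightarrow> bool" where
  "torus T \<longleftrightarrow> (\<exists>k \<phi>. bij_betw \<phi> (Gm k) T
     \<and> (\<forall>z\<in>Gm k. \<forall>w\<in>Gm k. \<phi> (\<lambda>i. z i * w i) = \<phi> z ** \<phi> w)
     \<and> (\<forall>P\<in>matrix_poly. \<exists>f\<in>laurent_poly k. \<forall>z\<in>Gm k. f z = P (\<phi> z))
     \<and> (\<forall>f\<in>laurent_poly k. \<exists>P\<in>matrix_poly. \<forall>z\<in>Gm k. P (\<phi> z) = f z))"

definition maximal_torus :: "(complex^'n^'n) set \<Rightarrow> (complex^'n^'n) set \<Rightarrow> bool" where
  "maximal_torus G T \<longleftrightarrow>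
     torus T \<and> T \<subseteq> G \<and> (\<forall>T'. torus T' \<and> T \<subseteq> T' \<and> T' \<subseteq> G \<longrightarrow> T' = T)"


section \<open>Character varieties of the free abelian group of rank two\<close>

type_synonym 'n rep = "int \<times> int \<Rightarrow> complex^'n^'n"

definition Hom :: "(complex^'n^'n) set \<Rightarrow> 'n rep set" where
  "Hom G = {\<rho>. (\<forall>x. \<rho> x \<in> G) \<and> (\<forall>x y. \<rho> (x + y) = \<rho> x ** \<rho> y)}"

text \<open>Polynomials in the entries of all the matrices \<open>\<rho> x\<close>. They are defined on arbitrary
  matrix-valued functions, so that a representation can be deformed to first order; restricted to
  \<open>Hom G\<close> they form its coordinate ring.\<close>

definition rep_poly :: "('n::finite rep \<Rightarrow> complex) set" where
  "rep_poly = algebra_gen {\<lambda>\<rho>. \<rho> x $ i $ j | x i j. True}"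

definition invariant_poly :: "(complex^'n^'n) set \<Rightarrow> ('n rep \<Rightarrow> complex) set" where
  "invariant_poly G = {F \<in> rep_poly. \<forall>\<rho>\<in>Hom G. \<forall>A\<in>G.
     F (\<lambda>x. A ** \<rho> x ** matrix_inv A) = F \<rho>}"

text \<open>The points of the GIT quotient are the classes of representations that are not separated by
  invariant regular functions.\<close>

definition git_class :: "(complex^'n^'n) set \<Rightarrow> 'n rep \<Rightarrow> 'n rep set" where
  "git_class G \<rho> = {\<sigma> \<in> Hom G. \<forall>F\<in>invariant_poly G. F \<sigma> = F \<rho>}"

definition X0 :: "(complex^'n^'n) set \<Rightarrow> (complex^'n^'n) set \<Rightarrow> 'n rep set set" where
  "X0 G T = git_class G ` Hom T"

definition dense_rep :: "(complex^'n^'n) set \<Rightarrow> 'n rep \<Rightarrow> bool" where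
  "dense_rep G \<rho> \<longleftrightarrow> (\<exists>T. maximal_torus G T \<and> zariski_dense_in (range \<rho>) T)"

definition X_dense :: "(complex^'n^'n) set \<Rightarrow> (complex^'n^'n) set \<Rightarrow> 'n rep set set" where
  "X_dense G T = {x \<in> X0 G T. \<exists>\<rho>\<in>x. dense_rep G \<rho>}"

text \<open>\<open>lifts G T f F\<close>: the invariant function \<open>F\<close> induces a regular function on the whole
  quotient that restricts to \<open>f\<close> on \<open>X0 G T\<close>.\<close>

definition lifts :: "(complex^'n^'n) set \<Rightarrow> (complex^'n^'n) set \<Rightarrow>
    ('n rep set \<Rightarrow> complex) \<Rightarrow> ('n rep \<Rightarrow> complex) \<Rightarrow> bool" where
  "lifts G T f F \<longleftrightarrow> F \<in> invariant_poly G \<and> (\<forall>x\<in>X0 G T. \<forall>\<rho>\<in>x. f x = F \<rho>)"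

definition coordinate_ring :: "(complex^'n^'n) set \<Rightarrow> (complex^'n^'n) set \<Rightarrow>
    ('n rep set \<Rightarrow> complex) set" where
  "coordinate_ring G T = {f \<in> extensional (X0 G T). \<exists>F. lifts G T f F}"

definition tau :: "(complex^'n^'n) set \<Rightarrow> (complex^'n^'n) set \<Rightarrow> int \<times> int \<Rightarrow>
    'n rep set \<Rightarrow> complex" where
  "tau G T g = (\<lambda>x\<in>X0 G T. the_elem ((\<lambda>\<rho>. trace (\<rho> g)) ` x))"


section \<open>The first cohomology group and the symplectic form\<close>

definition Ad :: "'n rep \<Rightarrow> int \<times> int \<Rightarrow> complex^'n^'n \<Rightarrow> complex^'n^'n" where
  "Ad \<rho> x A = \<rho> x ** A ** \<rho> (- x)"

definition Z1 :: "(complex^'n^'n) set \<Rightarrow> 'n rep \<Rightarrow> (int \<times> int \<Rightarrow> complex^'n^'n) set" where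
  "Z1 \<gg> \<rho> = {u. (\<forall>x. u x \<in> \<gg>) \<and> (\<forall>x y. u (x + y) = u x + Ad \<rho> x (u y))}"

definition H1 :: "(complex^'n^'n) set \<Rightarrow> 'n rep \<Rightarrow> (int \<times> int \<Rightarrow> complex^'n^'n) set set" where
  "H1 \<gg> \<rho> = Z1 \<gg> \<rho> // {(u, v). u \<in> Z1 \<gg> \<rho> \<and> v \<in> Z1 \<gg> \<rho>
     \<and> (\<exists>A\<in>\<gg>. \<forall>x. v x - u x = Ad \<rho> x A - A)}"

definition trace_form :: "complex \<Rightarrow> complex^'n^'n \<Rightarrow> complex^'n^'n \<Rightarrow> complex" where
  "trace_form c A B = c * trace (A ** B)"

text \<open>The 2-cocycle obtained from the cup product of two 1-cocycles by applying the form.\<close>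

definition cup :: "complex \<Rightarrow> 'n rep \<Rightarrow> (int \<times> int \<Rightarrow> complex^'n^'n) \<Rightarrow>
    (int \<times> int \<Rightarrow> complex^'n^'n) \<Rightarrow> int \<times> int \<Rightarrow> int \<times> int \<Rightarrow> complex" where
  "cup c \<rho> u v x y = trace_form c (u x) (Ad \<rho> x (v y))"

definition omega :: "complex \<Rightarrow> 'n rep \<Rightarrow> (int \<times> int \<Rightarrow> complex^'n^'n) set \<Rightarrow>
    (int \<times> int \<Rightarrow> complex^'n^'n) set \<Rightarrow> complex" where
  "omega c \<rho> h k = the_elem
     {cup c \<rho> u v (1, 0) (0, 1) - cup c \<rho> u v (0, 1) (1, 0) | u v. u \<in> h \<and> v \<in> k}"

text \<open>A cocycle \<open>u\<close> is the tangent vector at \<open>\<rho>\<close> given by the first-order deformation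
  \<open>(1 + t u) \<rho>\<close>. The differential of the quotient map sends it to the derivation
  \<open>tangent_map G T \<rho> [u]\<close> at the class of \<open>\<rho>\<close>, whose value on \<open>f\<close> is the derivative along
  \<open>u\<close> of an invariant function inducing \<open>f\<close>. At the representations in \<open>dense_rep G\<close> this map is
  an isomorphism from \<open>H1\<close> onto the tangent space of the character variety, and below tangent
  vectors are identified with elements of \<open>H1\<close> through it.\<close>

definition tangent_map :: "(complex^'n^'n) set \<Rightarrow> (complex^'n^'n) set \<Rightarrow> 'n rep \<Rightarrow>
    (int \<times> int \<Rightarrow> complex^'n^'n) set \<Rightarrow> ('n rep set \<Rightarrow> complex) \<Rightarrow> complex" where
  "tangent_map G T \<rho> h f = (THE d. \<exists>u\<in>h. \<exists>F. lifts G T f F \<and>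
     ((\<lambda>t. F (\<lambda>x. \<rho> x + mat t ** u x ** \<rho> x)) has_field_derivative d) (at 0))"


section \<open>The Poisson bracket\<close>

definition hamiltonian :: "(complex^'n^'n) set \<Rightarrow> (complex^'n^'n) set \<Rightarrow> (complex^'n^'n) set \<Rightarrow>
    complex \<Rightarrow> ('n rep set \<Rightarrow> complex) \<Rightarrow> 'n rep \<Rightarrow> (int \<times> int \<Rightarrow> complex^'n^'n) set" where
  "hamiltonian G \<gg> T c f \<rho> =
     (THE h. h \<in> H1 \<gg> \<rho> \<and> (\<forall>k\<in>H1 \<gg> \<rho>. omega c \<rho> h k = tangent_map G T \<rho> k f))"

definition bracket_at :: "(complex^'n^'n) set \<Rightarrow> (complex^'n^'n) set \<Rightarrow> (complex^'n^'n) set \<Rightarrow>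
    complex \<Rightarrow> ('n rep set \<Rightarrow> complex) \<Rightarrow> ('n rep set \<Rightarrow> complex) \<Rightarrow> 'n rep set \<Rightarrow> complex" where
  "bracket_at G \<gg> T c f g x = the_elem
     {omega c \<rho> (hamiltonian G \<gg> T c f \<rho>) (hamiltonian G \<gg> T c g \<rho>) | \<rho>. \<rho> \<in> x \<and> dense_rep G \<rho>}"

text \<open>The bracket is the regular function on \<open>X0 G T\<close> with the prescribed values on the Zariski
  dense subset \<open>X_dense G T\<close>.\<close>

definition poisson_bracket :: "(complex^'n^'n) set \<Rightarrow> (complex^'n^'n) set \<Rightarrow>
    (complex^'n^'n) set \<Rightarrow> complex \<Rightarrow> ('n rep set \<Rightarrow> complex) \<Rightarrow> ('n rep set \<Rightarrow> complex) \<Rightarrow>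
    'n rep set \<Rightarrow> complex" where
  "poisson_bracket G \<gg> T c f g =
     (THE h. h \<in> coordinate_ring G T \<and> (\<forall>x\<in>X_dense G T. h x = bracket_at G \<gg> T c f g x))"

end

theory Submission
  imports Defs
begin

text \<open>At a representation \<open>\<rho>\<close> that is dense in a maximal torus the image of \<open>\<rho>\<close> is diagonal in some
  basis, with pairwise different weights. Hence every cocycle is the sum of a coboundary and a
  homomorphism into the centralizer of \<open>\<rho>\<close> in \<open>\<gg>\<close>, on which the trace form is nondegenerate. Let
  \<open>S\<close> be the projection onto \<open>\<gg>\<close> that is orthogonal for the trace form. As the differential of \<open>\<tau>(p,q)\<close> maps \<open>v\<close> to the
  trace of \<open>v(p,q) \<rho>(p,q)\<close>, which is additive in \<open>(p,q)\<close>, the Hamiltonian vector field of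
  \<open>\<tau>(p,q)\<close> is the class of the homomorphism \<open>(a,b) \<mapsto> (a q - b p)/c S(\<rho>(p,q))\<close>, and
  \<open>\<omega>\<close> takes the value \<open>(p s - q r)/c tr (S(\<rho>(r,s)) \<rho>(p,q))\<close> on two of them. The formulas follow,
  because \<open>S(A) = A - tr(A)/n\<close> for \<open>SL\<close>, and \<open>S(A) = (A - inverse A)/2\<close> for \<open>A\<close> in \<open>SO\<close> or \<open>Sp\<close>.

  The derivative of \<open>\<tau>(p,q)\<close> does not depend on the invariant function that represents it, because
  all maximal tori are conjugate, so that curves of representations into any of them stay in \<open>X0\<close>.
  The bracket is determined by its values on \<open>X_dense\<close>, because generic elements of a torus generate
  Zariski dense subgroups.\<close>

text \<open>A torus is given only as an algebraic copy of \<open>Gm k\<close>, so its structure must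
  be proved. Its common eigenvectors span, which puts it inside the full diagonal group of an
  eigenbasis; that group is shown to be a torus of \<open>G\<close>, and maximality makes the two
  equal. For \<open>SO\<close> and \<open>Sp\<close> the eigenbasis must also be hyperbolic for the
  invariant form. Both are treated at once through \<open>transpose J = mat \<epsilon> ** J\<close>
  with \<epsilon> = 1 or -1. In the orthogonal case two such bases may differ by an isometry of
  determinant -1, so a determinant has to be adjusted before conjugacy inside \<open>SO\<close>
  follows. The second obstacle is that \<open>omega\<close>, \<open>tangent_map\<close>,
  \<open>hamiltonian\<close> and the brackets are descriptions by \<open>THE\<close> or
  \<open>the_elem\<close>; each needs independence of the cocycle, of the lift or of the
  representative. A lift is controlled only over the fixed torus, whereas \<rho> may be dense in
  another one. Coboundary directions need curves of conjugations. These are chosen rational in t: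
  the Cayley transform for \<open>SO\<close> and \<open>Sp\<close>, and 1 + tA for
  \<open>SL\<close>, which leaves \<open>SL\<close> but conjugates like an element of it.\<close>

section \<open>Inverses, scalar matrices and diagonal matrices\<close>

lemma matrix_inv_mult:
  fixes A :: "'a::field^'n^'n"
  assumes "invertible A"
  shows "A ** matrix_inv A = mat 1" "matrix_inv A ** A = mat 1"
  using someI_ex[OF assms[unfolded invertible_def]] unfolding matrix_inv_def by auto

lemma matrix_inv_cancel:
  fixes A :: "'a::field^'n^'n"
  assumes "invertible A"
  shows "A ** (matrix_inv A ** X) = X" "matrix_inv A ** (A ** X) = X"
  by (simp_all add: matrix_mul_assoc matrix_inv_mult[OF assms])

lemma matrix_inv_unique:
  fixes A :: "'a::field^'n^'n"
  assumes "A ** B = mat 1"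
  shows "invertible A" "matrix_inv A = B"
proof -
  show inv: "invertible A"
    using assms invertible_right_inverse by blast
  have "matrix_inv A = matrix_inv A ** (A ** B)"
    by (simp add: assms)
  then show "matrix_inv A = B"
    by (simp add: matrix_inv_cancel[OF inv])
qed

lemma matrix_inv_prod:
  fixes A B :: "'a::field^'n^'n"
  assumes "invertible A" "invertible B"
  shows "matrix_inv (A ** B) = matrix_inv B ** matrix_inv A"
proof (rule matrix_inv_unique(2))
  show "A ** B ** (matrix_inv B ** matrix_inv A) = mat 1"
    by (simp add: matrix_mul_assoc[symmetric] matrix_inv_cancel matrix_inv_mult assms)
qed

lemma invertible_matrix_inv:
  fixes A :: "'a::field^'n^'n"
  assumes "invertible A"
  shows "invertible (matrix_inv A)" "matrix_inv (matrix_inv A) = A"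
  using matrix_inv_unique[of "matrix_inv A" A] matrix_inv_mult[OF assms] by auto

lemma mat_mult_nth [simp]:
  "(mat a ** A) $ i $ j = a * (A $ i $ j :: 'a::semiring_1)"
  by (simp add: matrix_matrix_mult_def mat_def if_distrib[of "\<lambda>x. x * _"] cong: if_cong)

lemma mat_mult_commute: "A ** mat a = mat a ** (A :: 'a::comm_semiring_1^'n^'n)"
  by (simp add: vec_eq_iff)
     (simp add: matrix_matrix_mult_def mat_def if_distrib[of "\<lambda>x. _ * x"] mult.commute cong: if_cong)

lemma trace_mat_mult: "trace (mat a ** A) = a * trace A"
  by (simp add: trace_def sum_distrib_left)

lemma trace_conj:
  fixes A :: "'a::field^'n^'n"
  assumes "invertible A"
  shows "trace (A ** X ** matrix_inv A) = trace X"
proof -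
  have "trace (A ** X ** matrix_inv A) = trace (matrix_inv A ** (A ** X))"
    by (rule trace_mul_sym)
  then show ?thesis
    by (simp add: matrix_inv_cancel[OF assms])
qed

definition diag :: "('n \<Rightarrow> 'a::zero) \<Rightarrow> 'a^'n^'n" where
  "diag d = (\<chi> i j. if i = j then d i else 0)"

lemma diag_nth: "diag d $ i $ j = (if i = j then d i else 0)"
  by (simp add: diag_def)

lemma diag_mult_nth [simp]:
  fixes A :: "'a::semiring_1^'n^'n"
  shows "(diag d ** A) $ i $ j = d i * A $ i $ j"
  by (simp add: matrix_matrix_mult_def diag_nth if_distrib[of "\<lambda>x. x * _"] cong: if_cong)

lemma mult_diag_nth [simp]:
  fixes A :: "'a::semiring_1^'n^'n"
  shows "(A ** diag d) $ i $ j = A $ i $ j * d j"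
  by (simp add: matrix_matrix_mult_def diag_nth if_distrib[of "\<lambda>x. _ * x"] cong: if_cong)

lemma diag_mult: "diag d ** diag e = diag (\<lambda>i. d i * e i :: 'a::semiring_1)"
  by (simp add: vec_eq_iff) (simp add: diag_nth)

lemma diag_one: "diag (\<lambda>_. 1) = mat 1"
  by (simp add: diag_def mat_def)

lemma det_diag: "det (diag d) = (\<Prod>i\<in>UNIV. d i :: 'a::comm_ring_1)"
  by (subst det_diagonal) (simp_all add: diag_nth)

abbreviation conj_diag :: "'a::field^'n^'n \<Rightarrow> ('n \<Rightarrow> 'a) \<Rightarrow> 'a^'n^'n" where
  "conj_diag P d \<equiv> P ** diag d ** matrix_inv P"

lemma conj_diag_mult:
  fixes P :: "'a::field^'n^'n"
  assumes "invertible P"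
  shows "(conj_diag P d) ** (conj_diag P e)
    = conj_diag P (\<lambda>i. d i * e i)"
  by (simp add: matrix_mul_assoc[symmetric] matrix_inv_cancel[OF assms] flip: diag_mult)

lemma conj_conj_inv:
  fixes P :: "'a::field^'n^'n"
  assumes "invertible P"
  shows "matrix_inv P ** (P ** D ** matrix_inv P) ** P = D"
    "P ** (matrix_inv P ** D ** P) ** matrix_inv P = D"
  by (simp_all add: matrix_mul_assoc[symmetric] matrix_inv_cancel matrix_inv_mult assms)

section \<open>Generated algebras of functions\<close>

lemma algebra_gen_sum:
  assumes "finite I" "\<And>i. i \<in> I \<Longrightarrow> f i \<in> algebra_gen F"
  shows "(\<lambda>x. \<Sum>i\<in>I. f i x) \<in> algebra_gen F"
  using assms by (induction I rule: finite_induct) (auto intro: algebra_gen.intros)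

lemma algebra_gen_prod:
  assumes "finite I" "\<And>i. i \<in> I \<Longrightarrow> f i \<in> algebra_gen F"
  shows "(\<lambda>x. \<Prod>i\<in>I. f i x) \<in> algebra_gen F"
  using assms by (induction I rule: finite_induct) (auto intro: algebra_gen.intros)

lemma algebra_gen_comp:
  assumes "f \<in> algebra_gen F" "\<And>g. g \<in> F \<Longrightarrow> (\<lambda>x. g (h x)) \<in> algebra_gen F'"
  shows "(\<lambda>x. f (h x)) \<in> algebra_gen F'"
  using assms(1) by induction (auto intro: algebra_gen.intros assms(2))

text \<open>Parametrizations of tori are regular only on \<open>Gm k\<close>, and their inverses
  exist only on the image, so pulling back generators has to be possible relative to a
  subset.\<close>

lemma algebra_gen_comp_on:
  assumes "f \<in> algebra_gen F"
    and "\<And>g. g \<in> F \<Longrightarrow> \<exists>u\<in>algebra_gen F'. \<forall>x\<in>X. u x = g (h x)"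
  shows "\<exists>u\<in>algebra_gen F'. \<forall>x\<in>X. u x = f (h x)"
  using assms(1)
proof induction
  case (const a)
  then show ?case by (intro bexI[of _ "\<lambda>_. a"]) (auto intro: algebra_gen.intros)
next
  case (gen f)
  then show ?case by (rule assms(2))
next
  case (add f g)
  then obtain u v where "u \<in> algebra_gen F'" "v \<in> algebra_gen F'"
    "\<forall>x\<in>X. u x = f (h x)" "\<forall>x\<in>X. v x = g (h x)" by blast
  then show ?case by (intro bexI[of _ "\<lambda>x. u x + v x"]) (auto intro: algebra_gen.intros)
next
  case (mult f g)
  then obtain u v where "u \<in> algebra_gen F'" "v \<in> algebra_gen F'"
    "\<forall>x\<in>X. u x = f (h x)" "\<forall>x\<in>X. v x = g (h x)" by blast
  then show ?case by (intro bexI[of _ "\<lambda>x. u x * v x"]) (auto intro: algebra_gen.intros)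
qed

lemma algebra_gen_diff:
  assumes "f \<in> algebra_gen F" "g \<in> algebra_gen F"
  shows "(\<lambda>x. f x - g x) \<in> algebra_gen F"
  using algebra_gen.add[OF assms(1) algebra_gen.mult[OF algebra_gen.const[of "-1"] assms(2)]]
  by simp

lemma matrix_poly_nth: "(\<lambda>A. A $ i $ j) \<in> matrix_poly"
  unfolding matrix_poly_def by (auto intro: algebra_gen.gen)

lemma matrix_poly_conj_nth:
  fixes P Q :: "complex^'n^'n"
  shows "(\<lambda>A. (P ** A ** Q) $ i $ j) \<in> matrix_poly"
proof -
  have "(\<lambda>A. \<Sum>k\<in>UNIV. (\<Sum>l\<in>UNIV. P $ i $ l * A $ l $ k) * Q $ k $ j) \<in> matrix_poly"
    using matrix_poly_nth unfolding matrix_poly_def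
    by (intro algebra_gen_sum algebra_gen.mult algebra_gen.const) auto
  then show ?thesis
    by (simp add: matrix_matrix_mult_def)
qed

section \<open>Laurent monomials\<close>

definition laurent_monom :: "nat \<Rightarrow> (nat \<Rightarrow> int) \<Rightarrow> (nat \<Rightarrow> complex) \<Rightarrow> complex" where
  "laurent_monom k m z = (\<Prod>i<k. z i powi m i)"

lemma Gm_mult: "z \<in> Gm k \<Longrightarrow> w \<in> Gm k \<Longrightarrow> (\<lambda>i. z i * w i) \<in> Gm k"
  by (auto simp: Gm_def)

lemma laurent_monom_mult:
  "laurent_monom k m (\<lambda>i. z i * w i) = laurent_monom k m z * laurent_monom k m w"
  by (simp add: laurent_monom_def power_int_mult_distrib prod.distrib)

lemma laurent_monom_add:
  assumes "z \<in> Gm k"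
  shows "laurent_monom k (\<lambda>i. m i + m' i) z = laurent_monom k m z * laurent_monom k m' z"
  using assms by (simp add: laurent_monom_def Gm_def power_int_add prod.distrib)

lemma laurent_monom_uminus:
  "laurent_monom k (\<lambda>i. - m i) z = inverse (laurent_monom k m z)"
  by (simp add: laurent_monom_def power_int_minus flip: prod_inversef)

lemma laurent_monom_nonzero: "z \<in> Gm k \<Longrightarrow> laurent_monom k m z \<noteq> 0"
  by (auto simp: laurent_monom_def Gm_def)

text \<open>Exponents vanish from \<open>k\<close> on, so that different exponents give different
  characters of \<open>Gm k\<close> and coefficients can be compared.\<close>

definition laurent_expands where
  "laurent_expands k f \<longleftrightarrow> (\<exists>M c. finite M \<and> (\<forall>m\<in>M. \<forall>i\<ge>k. m i = 0) \<and>
     (\<forall>z\<in>Gm k. f z = (\<Sum>m\<in>M. c m * laurent_monom k m z)))"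

text \<open>Terms with equal exponents are collected. Allowing repetitions in the index set makes
  sums a matter of disjoint unions and products a matter of cartesian products.\<close>

lemma laurent_expandsI:
  assumes "finite I" "\<And>x. x \<in> I \<Longrightarrow> \<forall>i\<ge>k. e x i = 0"
    and f: "\<And>z. z \<in> Gm k \<Longrightarrow> f z = (\<Sum>x\<in>I. b x * laurent_monom k (e x) z)"
  shows "laurent_expands k f"
  unfolding laurent_expands_def
proof (intro exI conjI ballI)
  show "finite (e ` I)" using assms by simp
  show "\<forall>i\<ge>k. m i = 0" if "m \<in> e ` I" for m using that assms(2) by auto
  show "f z = (\<Sum>m\<in>e ` I. (\<Sum>x\<in>{x\<in>I. e x = m}. b x) * laurent_monom k m z)" if "z \<in> Gm k" for z
    unfolding f[OF that] sum.image_gen[OF assms(1), of "\<lambda>x. b x * laurent_monom k (e x) z" e]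
    by (intro sum.cong refl) (auto simp: sum_distrib_right intro!: sum.cong)
qed

lemma laurent_poly_expands:
  assumes "f \<in> laurent_poly k"
  shows "laurent_expands k f"
  using assms unfolding laurent_poly_def
proof induction
  case (const a)
  show ?case
    by (rule laurent_expandsI[of "{()}" k "\<lambda>_ _. 0" _ "\<lambda>_. a"]) (auto simp: laurent_monom_def)
next
  case (gen f)
  have *: "laurent_monom k (\<lambda>j. if j = i then e else 0) z = z i powi e" if "i < k" for i e z
  proof -
    have "laurent_monom k (\<lambda>j. if j = i then e else 0) z = (\<Prod>j<k. if j = i then z j powi e else 1)"
      unfolding laurent_monom_def by (intro prod.cong) auto
    then show ?thesis using that by simp
  qed
  from gen consider i where "i < k" "f = (\<lambda>z. z i)" | i where "i < k" "f = (\<lambda>z. inverse (z i))"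
    by blast
  then show ?case
  proof cases
    case (1 i)
    then show ?thesis
      by (intro laurent_expandsI[of "{()}" k "\<lambda>_ j. if j = i then 1 else 0" _ "\<lambda>_. 1"])
         (simp_all add: * )
  next
    case (2 i)
    then show ?thesis
      by (intro laurent_expandsI[of "{()}" k "\<lambda>_ j. if j = i then -1 else 0" _ "\<lambda>_. 1"])
         (simp_all add: * power_int_minus)
  qed
next
  case (add f g)
  obtain M c where f: "finite M" "\<forall>m\<in>M. \<forall>i\<ge>k. m i = 0"
    "\<forall>z\<in>Gm k. f z = (\<Sum>m\<in>M. c m * laurent_monom k m z)"
    using add.IH(1) unfolding laurent_expands_def by (elim exE conjE)
  obtain M' c' where g: "finite M'" "\<forall>m\<in>M'. \<forall>i\<ge>k. m i = 0"
    "\<forall>z\<in>Gm k. g z = (\<Sum>m\<in>M'. c' m * laurent_monom k m z)"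
    using add.IH(2) unfolding laurent_expands_def by (elim exE conjE)
  show ?case
  proof (rule laurent_expandsI)
    show "finite (M <+> M')" using f(1) g(1) by simp
    show "\<forall>i\<ge>k. case_sum id id x i = 0" if "x \<in> M <+> M'" for x
      using that f(2) g(2) by (elim PlusE) simp_all
    show "f z + g z = (\<Sum>x\<in>M <+> M'. case_sum c c' x * laurent_monom k (case_sum id id x) z)"
      if "z \<in> Gm k" for z
      by (simp add: sum.Plus f(1) g(1) bspec[OF f(3) that] bspec[OF g(3) that])
  qed
next
  case (mult f g)
  obtain M c where f: "finite M" "\<forall>m\<in>M. \<forall>i\<ge>k. m i = 0"
    "\<forall>z\<in>Gm k. f z = (\<Sum>m\<in>M. c m * laurent_monom k m z)"
    using mult.IH(1) unfolding laurent_expands_def by (elim exE conjE)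
  obtain M' c' where g: "finite M'" "\<forall>m\<in>M'. \<forall>i\<ge>k. m i = 0"
    "\<forall>z\<in>Gm k. g z = (\<Sum>m\<in>M'. c' m * laurent_monom k m z)"
    using mult.IH(2) unfolding laurent_expands_def by (elim exE conjE)
  show ?case
  proof (rule laurent_expandsI)
    show "finite (M \<times> M')" using f(1) g(1) by simp
    show "\<forall>i\<ge>k. (\<lambda>i. fst x i + snd x i) i = 0" if "x \<in> M \<times> M'" for x
      using that bspec[OF f(2), of "fst x"] bspec[OF g(2), of "snd x"] by auto
    show "f z * g z = (\<Sum>x\<in>M \<times> M'. (c (fst x) * c' (snd x)) *
            laurent_monom k (\<lambda>i. fst x i + snd x i) z)"
      if "z \<in> Gm k" for z
      unfolding bspec[OF f(3) that] bspec[OF g(3) that] sum_product sum.cartesian_product case_prod_beta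
      by (intro sum.cong refl) (simp add: laurent_monom_add[OF that])
  qed
qed

text \<open>Artin's argument: comparing the relation at \<open>p x y\<close> with \<open>ch m0 y\<close> times the relation at \<open>x\<close>
  eliminates \<open>m0\<close>.\<close>

lemma independence_of_characters:
  fixes ch :: "'m \<Rightarrow> 'x \<Rightarrow> 'a::field"
  assumes "finite M"
    and closed: "\<And>x y. x \<in> X \<Longrightarrow> y \<in> X \<Longrightarrow> p x y \<in> X"
    and hom: "\<And>m x y. m \<in> M \<Longrightarrow> x \<in> X \<Longrightarrow> y \<in> X \<Longrightarrow> ch m (p x y) = ch m x * ch m y"
    and distinct: "\<And>m m'. m \<in> M \<Longrightarrow> m' \<in> M \<Longrightarrow> m \<noteq> m' \<Longrightarrow> \<exists>x\<in>X. ch m x \<noteq> ch m' x"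
    and nonzero: "\<And>m. m \<in> M \<Longrightarrow> \<exists>x\<in>X. ch m x \<noteq> 0"
    and rel: "\<And>x. x \<in> X \<Longrightarrow> (\<Sum>m\<in>M. a m * ch m x) = 0"
    and "m \<in> M"
  shows "a m = 0"
  using assms(1) hom distinct nonzero rel \<open>m \<in> M\<close>
proof (induction M arbitrary: a m rule: finite_induct)
  case empty
  then show ?case by simp
next
  case (insert m0 M)
  have *: "a m = 0" if m: "m \<in> M" for m
  proof -
    have "m \<noteq> m0" using m insert.hyps by auto
    then obtain y where y: "y \<in> X" "ch m y \<noteq> ch m0 y"
      using insert.prems(2)[of m m0] m by blast
    have "a m * (ch m y - ch m0 y) = 0"
    proof (rule insert.IH[of "\<lambda>m. a m * (ch m y - ch m0 y)"])
      fix x assume x: "x \<in> X"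
      have "(\<Sum>m\<in>insert m0 M. a m * ch m (p x y)) - ch m0 y * (\<Sum>m\<in>insert m0 M. a m * ch m x) = 0"
        using insert.prems(4)[OF x] insert.prems(4)[OF closed[OF x y(1)]] by simp
      also have "(\<Sum>m\<in>insert m0 M. a m * ch m (p x y)) = (\<Sum>m\<in>insert m0 M. a m * ch m x * ch m y)"
        using insert.prems(1) x y by (intro sum.cong) auto
      finally show "(\<Sum>m\<in>M. a m * (ch m y - ch m0 y) * ch m x) = 0"
        using insert.hyps
        by (simp add: algebra_simps sum_distrib_left sum_subtractf)
    qed (use insert.prems m in auto)
    then show ?thesis using y by simp
  qed
  have "a m0 = 0"
  proof -
    obtain x where x: "x \<in> X" "ch m0 x \<noteq> 0" using insert.prems(3) by blast
    have "(\<Sum>m\<in>M. a m * ch m x) = 0" using * by simp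
    then show ?thesis using insert.prems(4)[OF x(1)] insert.hyps x by simp
  qed
  with * insert.prems(5) show ?case by auto
qed

lemma laurent_monom_independent:
  assumes "finite M" "\<And>m. m \<in> M \<Longrightarrow> \<forall>i\<ge>k. m i = 0"
    and "\<And>z. z \<in> Gm k \<Longrightarrow> (\<Sum>m\<in>M. a m * laurent_monom k m z) = 0"
    and "m \<in> M"
  shows "a m = 0"
proof (rule independence_of_characters[of M "Gm k" "\<lambda>z w i. z i * w i" "laurent_monom k" a m])
  show "\<exists>z\<in>Gm k. laurent_monom k m z \<noteq> laurent_monom k m' z"
    if "m \<in> M" "m' \<in> M" "m \<noteq> m'" for m m'
  proof -
    obtain i where i: "m i \<noteq> m' i" using \<open>m \<noteq> m'\<close> by blast
    then have "i < k" using assms(2) that by (metis linorder_not_less)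
    \<comment> \<open>As 2 is not a root of unity, this point separates any two exponents that
      differ at \<open>i\<close>.\<close>
    let ?z = "\<lambda>j. if j = i then 2 else 1 :: complex"
    have "?z \<in> Gm k" using \<open>i < k\<close> by (auto simp: Gm_def)
    moreover have "laurent_monom k n ?z = 2 powi n i" for n
    proof -
      have "laurent_monom k n ?z = (\<Prod>j<k. if j = i then 2 powi n j else 1)"
        unfolding laurent_monom_def by (intro prod.cong) auto
      then show ?thesis using \<open>i < k\<close> by simp
    qed
    moreover have "(2::complex) powi m i \<noteq> 2 powi m' i"
    proof
      assume "(2::complex) powi m i = 2 powi m' i"
      then have "norm ((2::complex) powi m i) = norm ((2::complex) powi m' i)" by simp
      then have "(2::real) powi m i = 2 powi m' i" by (simp add: norm_power_int)
      then show False
        using i power_int_strict_increasing[of "m i" "m' i" "2::real"]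
          power_int_strict_increasing[of "m' i" "m i" "2::real"] by linarith
    qed
    ultimately show ?thesis by (metis (no_types, lifting))
  qed
  show "\<exists>z\<in>Gm k. laurent_monom k m z \<noteq> 0" for m
    by (rule bexI[of _ "\<lambda>_. 1"]) (auto simp: laurent_monom_def Gm_def)
  show "(\<Sum>m\<in>M. a m * laurent_monom k m z) = 0" if "z \<in> Gm k" for z
    by (rule assms(3)[OF that])
qed (simp_all add: laurent_monom_mult Gm_mult assms(1,4))

section \<open>Tori\<close>

lemma Gm_one: "(\<lambda>_. 1) \<in> Gm k"
  by (auto simp: Gm_def)

definition torus_param :: "nat \<Rightarrow> ((nat \<Rightarrow> complex) \<Rightarrow> complex^'n^'n) \<Rightarrow> (complex^'n^'n) set \<Rightarrow> bool" where
  "torus_param k \<phi> T \<longleftrightarrow> bij_betw \<phi> (Gm k) T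
     \<and> (\<forall>z\<in>Gm k. \<forall>w\<in>Gm k. \<phi> (\<lambda>i. z i * w i) = \<phi> z ** \<phi> w)
     \<and> (\<forall>P\<in>matrix_poly. \<exists>f\<in>laurent_poly k. \<forall>z\<in>Gm k. f z = P (\<phi> z))
     \<and> (\<forall>f\<in>laurent_poly k. \<exists>P\<in>matrix_poly. \<forall>z\<in>Gm k. P (\<phi> z) = f z)"

lemma torus_iff_param: "torus T \<longleftrightarrow> (\<exists>k \<phi>. torus_param k \<phi> T)"
  unfolding torus_def torus_param_def by simp

lemma torus_param_image: "torus_param k \<phi> T \<Longrightarrow> T = \<phi> ` Gm k"
  unfolding torus_param_def bij_betw_def by simp

lemma torus_param_mult:
  "torus_param k \<phi> T \<Longrightarrow> z \<in> Gm k \<Longrightarrow> w \<in> Gm k \<Longrightarrow> \<phi> (\<lambda>i. z i * w i) = \<phi> z ** \<phi> w"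
  unfolding torus_param_def by simp

lemma torus_param_pull:
  "torus_param k \<phi> T \<Longrightarrow> P \<in> matrix_poly \<Longrightarrow> \<exists>f\<in>laurent_poly k. \<forall>z\<in>Gm k. f z = P (\<phi> z)"
  unfolding torus_param_def by simp

lemma torus_mult_closed:
  assumes "torus T" "A \<in> T" "B \<in> T"
  shows "A ** B \<in> T"
proof -
  obtain k \<phi> where p: "torus_param k \<phi> T"
    using assms(1) torus_iff_param by blast
  obtain z w where zw: "z \<in> Gm k" "w \<in> Gm k" "A = \<phi> z" "B = \<phi> w"
    using assms(2,3) torus_param_image[OF p] by blast
  then have "A ** B = \<phi> (\<lambda>i. z i * w i)"
    using torus_param_mult[OF p] by simp
  then show ?thesis
    using imageI[OF Gm_mult[OF zw(1,2)], of \<phi>] torus_param_image[OF p] by simp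
qed

text \<open>Roots are taken coordinatewise in \<open>Gm k\<close>; \<open>csqrt 1 = 1\<close>
  respects the padding by 1. This divisibility is what later excludes characters with values
  \<plusminus>1.\<close>

lemma torus_sqrt:
  assumes "torus T" "A \<in> T"
  shows "\<exists>B\<in>T. A = B ** B"
proof -
  obtain k \<phi> where p: "torus_param k \<phi> T"
    using assms(1) torus_iff_param by blast
  obtain z where z: "z \<in> Gm k" "A = \<phi> z"
    using assms(2) torus_param_image[OF p] by blast
  let ?w = "\<lambda>i. csqrt (z i)"
  have w: "?w \<in> Gm k" using z by (auto simp: Gm_def)
  have "(\<lambda>i. ?w i * ?w i) = z" by (simp add: fun_eq_iff flip: power2_eq_square)
  then have "\<phi> z = \<phi> ?w ** \<phi> ?w" using torus_param_mult[OF p w w] by simp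
  then show ?thesis using z w torus_param_image[OF p] by blast
qed

text \<open>Multiplicativity alone would allow a singular idempotent as the unit of a torus; an
  invertible idempotent is the identity.\<close>

lemma torus_param_one:
  assumes p: "torus_param k \<phi> T" and inv: "\<And>A. A \<in> T \<Longrightarrow> invertible A"
  shows "\<phi> (\<lambda>_. 1) = mat 1"
proof -
  have "\<phi> (\<lambda>_. 1) ** \<phi> (\<lambda>_. 1) = \<phi> (\<lambda>_. 1)"
    using torus_param_mult[OF p Gm_one Gm_one] by simp
  moreover have "invertible (\<phi> (\<lambda>_. 1))"
    using inv torus_param_image[OF p] Gm_one by blast
  ultimately show ?thesis
    by (metis matrix_inv_cancel(2) matrix_inv_mult(2))
qed

text \<open>Every entry has its own finite set of exponents. Over their union, with coefficients
  padded by 0, the parametrization becomes one Laurent polynomial with matrix coefficients, which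
  turn out to be the projections onto the weight spaces.\<close>

lemma torus_param_expand:
  assumes p: "torus_param k \<phi> (T :: (complex^'n^'n) set)"
  obtains M and C :: "(nat \<Rightarrow> int) \<Rightarrow> complex^'n^'n" where "finite M" "\<And>m. m \<in> M \<Longrightarrow> \<forall>i\<ge>k. m i = 0"
    and "\<And>z. z \<in> Gm k \<Longrightarrow> \<phi> z = (\<Sum>m\<in>M. mat (laurent_monom k m z) ** C m)"
proof -
  have "\<exists>M c. finite M \<and> (\<forall>m\<in>M. \<forall>l\<ge>k. m l = 0) \<and>
     (\<forall>z\<in>Gm k. \<phi> z $ i $ j = (\<Sum>m\<in>M. c m * laurent_monom k m z))" for i j
  proof -
    obtain f where f: "f \<in> laurent_poly k" "\<And>z. z \<in> Gm k \<Longrightarrow> f z = \<phi> z $ i $ j"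
      using torus_param_pull[OF p matrix_poly_nth[of i j]] by auto
    then show ?thesis
      using laurent_poly_expands[OF f(1)] unfolding laurent_expands_def by simp
  qed
  then obtain M c where Mc: "\<And>i j. finite (M i j)" "\<And>i j. \<forall>m\<in>M i j. \<forall>l\<ge>k. m l = 0"
    "\<And>i j. \<forall>z\<in>Gm k. \<phi> z $ i $ j = (\<Sum>m\<in>M i j. c i j m * laurent_monom k m z)"
    by metis
  let ?M = "\<Union>i. \<Union>j. M i j"
  let ?C = "\<lambda>m. \<chi> i j. if m \<in> M i j then c i j m else 0"
  have fin: "finite ?M" using Mc(1) by simp
  show thesis
  proof
    show "finite ?M" by fact
    show "\<forall>i\<ge>k. m i = 0" if "m \<in> ?M" for m using that Mc(2) by blast
    show "\<phi> z = (\<Sum>m\<in>?M. mat (laurent_monom k m z) ** ?C m)" if "z \<in> Gm k" for z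
    proof -
      have "\<phi> z $ i $ j = (\<Sum>m\<in>?M. mat (laurent_monom k m z) ** ?C m) $ i $ j" for i j
      proof -
        have "\<phi> z $ i $ j = (\<Sum>m\<in>M i j. laurent_monom k m z * c i j m)"
          using bspec[OF Mc(3) that] by (simp add: mult.commute)
        also have "\<dots> = (\<Sum>m\<in>?M. laurent_monom k m z * (if m \<in> M i j then c i j m else 0))"
          by (intro sum.mono_neutral_cong_left fin) auto
        finally show ?thesis by simp
      qed
      then show ?thesis by (simp add: vec_eq_iff)
    qed
  qed
qed

section \<open>Tori are diagonalizable, and diagonal tori\<close>

definition common_eigenvectors :: "('a::field^'n^'n) set \<Rightarrow> ('a^'n) set" where
  "common_eigenvectors T = {v. \<forall>A\<in>T. \<exists>a. A *v v = a *s v}"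

lemma mat_mult_vector: "(mat a ** A) *v x = a *s (A *v (x :: 'a::comm_semiring_1^'n))"
  by (simp add: vec_eq_iff matrix_vector_mult_def sum_distrib_left mult.assoc)

lemma sum_mult_vector: "(\<Sum>m\<in>M. B m) *v x = (\<Sum>m\<in>M. B m *v (x :: 'a::comm_semiring_1^'n))"
  by (induction M rule: infinite_finite_induct) (simp_all add: matrix_vector_mult_add_rdistrib)

lemma matrix_mult_add_rdistrib: "(A + B) ** C = A ** C + B ** (C :: 'a::semiring_1^'n^'n)"
  by (simp add: vec_eq_iff matrix_matrix_mult_def sum.distrib distrib_right)

lemma sum_matrix_mult: "(\<Sum>m\<in>M. B m) ** (X :: 'a::semiring_1^'n^'n) = (\<Sum>m\<in>M. B m ** X)"
  by (induction M rule: infinite_finite_induct) (simp_all add: matrix_mult_add_rdistrib)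

lemma matrix_mult_sum: "(X :: 'a::semiring_1^'n^'n) ** (\<Sum>m\<in>M. B m) = (\<Sum>m\<in>M. X ** B m)"
  by (induction M rule: infinite_finite_induct) (simp_all add: matrix_add_ldistrib)

text \<open>Comparing coefficients in \<open>\<phi> (z * w) = \<phi> z ** \<phi> w\<close> shows that the coefficient matrices
  of \<open>\<phi>\<close> are orthogonal idempotents.\<close>

lemma torus_eigenvectors_span:
  fixes T :: "(complex^'n^'n) set"
  assumes T: "torus T" and inv: "\<And>A. A \<in> T \<Longrightarrow> invertible A"
  shows "vec.span (common_eigenvectors T) = UNIV"
proof -
  obtain k \<phi> where p: "torus_param k \<phi> T"
    using T torus_iff_param by blast
  obtain M C where fin: "finite M" and M: "\<And>m. m \<in> M \<Longrightarrow> \<forall>i\<ge>k. m i = 0"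
    and \<phi>: "\<And>z. z \<in> Gm k \<Longrightarrow> \<phi> z = (\<Sum>m\<in>M. mat (laurent_monom k m z) ** C m)"
    using torus_param_expand[OF p] by blast
  \<comment> \<open>Coefficients are compared in \<open>z\<close> for fixed \<open>w\<close>, which
    shows that \<open>\<phi> w\<close> acts on the range of \<open>C m\<close> by a scalar from the
    right; \<open>\<phi> w\<close> is then expanded again.\<close>
  have coeff: "(\<Sum>m'\<in>M. mat (laurent_monom k m' w) ** (C m ** C m')) = mat (laurent_monom k m w) ** C m"
    if "m \<in> M" "w \<in> Gm k" for m w
  proof -
    let ?X = "\<lambda>m. C m ** \<phi> w - mat (laurent_monom k m w) ** C m"
    have "?X m $ i $ j = 0" for i j
    proof (rule laurent_monom_independent[OF fin M _ \<open>m \<in> M\<close>])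
      fix z assume z: "z \<in> Gm k"
      have "(\<Sum>m\<in>M. mat (laurent_monom k m z) ** (C m ** \<phi> w)) = \<phi> z ** \<phi> w"
        by (simp add: \<phi>[OF z] sum_matrix_mult matrix_mul_assoc)
      also have "\<dots> = \<phi> (\<lambda>i. z i * w i)"
        using torus_param_mult[OF p z that(2)] by simp
      also have "\<dots> = (\<Sum>m\<in>M. mat (laurent_monom k m z) ** (mat (laurent_monom k m w) ** C m))"
        unfolding \<phi>[OF Gm_mult[OF z that(2)]]
        by (intro sum.cong refl) (simp add: vec_eq_iff laurent_monom_mult mult.assoc)
      finally have eq: "(\<Sum>m\<in>M. mat (laurent_monom k m z) ** (C m ** \<phi> w)) $ i $ j =
        (\<Sum>m\<in>M. mat (laurent_monom k m z) ** (mat (laurent_monom k m w) ** C m)) $ i $ j"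
        by simp
      show "(\<Sum>m\<in>M. ?X m $ i $ j * laurent_monom k m z) = 0"
        using eq by (simp add: algebra_simps sum_subtractf)
    qed auto
    then have "C m ** \<phi> w = mat (laurent_monom k m w) ** C m"
      by (simp add: vec_eq_iff)
    then show ?thesis
      unfolding \<phi>[OF that(2)] matrix_mult_sum
      by (simp add: matrix_mul_assoc mat_mult_commute)
  qed
  \<comment> \<open>The second comparison of coefficients, now in \<open>w\<close>.\<close>
  have ortho: "C m ** C m' = (if m' = m then C m else 0)" if "m \<in> M" "m' \<in> M" for m m'
  proof -
    let ?X = "\<lambda>m'. C m ** C m' - (if m' = m then C m else 0)"
    have "?X m' $ i $ j = 0" for i j
    proof (rule laurent_monom_independent[OF fin M _ \<open>m' \<in> M\<close>])
      fix w assume w: "w \<in> Gm k"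
      have "(\<Sum>m'\<in>M. (if m' = m then C m else 0) $ i $ j * laurent_monom k m' w)
        = (\<Sum>m'\<in>M. if m' = m then C m $ i $ j * laurent_monom k m' w else 0)"
        by (intro sum.cong) auto
      also have "\<dots> = C m $ i $ j * laurent_monom k m w"
        using fin \<open>m \<in> M\<close> by simp
      finally show "(\<Sum>m'\<in>M. ?X m' $ i $ j * laurent_monom k m' w) = 0"
        using arg_cong[OF coeff[OF \<open>m \<in> M\<close> w], of "\<lambda>A. A $ i $ j"]
        by (simp add: left_diff_distrib sum_subtractf mult.commute[of "laurent_monom _ _ _"])
    qed auto
    then show ?thesis by (simp add: vec_eq_iff)
  qed
  have ev: "C m *v x \<in> common_eigenvectors T" if "m \<in> M" for m x
    unfolding common_eigenvectors_def
  proof (intro CollectI ballI)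
    fix A assume "A \<in> T"
    then obtain z where z: "z \<in> Gm k" "A = \<phi> z"
      using torus_param_image[OF p] by blast
    have "A ** C m = (\<Sum>m'\<in>M. mat (laurent_monom k m' z) ** (C m' ** C m))"
      unfolding z(2) \<phi>[OF z(1)] sum_matrix_mult by (simp add: matrix_mul_assoc)
    also have "\<dots> = (\<Sum>m'\<in>M. if m' = m then mat (laurent_monom k m' z) ** C m else 0)"
      by (intro sum.cong refl) (auto simp: ortho that)
    also have "\<dots> = mat (laurent_monom k m z) ** C m"
      using fin that by simp
    finally have "A *v (C m *v x) = laurent_monom k m z *s (C m *v x)"
      by (metis mat_mult_vector matrix_vector_mul_assoc)
    then show "\<exists>a. A *v (C m *v x) = a *s (C m *v x)" by blast
  qed
  \<comment> \<open>At the unit all monomials are 1, so the \<open>C m\<close> sum to the identity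
    and split \<open>x\<close> into eigenvectors.\<close>
  have "x \<in> vec.span (common_eigenvectors T)" for x
  proof -
    have "x = \<phi> (\<lambda>_. 1) *v x"
      using torus_param_one[OF p inv] by simp
    also have "\<dots> = (\<Sum>m\<in>M. 1 *s (C m *v x))"
      unfolding \<phi>[OF Gm_one] sum_mult_vector mat_mult_vector by (simp add: laurent_monom_def)
    finally show ?thesis
      using ev by (metis (no_types, lifting) vec.span_base vec.span_scale vec.span_sum)
  qed
  then show ?thesis by blast
qed

text \<open>Regularity in both directions can be tested on the diagonal entries
  \<open>\<psi> z\<close>. The reciprocals of the coordinates need a hypothesis of their own, since
  polynomials in matrix entries contain no reciprocals.\<close>

lemma torus_conj_diag:
  fixes P :: "complex^'n^'n" and \<psi> :: "(nat \<Rightarrow> complex) \<Rightarrow> 'n \<Rightarrow> complex"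
  assumes P: "invertible P"
    and mult: "\<And>z w i. z \<in> Gm k \<Longrightarrow> w \<in> Gm k \<Longrightarrow> \<psi> (\<lambda>i. z i * w i) i = \<psi> z i * \<psi> w i"
    and laurent: "\<And>i. \<exists>f\<in>laurent_poly k. \<forall>z\<in>Gm k. f z = \<psi> z i"
    and coord: "\<And>j. j < k \<Longrightarrow> \<exists>Q\<in>algebra_gen {\<lambda>d. d i |i. True}. \<forall>z\<in>Gm k. Q (\<psi> z) = z j"
    and inv_coord: "\<And>j. j < k \<Longrightarrow> \<exists>Q\<in>algebra_gen {\<lambda>d. d i |i. True}. \<forall>z\<in>Gm k. Q (\<psi> z) = inverse (z j)"
  shows "torus ((\<lambda>z. conj_diag P (\<psi> z)) ` Gm k)"
proof -
  let ?\<phi> = "\<lambda>z. conj_diag P (\<psi> z)"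
  \<comment> \<open>A polynomial map on all matrices that recovers \<open>\<psi> z\<close> from
    \<open>?\<phi> z\<close>.\<close>
  let ?c = "\<lambda>A i. (matrix_inv P ** A ** P) $ i $ i"
  have c: "?c (?\<phi> z) = \<psi> z" for z
    by (simp add: conj_conj_inv[OF P] diag_nth fun_eq_iff)
  have pull: "\<exists>R\<in>matrix_poly. \<forall>A. R A = Q (?c A)" if "Q \<in> algebra_gen {\<lambda>d. d i |i. True}" for Q
  proof (intro bexI[of _ "\<lambda>A. Q (?c A)"])
    show "(\<lambda>A. Q (?c A)) \<in> matrix_poly"
      using matrix_poly_conj_nth unfolding matrix_poly_def
      by (intro algebra_gen_comp[OF that]) auto
  qed simp
  have inj: "inj_on ?\<phi> (Gm k)"
  proof (rule inj_onI)
    fix z w assume zw: "z \<in> Gm k" "w \<in> Gm k" "?\<phi> z = ?\<phi> w"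
    then have "\<psi> z = \<psi> w" by (metis c)
    then have "z j = w j" if "j < k" for j
      using coord[OF that] zw by metis
    moreover have "z j = w j" if "\<not> j < k" for j
      using zw that by (simp add: Gm_def)
    ultimately show "z = w" by blast
  qed
  have "torus_param k ?\<phi> (?\<phi> ` Gm k)"
    unfolding torus_param_def
  proof (intro conjI ballI)
    show "bij_betw ?\<phi> (Gm k) (?\<phi> ` Gm k)" using inj by (rule inj_on_imp_bij_betw)
    show "?\<phi> (\<lambda>i. z i * w i) = ?\<phi> z ** ?\<phi> w" if "z \<in> Gm k" "w \<in> Gm k" for z w
      unfolding conj_diag_mult[OF P] mult[OF that, abs_def, symmetric] by simp
    show "\<exists>f\<in>laurent_poly k. \<forall>z\<in>Gm k. f z = R (?\<phi> z)" if "R \<in> matrix_poly" for R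
      unfolding laurent_poly_def
    proof (rule algebra_gen_comp_on[OF that[unfolded matrix_poly_def]])
      fix g :: "complex^'n^'n \<Rightarrow> complex" assume "g \<in> {\<lambda>A. A $ i $ j |i j. True}"
      then obtain i j where g: "g = (\<lambda>A. A $ i $ j)" by blast
      obtain f where f: "\<And>l. f l \<in> laurent_poly k" "\<And>l z. z \<in> Gm k \<Longrightarrow> f l z = \<psi> z l"
        using laurent by metis
      have *: "(\<lambda>z. \<Sum>l\<in>UNIV. P $ i $ l * f l z * matrix_inv P $ l $ j) \<in> laurent_poly k"
        using f(1) unfolding laurent_poly_def
        by (intro algebra_gen_sum algebra_gen.mult algebra_gen.const) auto
      have "(\<Sum>l\<in>UNIV. P $ i $ l * f l z * matrix_inv P $ l $ j) = g (?\<phi> z)"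
        if "z \<in> Gm k" for z
        unfolding g by (subst matrix_matrix_mult_def) (simp add: f(2)[OF that])
      then show "\<exists>u\<in>algebra_gen ({\<lambda>z. z i |i. i < k} \<union> {\<lambda>z. inverse (z i) |i. i < k}).
          \<forall>z\<in>Gm k. u z = g (?\<phi> z)"
        by (intro bexI[OF _ *[unfolded laurent_poly_def]]) simp
    qed
    show "\<exists>R\<in>matrix_poly. \<forall>z\<in>Gm k. R (?\<phi> z) = f z" if "f \<in> laurent_poly k" for f
    proof -
      have "\<exists>R\<in>matrix_poly. \<forall>A\<in>?\<phi> ` Gm k. R A = f (inv_into (Gm k) ?\<phi> A)"
        unfolding matrix_poly_def
      proof (rule algebra_gen_comp_on[OF that[unfolded laurent_poly_def]])
        fix g :: "(nat \<Rightarrow> complex) \<Rightarrow> complex"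
        assume g: "g \<in> {\<lambda>z. z i |i. i < k} \<union> {\<lambda>z. inverse (z i) |i. i < k}"
        have "\<exists>Q\<in>algebra_gen {\<lambda>d. d i |i. True}. \<forall>z\<in>Gm k. Q (\<psi> z) = g z"
          using g
        proof
          assume "g \<in> {\<lambda>z. z i |i. i < k}"
          then obtain j where "j < k" "g = (\<lambda>z. z j)" by blast
          then show ?thesis using coord[of j] by simp
        next
          assume "g \<in> {\<lambda>z. inverse (z i) |i. i < k}"
          then obtain j where "j < k" "g = (\<lambda>z. inverse (z j))" by blast
          then show ?thesis using inv_coord[of j] by simp
        qed
        then obtain Q where Q: "Q \<in> algebra_gen {\<lambda>d. d i |i. True}" "\<forall>z\<in>Gm k. Q (\<psi> z) = g z"
          by (elim bexE)
        obtain R where R: "R \<in> matrix_poly" "\<forall>A. R A = Q (?c A)"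
          using pull[OF Q(1)] by (elim bexE)
        have "R (?\<phi> z) = g (inv_into (Gm k) ?\<phi> (?\<phi> z))" if "z \<in> Gm k" for z
          using R(2) Q(2) that by (simp add: c inv_into_f_f[OF inj that])
        then show "\<exists>u\<in>algebra_gen {\<lambda>A. A $ i $ j |i j. True}.
            \<forall>A\<in>?\<phi> ` Gm k. u A = g (inv_into (Gm k) ?\<phi> A)"
          by (intro bexI[OF _ R(1)[unfolded matrix_poly_def]]) blast
      qed
      then obtain R where R: "R \<in> matrix_poly" "\<forall>A\<in>?\<phi> ` Gm k. R A = f (inv_into (Gm k) ?\<phi> A)"
        by (elim bexE)
      have "R (?\<phi> z) = f z" if "z \<in> Gm k" for z
        using bspec[OF R(2) imageI[OF that]]
        by (simp only: inv_into_f_f[OF inj that])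
      then show ?thesis using R(1) by blast
    qed
  qed
  then show ?thesis using torus_iff_param by blast
qed

section \<open>First-order deformations\<close>

definition has_mderiv :: "(complex \<Rightarrow> complex^'n^'n) \<Rightarrow> complex^'n^'n \<Rightarrow> bool" where
  "has_mderiv M M' \<longleftrightarrow> (\<forall>i j. ((\<lambda>t. M t $ i $ j) has_field_derivative M' $ i $ j) (at 0))"

lemma has_mderiv_const: "has_mderiv (\<lambda>_. A) 0"
  by (simp add: has_mderiv_def)

lemma has_mderiv_linear: "has_mderiv (\<lambda>t. A + mat t ** B) B"
  unfolding has_mderiv_def by (auto intro!: derivative_eq_intros)

lemma has_mderiv_mult:
  assumes "has_mderiv M M'" "has_mderiv N N'"
  shows "has_mderiv (\<lambda>t. M t ** N t) (M' ** N 0 + M 0 ** N')"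
  unfolding has_mderiv_def
proof (intro allI)
  fix i j
  have "((\<lambda>t. \<Sum>k\<in>UNIV. M t $ i $ k * N t $ k $ j) has_field_derivative
      (\<Sum>k\<in>UNIV. M' $ i $ k * N 0 $ k $ j + M 0 $ i $ k * N' $ k $ j)) (at 0)"
    using assms unfolding has_mderiv_def
    by (intro DERIV_sum) (auto intro!: derivative_eq_intros)
  then show "((\<lambda>t. (M t ** N t) $ i $ j) has_field_derivative (M' ** N 0 + M 0 ** N') $ i $ j) (at 0)"
    by (simp add: matrix_matrix_mult_def sum.distrib)
qed

lemma det_differentiable:
  assumes "\<And>i j. (\<lambda>t. M t $ i $ j) field_differentiable at (0::complex)"
  shows "(\<lambda>t. det (M t :: complex^'n^'n)) field_differentiable at 0"
proof -
  have "(\<lambda>t. \<Prod>i\<in>I. M t $ i $ p i) field_differentiable at 0" if "finite I" for I and p :: "'n \<Rightarrow> 'n"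
    using that by induction (auto intro!: derivative_intros assms)
  then show ?thesis
    unfolding det_def by (intro derivative_intros field_differentiable_sum) auto
qed

text \<open>By Cramer's rule the entries of the inverse are quotients of determinants, hence
  differentiable. The value of the derivative then follows by differentiating
  \<open>M t ** matrix_inv (M t) = mat 1\<close>, which holds near 0.\<close>

lemma has_mderiv_inverse:
  assumes M: "has_mderiv M M'" and M0: "M 0 = mat 1"
  shows "has_mderiv (\<lambda>t. matrix_inv (M t)) (- M')" "\<forall>\<^sub>F t in nhds 0. invertible (M t)"
proof -
  have diff: "(\<lambda>t. M t $ i $ j) field_differentiable at 0" for i j
    using M unfolding has_mderiv_def field_differentiable_def by blast
  have "isCont (\<lambda>t. det (M t)) 0"
    using det_differentiable[OF diff] field_differentiable_imp_continuous_at by blast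
  moreover have "det (M 0) \<noteq> 0" by (simp add: M0)
  ultimately have "\<forall>\<^sub>F t in at 0. det (M t) \<noteq> 0"
    using isCont_def tendsto_imp_eventually_ne by blast
  with \<open>det (M 0) \<noteq> 0\<close> have ev: "\<forall>\<^sub>F t in nhds 0. det (M t) \<noteq> 0"
    by (simp add: eventually_nhds_conv_at)
  then show inv: "\<forall>\<^sub>F t in nhds 0. invertible (M t)"
    by (simp add: invertible_det_nz)
  have entry: "matrix_inv (M t) $ k $ l =
      det (\<chi> i j. if j = k then axis l 1 $ i else M t $ i $ j) / det (M t)"
    if "det (M t) \<noteq> 0" for t k l
  proof -
    have "invertible (M t)" using that by (simp add: invertible_det_nz)
    then have "M t *v (matrix_inv (M t) *v axis l 1) = axis l 1"
      by (simp add: matrix_vector_mul_assoc matrix_inv_mult)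
    then have "matrix_inv (M t) *v axis l 1 =
        (\<chi> k. det (\<chi> i j. if j = k then axis l 1 $ i else M t $ i $ j) / det (M t))"
      by (rule iffD1[OF cramer[OF that]])
    moreover have "(matrix_inv (M t) *v axis l 1) $ k = matrix_inv (M t) $ k $ l"
      by (simp add: matrix_vector_mult_def axis_def if_distrib cong: if_cong)
    ultimately show ?thesis by simp
  qed
  have "(\<lambda>t. matrix_inv (M t) $ k $ l) field_differentiable at 0" for k l
  proof -
    have "(\<lambda>t. (\<chi> i j. if j = k then axis l 1 $ i else M t $ i $ j) $ i $ j) field_differentiable at 0"
      for i j by (cases "j = k") (use diff in \<open>simp_all add: field_differentiable_const\<close>)
    then have "(\<lambda>t. det (\<chi> i j. if j = k then axis l 1 $ i else M t $ i $ j)) field_differentiable at 0"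
      by (rule det_differentiable)
    then have "(\<lambda>t. det (\<chi> i j. if j = k then axis l 1 $ i else M t $ i $ j) / det (M t))
        field_differentiable at 0"
      using det_differentiable[OF diff] \<open>det (M 0) \<noteq> 0\<close> by (rule field_differentiable_divide)
    then obtain d where "((\<lambda>t. det (\<chi> i j. if j = k then axis l 1 $ i else M t $ i $ j) / det (M t))
        has_field_derivative d) (at 0)"
      unfolding field_differentiable_def by blast
    moreover have "\<forall>\<^sub>F t in nhds 0. det (\<chi> i j. if j = k then axis l 1 $ i else M t $ i $ j) / det (M t)
        = matrix_inv (M t) $ k $ l"
      using ev by eventually_elim (simp add: entry)
    ultimately have "((\<lambda>t. matrix_inv (M t) $ k $ l) has_field_derivative d) (at 0)"
      by (subst DERIV_cong_ev[OF refl _ refl, symmetric]) auto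
    then show ?thesis unfolding field_differentiable_def by blast
  qed
  then have "\<exists>d. \<forall>k l. ((\<lambda>t. matrix_inv (M t) $ k $ l) has_field_derivative d k l) (at 0)"
    unfolding field_differentiable_def by metis
  then obtain d where "\<And>k l. ((\<lambda>t. matrix_inv (M t) $ k $ l) has_field_derivative d k l) (at 0)"
    by blast
  then have N: "has_mderiv (\<lambda>t. matrix_inv (M t)) (\<chi> k l. d k l)" (is "has_mderiv _ ?N")
    by (simp add: has_mderiv_def)
  have M0': "matrix_inv (M 0) = mat 1"
    by (simp add: M0 matrix_inv_unique)
  have "M' + ?N = 0"
  proof -
    have "((\<lambda>t. (M t ** matrix_inv (M t)) $ i $ j) has_field_derivative (M' + ?N) $ i $ j) (at 0)" for i j
      using has_mderiv_mult[OF M N] unfolding M0' unfolding M0 by (simp add: has_mderiv_def)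
    moreover have "((\<lambda>t. (M t ** matrix_inv (M t)) $ i $ j) has_field_derivative 0) (at 0)" for i j
    proof (subst DERIV_cong_ev[OF refl _ refl])
      show "\<forall>\<^sub>F t in nhds 0. (M t ** matrix_inv (M t)) $ i $ j = mat 1 $ i $ j"
        using inv by eventually_elim (simp add: matrix_inv_mult)
    qed simp
    ultimately have "(M' + ?N) $ i $ j = 0" for i j
      using DERIV_unique by blast
    then show ?thesis by (simp add: vec_eq_iff)
  qed
  then have "?N = - M'" by (metis add.inverse_unique)
  with N show "has_mderiv (\<lambda>t. matrix_inv (M t)) (- M')" by simp
qed

text \<open>\<open>D\<close> is the differential of \<open>F\<close> at \<rho>. It is evaluated
  along arbitrary differentiable curves of matrix-valued functions, so that a straight line and a
  curve inside \<open>Hom G\<close> with the same velocity give the same derivative.\<close>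

definition rep_deriv :: "'n::finite rep \<Rightarrow> ('n rep \<Rightarrow> complex) \<Rightarrow> ('n rep \<Rightarrow> complex) \<Rightarrow> bool" where
  "rep_deriv \<rho> F D \<longleftrightarrow> (\<forall>u v. D (\<lambda>x. u x + v x) = D u + D v) \<and>
     (\<forall>\<gamma> u. \<gamma> 0 = \<rho> \<longrightarrow> (\<forall>x. has_mderiv (\<lambda>t. \<gamma> t x) (u x)) \<longrightarrow>
        ((\<lambda>t. F (\<gamma> t)) has_field_derivative D u) (at 0))"

lemma rep_poly_deriv:
  assumes "F \<in> rep_poly"
  shows "\<exists>D. rep_deriv \<rho> F D"
  using assms unfolding rep_poly_def
proof induction
  case (const a)
  show ?case by (rule exI[of _ "\<lambda>_. 0"]) (simp add: rep_deriv_def)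
next
  case (gen F)
  then obtain x i j where F: "F = (\<lambda>\<rho>. \<rho> x $ i $ j)" by blast
  show ?case
    by (rule exI[of _ "\<lambda>u. u x $ i $ j"]) (auto simp: rep_deriv_def F has_mderiv_def simp del: split_paired_All)
next
  case (add F F')
  then obtain D D' where "rep_deriv \<rho> F D" "rep_deriv \<rho> F' D'" by blast
  then have "rep_deriv \<rho> (\<lambda>x. F x + F' x) (\<lambda>u. D u + D' u)"
    unfolding rep_deriv_def by (auto intro!: DERIV_add)
  then show ?case by blast
next
  case (mult F F')
  then obtain D D' where "rep_deriv \<rho> F D" "rep_deriv \<rho> F' D'" by blast
  then have "rep_deriv \<rho> (\<lambda>x. F x * F' x) (\<lambda>u. D u * F' \<rho> + D' u * F \<rho>)"
    unfolding rep_deriv_def by (auto simp: distrib_right intro!: DERIV_mult)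
  then show ?case by blast
qed

lemma rep_derivD:
  assumes "rep_deriv \<rho> F D"
  shows "D (\<lambda>x. u x + v x) = D u + D v"
    and "\<gamma> 0 = \<rho> \<Longrightarrow> (\<And>x. has_mderiv (\<lambda>t. \<gamma> t x) (u x)) \<Longrightarrow>
      ((\<lambda>t. F (\<gamma> t)) has_field_derivative D u) (at 0)"
  using assms unfolding rep_deriv_def by blast+

text \<open>The way in which every vanishing of a derivative is obtained: exhibit a curve with the
  given velocity along which \<open>F\<close> does not change.\<close>

lemma rep_deriv_eventually_const:
  assumes "rep_deriv \<rho> F D" "\<gamma> 0 = \<rho>" "\<And>x. has_mderiv (\<lambda>t. \<gamma> t x) (u x)"
    and "\<forall>\<^sub>F t in nhds 0. F (\<gamma> t) = b"
  shows "D u = 0"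
proof -
  have "((\<lambda>t. F (\<gamma> t)) has_field_derivative D u) (at 0)"
    by (rule rep_derivD(2)[of \<rho> F D \<gamma> u]) (use assms in auto)
  moreover have "((\<lambda>t. F (\<gamma> t)) has_field_derivative 0) (at 0)"
    by (subst DERIV_cong_ev[OF refl assms(4) refl]) simp
  ultimately show ?thesis by (rule DERIV_unique)
qed

section \<open>Representations of the free abelian group of rank two\<close>

lemma int_pair_induct:
  fixes x :: "int \<times> int"
  assumes "P (1, 0)" "P (0, 1)"
    and add: "\<And>x y. P x \<Longrightarrow> P y \<Longrightarrow> P (x + y)" and uminus: "\<And>x. P x \<Longrightarrow> P (- x)"
  shows "P x"
proof -
  have zero: "P 0" using add[OF assms(1) uminus[OF assms(1)]] by (simp add: zero_prod_def)
  have 1: "P (a, 0)" for a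
  proof (induction a rule: int_induct[where k = 0])
    case base then show ?case using zero by (simp add: zero_prod_def)
  next
    case (step1 i) then show ?case using add[OF _ assms(1)] by fastforce
  next
    case (step2 i) then show ?case using add[OF _ uminus[OF assms(1)]] by fastforce
  qed
  have 2: "P (0, b)" for b
  proof (induction b rule: int_induct[where k = 0])
    case base then show ?case using zero by (simp add: zero_prod_def)
  next
    case (step1 i) then show ?case using add[OF _ assms(2)] by fastforce
  next
    case (step2 i) then show ?case using add[OF _ uminus[OF assms(2)]] by fastforce
  qed
  show ?thesis using add[OF 1[of "fst x"] 2[of "snd x"]] by simp
qed

lemma additive_int_pair:
  fixes l :: "int \<times> int \<Rightarrow> complex"
  assumes add: "\<And>x y. l (x + y) = l x + l y"
  shows "l (p, q) = of_int p * l (1, 0) + of_int q * l (0, 1)"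
proof -
  have "l x = of_int (fst x) * l (1, 0) + of_int (snd x) * l (0, 1)" for x
  proof (induction x rule: int_pair_induct)
    case (3 x y) then show ?case by (simp add: add algebra_simps)
  next
    case (4 x)
    have "l 0 = 0" using add[of 0 0] by simp
    then have "l (- x) = - l x" using add[of x "- x"] by (simp add: eq_neg_iff_add_eq_0 add.commute)
    with 4 show ?case by simp
  qed simp_all
  from this[of "(p, q)"] show ?thesis by simp
qed

lemma Hom_mult: "\<rho> \<in> Hom G \<Longrightarrow> \<rho> (x + y) = \<rho> x ** \<rho> y"
  unfolding Hom_def by blast

lemma Hom_in: "\<rho> \<in> Hom G \<Longrightarrow> \<rho> x \<in> G"
  unfolding Hom_def by blast

lemma Hom_commute: "\<rho> \<in> Hom G \<Longrightarrow> \<rho> x ** \<rho> y = \<rho> y ** \<rho> x"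
  by (metis Hom_mult add.commute)

lemma Hom_mono: "\<rho> \<in> Hom G \<Longrightarrow> G \<subseteq> H \<Longrightarrow> \<rho> \<in> Hom H"
  unfolding Hom_def by blast

lemma Hom_zero:
  assumes "\<rho> \<in> Hom G" "\<And>A. A \<in> G \<Longrightarrow> invertible A"
  shows "\<rho> 0 = mat 1"
  using Hom_mult[OF assms(1), of 0 0] matrix_inv_cancel(2)[of "\<rho> 0" "\<rho> 0"]
    matrix_inv_mult(2)[of "\<rho> 0"] assms(2)[OF Hom_in[OF assms(1), of 0]] by simp

lemma Hom_uminus:
  assumes "\<rho> \<in> Hom G" "\<And>A. A \<in> G \<Longrightarrow> invertible A"
  shows "\<rho> (- x) = matrix_inv (\<rho> x)"
  using Hom_mult[OF assms(1), of x "- x"] Hom_zero[OF assms] matrix_inv_unique(2)[of "\<rho> x" "\<rho> (- x)"]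
  by simp

lemma Hom_eqI:
  assumes "\<rho> \<in> Hom G" "\<sigma> \<in> Hom G" "\<And>A. A \<in> G \<Longrightarrow> invertible A"
    and "\<rho> (1, 0) = \<sigma> (1, 0)" "\<rho> (0, 1) = \<sigma> (0, 1)"
  shows "\<rho> = \<sigma>"
proof
  show "\<rho> x = \<sigma> x" for x
    by (induction x rule: int_pair_induct)
       (simp_all add: assms(4,5) Hom_mult[OF assms(1)] Hom_mult[OF assms(2)]
         Hom_uminus[OF assms(1,3)] Hom_uminus[OF assms(2,3)])
qed

section \<open>Density of the representations with dense image\<close>

text \<open>The exponents of any two solutions differ by a multiple of 2 pi i, which leaves
  countably many levels of a nonconstant polynomial, each of them finite.\<close>

lemma countable_exp_poly_eq:
  assumes "\<exists>i<k. m i \<noteq> (0::int)"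
  shows "countable {t::complex. C * exp (\<Sum>i<k. of_int (m i) * t ^ Suc i) = 1}" (is "countable ?S")
proof (cases "?S = {}")
  case True
  then show ?thesis by simp
next
  case False
  then obtain t0 where t0: "C * exp (\<Sum>i<k. of_int (m i) * t0 ^ Suc i) = 1" by blast
  define f where "f = (\<lambda>t::complex. \<Sum>i<k. of_int (m i) * t ^ Suc i)"
  define p where "p = (\<Sum>i<k. monom (of_int (m i) :: complex) (Suc i))"
  have f: "f t = poly p t" for t
    unfolding f_def p_def by (simp add: poly_sum poly_monom)
  obtain i0 where i0: "i0 < k" "m i0 \<noteq> 0" using assms by blast
  have fin: "finite {t. f t = b}" for b
  proof -
    \<comment> \<open>The polynomial has no constant term, so subtracting \<open>b\<close> leaves
      the nonzero coefficient of degree \<open>Suc i0\<close> intact.\<close>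
    have "coeff (p - [:b:]) (Suc i0) = of_int (m i0)"
      using i0 by (simp add: p_def coeff_sum coeff_pCons)
    then have "p - [:b:] \<noteq> 0" using i0 by (metis coeff_0 of_int_eq_0_iff)
    then have "finite {t. poly (p - [:b:]) t = 0}" by (rule poly_roots_finite)
    then show ?thesis by (simp add: f)
  qed
  have "?S \<subseteq> (\<Union>n::int. {t. f t = f t0 + of_int (2 * n) * (of_real pi * \<i>)})"
  proof
    fix t assume "t \<in> ?S"
    then have "C * exp (f t) = C * exp (f t0)" "C \<noteq> 0" using t0 by (auto simp: f_def)
    then have "exp (f t) = exp (f t0)" by simp
    then obtain n :: int where "f t = f t0 + of_int (2 * n) * (of_real pi * \<i>)"
      unfolding exp_eq by (auto simp: mult_ac)
    then show "t \<in> (\<Union>n::int. {t. f t = f t0 + of_int (2 * n) * (of_real pi * \<i>)})" by blast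
  qed
  moreover have "countable (\<Union>n::int. {t. f t = f t0 + of_int (2 * n) * (of_real pi * \<i>)})"
    by (rule countable_UN) (simp_all add: countable_finite fin)
  ultimately show ?thesis by (rule countable_subset)
qed

lemma countable_exponents: "countable {m :: nat \<Rightarrow> int. \<forall>i\<ge>k. m i = 0}"
proof (rule countable_subset)
  show "{m :: nat \<Rightarrow> int. \<forall>i\<ge>k. m i = 0} \<subseteq> range (\<lambda>l i. if i < length l then l ! i else 0)"
  proof
    fix m :: "nat \<Rightarrow> int" assume "m \<in> {m. \<forall>i\<ge>k. m i = 0}"
    then have "m = (\<lambda>i. if i < length (map m [0..<k]) then map m [0..<k] ! i else 0)"
      by (auto simp: fun_eq_iff)
    then show "m \<in> range (\<lambda>l i. if i < length l then l ! i else 0)" by blast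
  qed
qed simp

text \<open>Multiplicative independence of \<open>y\<close> makes the values of distinct monomials
  at \<open>y\<close> distinct. Their powers are then distinct characters of the additive monoid of
  naturals, so a Laurent polynomial vanishing at all powers of \<open>y\<close> has only zero
  coefficients.\<close>

lemma torus_param_dense_powers:
  fixes T :: "(complex^'n^'n) set"
  assumes p: "torus_param k \<phi> T" and y: "y \<in> Gm k"
    and indep: "\<And>m. \<forall>i\<ge>k. m i = 0 \<Longrightarrow> \<exists>i<k. m i \<noteq> 0 \<Longrightarrow> laurent_monom k m y \<noteq> 1"
    and P: "P \<in> matrix_poly" and van: "\<And>a::nat. P (\<phi> (\<lambda>i. y i ^ a)) = 0" and "A \<in> T"
  shows "P A = 0"
proof -
  obtain f where f: "f \<in> laurent_poly k" "\<forall>z\<in>Gm k. f z = P (\<phi> z)"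
    using torus_param_pull[OF p P] by (elim bexE)
  obtain M c where M: "finite M" "\<forall>m\<in>M. \<forall>i\<ge>k. m i = 0"
    and c: "\<forall>z\<in>Gm k. f z = (\<Sum>m\<in>M. c m * laurent_monom k m z)"
    using laurent_poly_expands[OF f(1)] unfolding laurent_expands_def by (elim exE conjE)
  have pow: "(\<lambda>i. y i ^ a) \<in> Gm k" for a
    using y by (auto simp: Gm_def)
  have monom_pow: "laurent_monom k m (\<lambda>i. y i ^ a) = laurent_monom k m y ^ a" for m a
    unfolding laurent_monom_def prod_power_distrib
    by (simp add: power_int_power power_int_power' mult.commute)
  have "c m = 0" if "m \<in> M" for m
  proof (rule independence_of_characters[of M UNIV "(+)" "\<lambda>m a. laurent_monom k m y ^ a" c m])
    show "\<exists>a\<in>UNIV. laurent_monom k m y ^ a \<noteq> laurent_monom k m' y ^ a"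
      if "m \<in> M" "m' \<in> M" "m \<noteq> m'" for m m'
    proof (rule bexI[of _ 1])
      have "laurent_monom k (\<lambda>i. m i + - m' i) y \<noteq> 1"
      proof (rule indep)
        show "\<forall>i\<ge>k. m i + - m' i = 0" using M(2)[rule_format, OF that(1)] M(2)[rule_format, OF that(2)] by simp
        obtain i where i: "m i \<noteq> m' i" using \<open>m \<noteq> m'\<close> by blast
        have "i < k"
          using i M(2)[rule_format, OF that(1), of i] M(2)[rule_format, OF that(2), of i] by force
        with i show "\<exists>i<k. m i + - m' i \<noteq> 0" by auto
      qed
      then have "laurent_monom k m y * inverse (laurent_monom k m' y) \<noteq> 1"
        by (simp only: laurent_monom_add[OF y] laurent_monom_uminus not_False_eq_True)
      then show "laurent_monom k m y ^ 1 \<noteq> laurent_monom k m' y ^ 1"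
        using laurent_monom_nonzero[OF y] by auto
    qed simp
    show "\<exists>a\<in>UNIV. laurent_monom k m y ^ a \<noteq> 0" for m
      by (rule bexI[of _ 0]) auto
    show "(\<Sum>m\<in>M. c m * laurent_monom k m y ^ a) = 0" for a
      using bspec[OF c pow[of a]] bspec[OF f(2) pow[of a]] van[of a] by (simp add: monom_pow)
  qed (simp_all add: M(1) that power_add)
  moreover obtain z where "z \<in> Gm k" "A = \<phi> z" using \<open>A \<in> T\<close> torus_param_image[OF p] by blast
  ultimately show ?thesis
    using bspec[OF c, of z] bspec[OF f(2), of z] by simp
qed

text \<open>The value of \<sigma> at (1,0) is moved along a curve \<open>R t\<close> while that at
  (0,1) is fixed. Outside a countable set of \<open>t\<close> the powers of the moved element are
  already dense, so \<open>F\<close> vanishes there. As \<open>F (R t)\<close> is continuous at 0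
  and every disc is uncountable, \<open>F\<close> vanishes at \<sigma>.\<close>

lemma dense_representations_dense:
  fixes T :: "(complex^'n^'n) set"
  assumes T: "torus T" and inv: "\<And>A. A \<in> T \<Longrightarrow> invertible A" and F: "F \<in> rep_poly"
    and van: "\<And>\<sigma>. \<sigma> \<in> Hom T \<Longrightarrow> zariski_dense_in (range \<sigma>) T \<Longrightarrow> F \<sigma> = 0"
    and \<sigma>: "\<sigma> \<in> Hom T"
  shows "F \<sigma> = 0"
proof -
  obtain k \<phi> where p: "torus_param k \<phi> T"
    using T torus_iff_param by blast
  obtain y w where y: "y \<in> Gm k" "\<sigma> (1, 0) = \<phi> y" and w: "w \<in> Gm k" "\<sigma> (0, 1) = \<phi> w"
    using Hom_in[OF \<sigma>] torus_param_image[OF p] by (metis imageE)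
  \<comment> \<open>The exponents \<open>t ^ Suc i\<close> vanish at 0, where the curve passes
    through \<open>y\<close>. Having different degrees, they admit no nontrivial integral
    combination that is constant.\<close>
  define Y where "Y = (\<lambda>t i. if i < k then y i * exp (t ^ Suc i) else 1)"
  define Z where "Z = (\<lambda>t x i. Y t i powi fst x * w i powi snd x)"
  define R where "R = (\<lambda>t x. \<phi> (Z t x))"
  have Y: "Y t \<in> Gm k" for t
    using y by (auto simp: Gm_def Y_def)
  have Y0: "Y 0 = y"
    using y by (auto simp: Gm_def Y_def)
  have Z: "Z t x \<in> Gm k" for t x
    using Y[of t] w by (auto simp: Gm_def Z_def)
  have R: "R t \<in> Hom T" for t
    unfolding Hom_def
  proof (intro CollectI conjI allI)
    show "R t x \<in> T" for x
      unfolding R_def torus_param_image[OF p] using Z by blast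
    show "R t (x + x') = R t x ** R t x'" for x x'
    proof -
      have "Z t (x + x') = (\<lambda>i. Z t x i * Z t x' i)"
        using Y[of t] w by (auto simp: Z_def Gm_def power_int_add)
      then show ?thesis unfolding R_def using torus_param_mult[OF p Z Z] by simp
    qed
  qed
  have R0: "R 0 = \<sigma>"
    by (rule Hom_eqI[OF R \<sigma> inv]) (simp_all add: R_def Z_def Y0 y w)
  \<comment> \<open>The parameters at which some nontrivial monomial relation holds.\<close>
  define bad where "bad = (\<Union>m\<in>{m. (\<forall>i\<ge>k. m i = 0) \<and> (\<exists>i<k. m i \<noteq> 0)}. {t. laurent_monom k m (Y t) = 1})"
  have monom_Y: "laurent_monom k m (Y t) =
      laurent_monom k m y * exp (\<Sum>i<k. of_int (m i) * t ^ Suc i)" for m t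
    unfolding laurent_monom_def Y_def
    by (simp add: exp_sum power_int_mult_distrib prod.distrib exp_power_int mult.commute)
  have "countable bad"
    unfolding bad_def
  proof (rule countable_UN)
    show "countable {m. (\<forall>i\<ge>k. m i = (0::int)) \<and> (\<exists>i<k. m i \<noteq> 0)}"
      by (rule countable_subset[OF _ countable_exponents[of k]]) blast
    show "countable {t. laurent_monom k m (Y t) = 1}"
      if "m \<in> {m. (\<forall>i\<ge>k. m i = 0) \<and> (\<exists>i<k. m i \<noteq> 0)}" for m
      unfolding monom_Y using that by (intro countable_exp_poly_eq) simp
  qed
  have FR: "F (R t) = 0" if "t \<notin> bad" for t
  proof (rule van[OF R])
    show "zariski_dense_in (range (R t)) T"
      unfolding zariski_dense_in_def
    proof (intro conjI ballI impI)
      show "range (R t) \<subseteq> T" using Hom_in[OF R] by blast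
      fix P A assume P: "P \<in> matrix_poly" "\<forall>A\<in>range (R t). P A = 0" "A \<in> T"
      show "P A = 0"
      proof (rule torus_param_dense_powers[OF p Y[of t] _ P(1) _ P(3)])
        show "laurent_monom k m (Y t) \<noteq> 1" if "\<forall>i\<ge>k. m i = 0" "\<exists>i<k. m i \<noteq> 0" for m
          using \<open>t \<notin> bad\<close> that unfolding bad_def by blast
        have "R t (int a, 0) = \<phi> (\<lambda>i. Y t i ^ a)" for a
          by (simp add: R_def Z_def)
        then show "P (\<phi> (\<lambda>i. Y t i ^ a)) = 0" for a using P(2) by (metis rangeI)
      qed
    qed
  qed
  have Zcont: "isCont (\<lambda>t. f (Z t x)) 0" if "f \<in> laurent_poly k" for f x
    using that unfolding laurent_poly_def
  proof induction
    case (gen g)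
    have *: "isCont (\<lambda>t. Z t x i) 0" "Z 0 x i \<noteq> 0" for i
    proof -
      show "Z 0 x i \<noteq> 0" using Z[of 0 x] by (auto simp: Gm_def)
      have "isCont (\<lambda>t. Y t i) 0" by (cases "i < k") (auto simp: Y_def intro!: continuous_intros)
      moreover have "Y 0 i \<noteq> 0" using Y[of 0] by (auto simp: Gm_def)
      ultimately show "isCont (\<lambda>t. Z t x i) 0" unfolding Z_def by (auto intro!: continuous_intros)
    qed
    from gen show ?case
    proof
      assume "g \<in> {\<lambda>z. z i |i. i < k}"
      then show ?thesis using * by blast
    next
      assume "g \<in> {\<lambda>z. inverse (z i) |i. i < k}"
      then show ?thesis using * by (auto intro!: continuous_intros)
    qed
  qed (auto intro!: continuous_intros)
  have "isCont (\<lambda>t. F (R t)) 0"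
    using F unfolding rep_poly_def
  proof induction
    case (gen g)
    then obtain x i j where g: "g = (\<lambda>\<rho>. \<rho> x $ i $ j)" by blast
    obtain f where f: "f \<in> laurent_poly k" "\<forall>z\<in>Gm k. f z = \<phi> z $ i $ j"
      using torus_param_pull[OF p matrix_poly_nth[of i j]] by (elim bexE)
    have "(\<lambda>t. g (R t)) = (\<lambda>t. f (Z t x))"
      using bspec[OF f(2) Z] by (simp add: g R_def)
    then show ?case using Zcont[OF f(1)] by simp
  qed (auto intro!: continuous_intros)
  show "F \<sigma> = 0"
  proof (rule ccontr)
    assume "F \<sigma> \<noteq> 0"
    then have "\<forall>\<^sub>F t in nhds 0. F (R t) \<noteq> 0"
      using \<open>isCont (\<lambda>t. F (R t)) 0\<close> R0 by (simp add: isCont_def tendsto_imp_eventually_ne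
          eventually_nhds_conv_at)
    then obtain U where "open U" "0 \<in> U" "\<And>t. t \<in> U \<Longrightarrow> F (R t) \<noteq> 0"
      unfolding eventually_nhds by blast
    moreover from this FR have "U \<subseteq> bad" by blast
    then have "countable U" using \<open>countable bad\<close> countable_subset by blast
    moreover from \<open>open U\<close> \<open>0 \<in> U\<close> obtain e where "e > 0" "ball 0 e \<subseteq> U"
      unfolding open_contains_ball by blast
    ultimately show False using uncountable_ball countable_subset by blast
  qed
qed

section \<open>Cocycles\<close>

lemma matrix_mult_diff: "A ** (B - C) = A ** B - A ** (C :: complex^'n^'n)"
  by (simp add: vec_eq_iff matrix_matrix_mult_def sum_subtractf right_diff_distrib)

lemma matrix_diff_mult: "(A - B) ** C = A ** C - B ** (C :: complex^'n^'n)"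
  by (simp add: vec_eq_iff matrix_matrix_mult_def sum_subtractf left_diff_distrib)

lemma rep_poly_nth: "(\<lambda>\<rho>. \<rho> x $ i $ j) \<in> rep_poly"
  unfolding rep_poly_def by (rule algebra_gen.gen) blast

lemma trace_rep_poly: "(\<lambda>\<rho>. trace (\<rho> g)) \<in> rep_poly"
  unfolding trace_def rep_poly_def
  by (intro algebra_gen_sum rep_poly_nth[unfolded rep_poly_def]) simp

lemma invariant_poly_const: "(\<lambda>_. a) \<in> invariant_poly G"
  unfolding invariant_poly_def rep_poly_def by (auto intro: algebra_gen.const)

lemma invariant_poly_mult:
  "F \<in> invariant_poly G \<Longrightarrow> F' \<in> invariant_poly G \<Longrightarrow> (\<lambda>\<rho>. F \<rho> * F' \<rho>) \<in> invariant_poly G"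
  unfolding invariant_poly_def rep_poly_def by (auto intro: algebra_gen.mult)

lemma invariant_poly_diff:
  "F \<in> invariant_poly G \<Longrightarrow> F' \<in> invariant_poly G \<Longrightarrow> (\<lambda>\<rho>. F \<rho> - F' \<rho>) \<in> invariant_poly G"
  unfolding invariant_poly_def rep_poly_def by (auto intro: algebra_gen_diff)

lemma git_class_self: "\<rho> \<in> Hom G \<Longrightarrow> \<rho> \<in> git_class G \<rho>"
  unfolding git_class_def by simp

lemma invariant_poly_class:
  "F \<in> invariant_poly G \<Longrightarrow> x \<in> X0 G T \<Longrightarrow> \<rho> \<in> x \<Longrightarrow> \<sigma> \<in> x \<Longrightarrow> F \<rho> = F \<sigma>"
  unfolding X0_def git_class_def by auto

lemma X0_in_Hom: "x \<in> X0 G T \<Longrightarrow> \<rho> \<in> x \<Longrightarrow> \<rho> \<in> Hom G"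
  unfolding X0_def git_class_def by auto

text \<open>\<open>S\<close> is the projection onto the Lie algebra that is orthogonal for the trace form.\<close>

locale classical_group =
  fixes G \<gg> :: "(complex^'n::finite^'n) set" and S :: "complex^'n^'n \<Rightarrow> complex^'n^'n"
  assumes invertible: "A \<in> G \<Longrightarrow> invertible A"
    and S_in: "S X \<in> \<gg>" and S_id: "X \<in> \<gg> \<Longrightarrow> S X = X"
    and S_add: "S (X + Y) = S X + S Y" and S_scale: "S (mat a ** X) = mat a ** S X"
    and S_conj: "A \<in> G \<Longrightarrow> S (A ** X ** matrix_inv A) = A ** S X ** matrix_inv A"
    and S_trace: "Y \<in> \<gg> \<Longrightarrow> trace (S X ** Y) = trace (X ** Y)"
    and curve: "A \<in> \<gg> \<Longrightarrow> \<exists>K. K 0 = mat 1 \<and> has_mderiv K A \<and>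
      (\<forall>F\<in>invariant_poly G. \<forall>\<rho>\<in>Hom G.
        \<forall>\<^sub>F t in nhds 0. F (\<lambda>x. K t ** \<rho> x ** matrix_inv (K t)) = F \<rho>)"
    and max_torus_diag: "maximal_torus G T \<Longrightarrow> \<exists>P :: complex^'n^'n. invertible P \<and>
      (\<forall>A\<in>T. \<exists>d. A = conj_diag P d) \<and>
      (\<forall>i j. i \<noteq> j \<longrightarrow> (\<exists>d. d i \<noteq> d j \<and> conj_diag P d \<in> T)) \<and>
      (\<forall>\<xi> t. conj_diag P \<xi> \<in> \<gg> \<longrightarrow> conj_diag P (\<lambda>i. exp (t * \<xi> i)) \<in> T)"
    and max_torus_conj: "maximal_torus G T \<Longrightarrow> maximal_torus G T' \<Longrightarrow>
      \<exists>g\<in>G. \<forall>A\<in>T'. g ** A ** matrix_inv g \<in> T"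
begin

lemma alg_add: "X \<in> \<gg> \<Longrightarrow> Y \<in> \<gg> \<Longrightarrow> X + Y \<in> \<gg>"
  by (metis S_in S_id S_add)

lemma alg_scale: "X \<in> \<gg> \<Longrightarrow> mat a ** X \<in> \<gg>"
  by (metis S_in S_id S_scale)

lemma alg_uminus: "X \<in> \<gg> \<Longrightarrow> - X \<in> \<gg>"
proof -
  have "mat (-1) ** X = - X" by (simp add: vec_eq_iff)
  then show "X \<in> \<gg> \<Longrightarrow> - X \<in> \<gg>" using alg_scale[of X "-1"] by simp
qed

lemma alg_diff: "X \<in> \<gg> \<Longrightarrow> Y \<in> \<gg> \<Longrightarrow> X - Y \<in> \<gg>"
  using alg_add[OF _ alg_uminus] by (metis diff_conv_add_uminus)

lemma S_diff: "S (X - Y) = S X - S Y"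
  using S_add[of "X - Y" Y] by simp

lemma alg_zero: "0 \<in> \<gg>"
  using alg_diff[OF S_in S_in, of 0 0] by simp

lemma rep_zero: "\<rho> \<in> Hom G \<Longrightarrow> \<rho> 0 = mat 1"
  using Hom_zero invertible by blast

lemma rep_uminus: "\<rho> \<in> Hom G \<Longrightarrow> \<rho> (- x) = matrix_inv (\<rho> x)"
  using Hom_uminus invertible by blast

lemma rep_invertible: "\<rho> \<in> Hom G \<Longrightarrow> invertible (\<rho> x)"
  using Hom_in invertible by blast

lemma Ad_eq: "\<rho> \<in> Hom G \<Longrightarrow> Ad \<rho> x A = \<rho> x ** A ** matrix_inv (\<rho> x)"
  unfolding Ad_def by (simp add: rep_uminus)

lemma Ad_add_rep: "\<rho> \<in> Hom G \<Longrightarrow> Ad \<rho> (x + y) A = Ad \<rho> x (Ad \<rho> y A)"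
  by (simp add: Ad_eq Hom_mult matrix_inv_prod rep_invertible matrix_mul_assoc)

lemma Ad_add: "Ad \<rho> x (A + B) = Ad \<rho> x A + Ad \<rho> x B"
  by (simp add: Ad_def matrix_add_ldistrib matrix_mult_add_rdistrib)

lemma Ad_diff: "Ad \<rho> x (A - B) = Ad \<rho> x A - Ad \<rho> x B"
  by (simp add: Ad_def matrix_mult_diff matrix_diff_mult)

lemma trace_Ad_Ad: "\<rho> \<in> Hom G \<Longrightarrow> trace (Ad \<rho> x A ** Ad \<rho> x B) = trace (A ** B)"
proof -
  assume \<rho>: "\<rho> \<in> Hom G"
  have "Ad \<rho> x A ** Ad \<rho> x B = \<rho> x ** (A ** B) ** matrix_inv (\<rho> x)"
    by (simp add: Ad_eq[OF \<rho>] matrix_mul_assoc[symmetric] matrix_inv_cancel rep_invertible[OF \<rho>])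
  then show ?thesis by (simp add: trace_conj rep_invertible[OF \<rho>])
qed

lemma Ad_alg: "\<rho> \<in> Hom G \<Longrightarrow> X \<in> \<gg> \<Longrightarrow> Ad \<rho> x X \<in> \<gg>"
  by (metis Ad_eq Hom_in S_conj S_id S_in)

definition cobdry :: "'n rep \<Rightarrow> complex^'n^'n \<Rightarrow> int \<times> int \<Rightarrow> complex^'n^'n" where
  "cobdry \<rho> A x = Ad \<rho> x A - A"

definition central :: "'n rep \<Rightarrow> complex^'n^'n \<Rightarrow> bool" where
  "central \<rho> X \<longleftrightarrow> (\<forall>x. \<rho> x ** X = X ** \<rho> x)"

lemma central_Ad: "\<rho> \<in> Hom G \<Longrightarrow> central \<rho> X \<Longrightarrow> Ad \<rho> x X = X"
  unfolding central_def Ad_eq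
  by (metis matrix_inv_mult(1) matrix_mul_assoc matrix_mul_rid rep_invertible)

lemma central_rep: "\<rho> \<in> Hom G \<Longrightarrow> central \<rho> (\<rho> x)"
  unfolding central_def using Hom_commute by blast

lemma central_S:
  assumes \<rho>: "\<rho> \<in> Hom G" and X: "central \<rho> X"
  shows "central \<rho> (S X)"
  unfolding central_def
proof
  fix x
  have "\<rho> x ** S X ** matrix_inv (\<rho> x) = S X"
    using S_conj[OF Hom_in[OF \<rho>], of x X] central_Ad[OF \<rho> X, of x] by (simp add: Ad_eq[OF \<rho>])
  then have "\<rho> x ** S X ** matrix_inv (\<rho> x) ** \<rho> x = S X ** \<rho> x" by simp
  then show "\<rho> x ** S X = S X ** \<rho> x"
    by (simp add: matrix_mul_assoc[symmetric] matrix_inv_mult rep_invertible[OF \<rho>])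
qed

lemma Z1_in: "u \<in> Z1 \<gg> \<rho> \<Longrightarrow> u x \<in> \<gg>"
  unfolding Z1_def by blast

lemma Z1_add: "u \<in> Z1 \<gg> \<rho> \<Longrightarrow> u (x + y) = u x + Ad \<rho> x (u y)"
  unfolding Z1_def by blast

lemma Z1_I: "(\<And>x. u x \<in> \<gg>) \<Longrightarrow> (\<And>x y. u (x + y) = u x + Ad \<rho> x (u y)) \<Longrightarrow> u \<in> Z1 \<gg> \<rho>"
  unfolding Z1_def by blast

lemma cobdry_Z1: "\<rho> \<in> Hom G \<Longrightarrow> A \<in> \<gg> \<Longrightarrow> cobdry \<rho> A \<in> Z1 \<gg> \<rho>"
  by (rule Z1_I) (simp_all add: cobdry_def alg_diff Ad_alg Ad_add_rep Ad_diff)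

lemma Z1_diff: "u \<in> Z1 \<gg> \<rho> \<Longrightarrow> v \<in> Z1 \<gg> \<rho> \<Longrightarrow> (\<lambda>x. u x - v x) \<in> Z1 \<gg> \<rho>"
  by (rule Z1_I) (simp_all add: Z1_in alg_diff Z1_add Ad_diff)

text \<open>The adjoint action is trivial on central elements, so homomorphisms with central values
  are cocycles. They serve as Hamiltonians and as test vectors for nondegeneracy.\<close>

lemma central_Z1:
  assumes "\<rho> \<in> Hom G" "X \<in> \<gg>" "Y \<in> \<gg>" "central \<rho> X" "central \<rho> Y"
  shows "(\<lambda>x. mat (of_int (fst x)) ** X + mat (of_int (snd x)) ** Y) \<in> Z1 \<gg> \<rho>"
proof (rule Z1_I)
  show "mat (of_int (fst x)) ** X + mat (of_int (snd x)) ** Y \<in> \<gg>" for x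
    using assms by (intro alg_add alg_scale)
  show "mat (of_int (fst (x + y))) ** X + mat (of_int (snd (x + y))) ** Y =
      mat (of_int (fst x)) ** X + mat (of_int (snd x)) ** Y +
      Ad \<rho> x (mat (of_int (fst y)) ** X + mat (of_int (snd y)) ** Y)" for x y
  proof -
    have "central \<rho> (mat (of_int (fst y)) ** X + mat (of_int (snd y)) ** Y)"
      using assms(4,5) unfolding central_def
      by (simp add: matrix_add_ldistrib matrix_mult_add_rdistrib matrix_mul_assoc mat_mult_commute)
         (simp add: matrix_mul_assoc[symmetric])
    then show ?thesis
      using central_Ad[OF assms(1)] by (simp add: vec_eq_iff algebra_simps)
  qed
qed

text \<open>The relation divided out in \<open>H1\<close>. Cochains are typed as
  \<open>'n rep\<close>, being matrix-valued functions on the same group.\<close>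

definition cohom :: "'n rep \<Rightarrow> ('n rep \<times> 'n rep) set" where
  "cohom \<rho> = {(u, v). u \<in> Z1 \<gg> \<rho> \<and> v \<in> Z1 \<gg> \<rho> \<and> (\<exists>A\<in>\<gg>. \<forall>x. v x - u x = Ad \<rho> x A - A)}"

lemma H1_eq: "H1 \<gg> \<rho> = Z1 \<gg> \<rho> // cohom \<rho>"
  unfolding H1_def cohom_def ..

lemma cohomI:
  "u \<in> Z1 \<gg> \<rho> \<Longrightarrow> v \<in> Z1 \<gg> \<rho> \<Longrightarrow> A \<in> \<gg> \<Longrightarrow> v = (\<lambda>x. u x + cobdry \<rho> A x) \<Longrightarrow> (u, v) \<in> cohom \<rho>"
  unfolding cohom_def cobdry_def by auto

lemma cohomE:
  assumes "(u, v) \<in> cohom \<rho>"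
  obtains A where "u \<in> Z1 \<gg> \<rho>" "v \<in> Z1 \<gg> \<rho>" "A \<in> \<gg>" "v = (\<lambda>x. u x + cobdry \<rho> A x)"
proof -
  from assms obtain A where A: "u \<in> Z1 \<gg> \<rho>" "v \<in> Z1 \<gg> \<rho>" "A \<in> \<gg>" "\<forall>x. v x - u x = Ad \<rho> x A - A"
    unfolding cohom_def by blast
  then have "v = (\<lambda>x. u x + cobdry \<rho> A x)"
    unfolding cobdry_def fun_eq_iff by (metis add.commute diff_add_cancel)
  with A show ?thesis using that by blast
qed

lemma cobdry_zero: "cobdry \<rho> 0 x = 0"
  by (simp add: cobdry_def Ad_def)

lemma cobdry_uminus: "cobdry \<rho> (- A) x = - cobdry \<rho> A x"
  using Ad_diff[of \<rho> x 0 A] Ad_diff[of \<rho> x 0 0] by (simp add: cobdry_def)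

lemma cobdry_add: "cobdry \<rho> (A + B) x = cobdry \<rho> A x + cobdry \<rho> B x"
  by (simp add: cobdry_def Ad_add)

lemma equiv_cohom: "equiv (Z1 \<gg> \<rho>) (cohom \<rho>)"
proof (rule equivI)
  show "cohom \<rho> \<subseteq> Z1 \<gg> \<rho> \<times> Z1 \<gg> \<rho>" unfolding cohom_def by blast
  show "refl_on (Z1 \<gg> \<rho>) (cohom \<rho>)"
    by (rule refl_onI) (auto intro!: cohomI[OF _ _ alg_zero] simp: cobdry_zero)
  show "sym (cohom \<rho>)"
  proof (rule symI)
    fix u v assume "(u, v) \<in> cohom \<rho>"
    then show "(v, u) \<in> cohom \<rho>"
      by (elim cohomE) (auto intro!: cohomI[OF _ _ alg_uminus] simp: cobdry_uminus)
  qed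
  show "trans (cohom \<rho>)"
  proof (rule transI)
    fix u v w assume "(u, v) \<in> cohom \<rho>" "(v, w) \<in> cohom \<rho>"
    then obtain A B where *: "u \<in> Z1 \<gg> \<rho>" "w \<in> Z1 \<gg> \<rho>" "A \<in> \<gg>" "B \<in> \<gg>"
      "v = (\<lambda>x. u x + cobdry \<rho> A x)" "w = (\<lambda>x. v x + cobdry \<rho> B x)"
      by (elim cohomE)
    show "(u, w) \<in> cohom \<rho>"
      by (rule cohomI[OF *(1,2) alg_add[OF *(3,4)]]) (simp add: *(5,6) cobdry_add add.assoc)
  qed
qed

lemma H1_class: "u \<in> Z1 \<gg> \<rho> \<Longrightarrow> cohom \<rho> `` {u} \<in> H1 \<gg> \<rho>"
  unfolding H1_eq by (rule quotientI)

lemma H1_class_self: "u \<in> Z1 \<gg> \<rho> \<Longrightarrow> u \<in> cohom \<rho> `` {u}"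
  using equiv_class_self[OF equiv_cohom] by blast

lemma H1_nonempty: "h \<in> H1 \<gg> \<rho> \<Longrightarrow> \<exists>u. u \<in> h"
  unfolding H1_eq using in_quotient_imp_non_empty[OF equiv_cohom] by blast

lemma H1_in_Z1: "h \<in> H1 \<gg> \<rho> \<Longrightarrow> u \<in> h \<Longrightarrow> u \<in> Z1 \<gg> \<rho>"
  unfolding H1_eq using in_quotient_imp_subset[OF equiv_cohom] by blast

lemma H1_cohom: "h \<in> H1 \<gg> \<rho> \<Longrightarrow> u \<in> h \<Longrightarrow> v \<in> h \<Longrightarrow> (u, v) \<in> cohom \<rho>"
  unfolding H1_eq using in_quotient_imp_in_rel[OF equiv_cohom] by blast

lemma H1_eqI: "h \<in> H1 \<gg> \<rho> \<Longrightarrow> k \<in> H1 \<gg> \<rho> \<Longrightarrow> u \<in> h \<Longrightarrow> v \<in> k \<Longrightarrow> (u, v) \<in> cohom \<rho> \<Longrightarrow> h = k"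
  unfolding H1_eq using quotient_eqI[OF equiv_cohom] by blast

section \<open>The symplectic form on cochains and on cohomology classes\<close>

definition pairing :: "complex \<Rightarrow> 'n rep \<Rightarrow> 'n rep \<Rightarrow>
    'n rep \<Rightarrow> complex" where
  "pairing c \<rho> u v = cup c \<rho> u v (1, 0) (0, 1) - cup c \<rho> u v (0, 1) (1, 0)"

lemma pairing_add_left: "pairing c \<rho> (\<lambda>x. u x + u' x) v = pairing c \<rho> u v + pairing c \<rho> u' v"
  by (simp add: pairing_def cup_def trace_form_def matrix_mult_add_rdistrib trace_add algebra_simps)

lemma pairing_diff_left: "pairing c \<rho> (\<lambda>x. u x - u' x) v = pairing c \<rho> u v - pairing c \<rho> u' v"
  using pairing_add_left[of c \<rho> "\<lambda>x. u x - u' x" u' v] by simp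

lemma pairing_add_right: "pairing c \<rho> u (\<lambda>x. v x + v' x) = pairing c \<rho> u v + pairing c \<rho> u v'"
  by (simp add: pairing_def cup_def trace_form_def Ad_add matrix_add_ldistrib trace_add algebra_simps)

text \<open>The value of \<open>u\<close> at (1,1) is computed in two ways, from (1,0)+(0,1) and
  from (0,1)+(1,0). Pairing the resulting identity with \<open>Ad \<rho> (1, 1) A\<close> and using
  invariance of the trace under \<open>Ad\<close> gives exactly the cancellation required.\<close>

lemma pairing_cobdry_right:
  assumes \<rho>: "\<rho> \<in> Hom G" and u: "u \<in> Z1 \<gg> \<rho>"
  shows "pairing c \<rho> u (cobdry \<rho> A) = 0"
proof -
  let ?a = "(1, 0) :: int \<times> int" and ?b = "(0, 1) :: int \<times> int"
  have ab: "?a + ?b = (1, 1)" "?b + ?a = (1, 1)" by simp_all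
  have "u ?a + Ad \<rho> ?a (u ?b) = u ?b + Ad \<rho> ?b (u ?a)"
    using Z1_add[OF u, of ?a ?b] Z1_add[OF u, of ?b ?a] unfolding ab by simp
  then have eq: "u ?a - u ?b = Ad \<rho> ?b (u ?a) - Ad \<rho> ?a (u ?b)" by (simp add: algebra_simps)
  have 1: "Ad \<rho> (1, 1) A = Ad \<rho> ?b (Ad \<rho> ?a A)" "Ad \<rho> (1, 1) A = Ad \<rho> ?a (Ad \<rho> ?b A)"
    using Ad_add_rep[OF \<rho>, of ?b ?a A] Ad_add_rep[OF \<rho>, of ?a ?b A] unfolding ab by simp_all
  have "trace ((u ?a - u ?b) ** Ad \<rho> (1, 1) A)
      = trace (Ad \<rho> ?b (u ?a) ** Ad \<rho> (1, 1) A) - trace (Ad \<rho> ?a (u ?b) ** Ad \<rho> (1, 1) A)"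
    unfolding eq by (simp add: matrix_diff_mult trace_sub)
  also have "trace (Ad \<rho> ?b (u ?a) ** Ad \<rho> (1, 1) A) = trace (u ?a ** Ad \<rho> ?a A)"
    unfolding 1(1) by (rule trace_Ad_Ad[OF \<rho>])
  also have "trace (Ad \<rho> ?a (u ?b) ** Ad \<rho> (1, 1) A) = trace (u ?b ** Ad \<rho> ?b A)"
    unfolding 1(2) by (rule trace_Ad_Ad[OF \<rho>])
  finally have "trace (u ?a ** Ad \<rho> (1, 1) A) - trace (u ?b ** Ad \<rho> (1, 1) A)
      = trace (u ?a ** Ad \<rho> ?a A) - trace (u ?b ** Ad \<rho> ?b A)"
    by (simp add: matrix_diff_mult trace_sub)
  moreover have "Ad \<rho> ?a (cobdry \<rho> A ?b) = Ad \<rho> (1, 1) A - Ad \<rho> ?a A"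
    "Ad \<rho> ?b (cobdry \<rho> A ?a) = Ad \<rho> (1, 1) A - Ad \<rho> ?b A"
    by (simp_all add: cobdry_def Ad_diff 1(2)) (simp add: 1 flip: 1(2))
  ultimately have "trace (u ?a ** Ad \<rho> ?a (cobdry \<rho> A ?b)) - trace (u ?b ** Ad \<rho> ?b (cobdry \<rho> A ?a)) = 0"
    by (simp add: matrix_mult_diff trace_sub) (simp add: algebra_simps)
  then show ?thesis
    unfolding pairing_def cup_def trace_form_def by (metis mult_zero_right right_diff_distrib)
qed

text \<open>Invariance of the trace removes \<open>Ad\<close> from the terms with
  \<open>Ad \<rho> x A\<close>; the remaining ones cancel by the two expressions for
  \<open>v\<close> at (1,1).\<close>

lemma pairing_cobdry_left:
  assumes \<rho>: "\<rho> \<in> Hom G" and v: "v \<in> Z1 \<gg> \<rho>"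
  shows "pairing c \<rho> (cobdry \<rho> A) v = 0"
proof -
  let ?a = "(1, 0) :: int \<times> int" and ?b = "(0, 1) :: int \<times> int"
  have ab: "?a + ?b = (1, 1)" "?b + ?a = (1, 1)" by simp_all
  have eq: "v ?a + Ad \<rho> ?a (v ?b) = v ?b + Ad \<rho> ?b (v ?a)"
    using Z1_add[OF v, of ?a ?b] Z1_add[OF v, of ?b ?a] unfolding ab by simp
  have "trace (cobdry \<rho> A ?a ** Ad \<rho> ?a (v ?b)) - trace (cobdry \<rho> A ?b ** Ad \<rho> ?b (v ?a))
      = trace (Ad \<rho> ?a A ** Ad \<rho> ?a (v ?b)) - trace (Ad \<rho> ?b A ** Ad \<rho> ?b (v ?a))
        - trace (A ** (Ad \<rho> ?a (v ?b) - Ad \<rho> ?b (v ?a)))"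
    by (simp add: cobdry_def matrix_diff_mult matrix_mult_diff trace_sub)
  also have "Ad \<rho> ?a (v ?b) - Ad \<rho> ?b (v ?a) = v ?b - v ?a"
    using eq by (simp add: algebra_simps)
  also have "trace (Ad \<rho> ?a A ** Ad \<rho> ?a (v ?b)) - trace (Ad \<rho> ?b A ** Ad \<rho> ?b (v ?a))
        - trace (A ** (v ?b - v ?a)) = 0"
    by (simp add: trace_Ad_Ad[OF \<rho>] matrix_mult_diff trace_sub)
  finally show ?thesis
    unfolding pairing_def cup_def trace_form_def by (metis mult_zero_right right_diff_distrib)
qed

lemma pairing_cohom:
  assumes \<rho>: "\<rho> \<in> Hom G" and "(u, u') \<in> cohom \<rho>" "(v, v') \<in> cohom \<rho>"
  shows "pairing c \<rho> u v = pairing c \<rho> u' v'"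
proof -
  obtain A where A: "u \<in> Z1 \<gg> \<rho>" "u' \<in> Z1 \<gg> \<rho>" "A \<in> \<gg>" "u' = (\<lambda>x. u x + cobdry \<rho> A x)"
    using assms(2) by (elim cohomE)
  obtain B where B: "v \<in> Z1 \<gg> \<rho>" "v' \<in> Z1 \<gg> \<rho>" "B \<in> \<gg>" "v' = (\<lambda>x. v x + cobdry \<rho> B x)"
    using assms(3) by (elim cohomE)
  have "pairing c \<rho> u' v' = pairing c \<rho> u v'"
    unfolding A(4) pairing_add_left by (simp add: pairing_cobdry_left[OF \<rho> B(2)])
  also have "\<dots> = pairing c \<rho> u v"
    unfolding B(4) pairing_add_right by (simp add: pairing_cobdry_right[OF \<rho> A(1)])
  finally show ?thesis ..
qed

text \<open>The set inside \<open>omega\<close> is a singleton by \<open>pairing_cohom\<close>, so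
  any two representatives compute its element.\<close>

lemma omega_eq:
  assumes \<rho>: "\<rho> \<in> Hom G" and h: "h \<in> H1 \<gg> \<rho>" "u \<in> h" and k: "k \<in> H1 \<gg> \<rho>" "v \<in> k"
  shows "omega c \<rho> h k = pairing c \<rho> u v"
proof -
  have "{cup c \<rho> u v (1, 0) (0, 1) - cup c \<rho> u v (0, 1) (1, 0) | u v. u \<in> h \<and> v \<in> k}
      = {pairing c \<rho> u v | u v. u \<in> h \<and> v \<in> k}"
    unfolding pairing_def ..
  also have "\<dots> = {pairing c \<rho> u v}"
    using h k pairing_cohom[OF \<rho> H1_cohom[OF h(1)] H1_cohom[OF k(1)]] by blast
  finally show ?thesis unfolding omega_def by simp
qed

end

context classical_group
begin

section \<open>Representations that are dense in a maximal torus\<close>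

text \<open>\<open>T\<close> is the torus in which \<rho> has dense image and may differ from the
  torus that fixes \<open>X0\<close>. Density is retained only as the separation of the weights
  \<open>wt\<close>.\<close>

definition diagonalized :: "(complex^'n^'n) set \<Rightarrow> 'n rep \<Rightarrow> complex^'n^'n \<Rightarrow>
    (int \<times> int \<Rightarrow> 'n \<Rightarrow> complex) \<Rightarrow> bool" where
  "diagonalized T \<rho> P wt \<longleftrightarrow> maximal_torus G T \<and> \<rho> \<in> Hom T \<and> invertible P \<and>
     (\<forall>x. \<rho> x = conj_diag P (wt x)) \<and>
     (\<forall>i j. i \<noteq> j \<longrightarrow> (\<exists>x. wt x i \<noteq> wt x j)) \<and>
     (\<forall>\<xi> t. conj_diag P \<xi> \<in> \<gg> \<longrightarrow> conj_diag P (\<lambda>i. exp (t * \<xi> i)) \<in> T)"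

text \<open>If two weights agreed on the image of \<rho>, the difference of two diagonal entries in
  the basis \<open>P\<close> would be a polynomial vanishing on that image, hence on
  \<open>T\<close>, against the separation of weights on \<open>T\<close>.\<close>

lemma dense_rep_diagonalized:
  assumes \<rho>: "\<rho> \<in> Hom G" and dense: "dense_rep G \<rho>"
  shows "\<exists>T P wt. diagonalized T \<rho> P wt"
proof -
  obtain T where T: "maximal_torus G T" "zariski_dense_in (range \<rho>) T"
    using dense unfolding dense_rep_def by blast
  have sub: "range \<rho> \<subseteq> T" using T(2) unfolding zariski_dense_in_def by blast
  obtain P :: "complex^'n^'n" where P: "invertible P" "\<forall>A\<in>T. \<exists>d. A = conj_diag P d"
    "\<forall>i j. i \<noteq> j \<longrightarrow> (\<exists>d. d i \<noteq> d j \<and> conj_diag P d \<in> T)"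
    "\<forall>\<xi> t. conj_diag P \<xi> \<in> \<gg> \<longrightarrow> conj_diag P (\<lambda>i. exp (t * \<xi> i)) \<in> T"
    using max_torus_diag[OF T(1)] by (elim exE conjE) (erule (3) that)
  have "\<forall>x. \<exists>d. \<rho> x = conj_diag P d" using P(2) sub by blast
  then obtain wt where wt: "\<forall>x. \<rho> x = conj_diag P (wt x)" by metis
  have "\<exists>x. wt x i \<noteq> wt x j" if "i \<noteq> j" for i j
  proof (rule ccontr)
    assume "\<nexists>x. wt x i \<noteq> wt x j"
    then have *: "wt x i = wt x j" for x by blast
    let ?R = "\<lambda>A. (matrix_inv P ** A ** P) $ i $ i - (matrix_inv P ** A ** P) $ j $ j"
    have R_poly: "?R \<in> matrix_poly"
      using matrix_poly_conj_nth unfolding matrix_poly_def by (intro algebra_gen_diff) auto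
    have R_range: "\<forall>A\<in>range \<rho>. ?R A = 0"
    proof
      fix A assume "A \<in> range \<rho>"
      then obtain x where "A = \<rho> x" by blast
      then have "matrix_inv P ** A ** P = diag (wt x)"
        using wt conj_conj_inv(1)[OF P(1)] by simp
      then show "?R A = 0" using * by (simp add: diag_nth)
    qed
    have "\<forall>Q\<in>matrix_poly. (\<forall>A\<in>range \<rho>. Q A = 0) \<longrightarrow> (\<forall>A\<in>T. Q A = 0)"
      using T(2) unfolding zariski_dense_in_def by (rule conjunct2)
    from bspec[OF this R_poly] R_range have R: "\<forall>A\<in>T. ?R A = 0"
      by (rule mp)
    obtain d where "d i \<noteq> d j" "conj_diag P d \<in> T" using P(3) \<open>i \<noteq> j\<close> by blast
    then show False using bspec[OF R, of "conj_diag P d"]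
      by (simp add: conj_conj_inv(1)[OF P(1)] diag_nth)
  qed
  moreover have "\<rho> \<in> Hom T" using \<rho> sub unfolding Hom_def by blast
  ultimately show ?thesis
    using T(1) P(1,4) wt unfolding diagonalized_def by blast
qed

context
  fixes \<rho> T P wt
  assumes diagonalized: "diagonalized T \<rho> P wt"
begin

lemma max_T: "maximal_torus G T" and rho_T: "\<rho> \<in> Hom T" and inv_P: "invertible P"
  and rho_diag: "\<rho> x = conj_diag P (wt x)"
  and separated: "i \<noteq> j \<Longrightarrow> \<exists>x. wt x i \<noteq> wt x j"
  and exp_T: "conj_diag P \<xi> \<in> \<gg> \<Longrightarrow> conj_diag P (\<lambda>i. exp (t * \<xi> i)) \<in> T"
  using diagonalized unfolding diagonalized_def by blast+

lemma T_sub_G: "T \<subseteq> G"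
  using max_T unfolding maximal_torus_def by blast

lemma rho_G: "\<rho> \<in> Hom G"
  using Hom_mono[OF rho_T T_sub_G] .

lemma rho_P: "matrix_inv P ** \<rho> x ** P = diag (wt x)"
  by (simp add: rho_diag conj_conj_inv[OF inv_P])

lemma weight_add: "wt (x + y) i = wt x i * wt y i"
proof -
  have "diag (wt (x + y)) = matrix_inv P ** (\<rho> x ** \<rho> y) ** P"
    using rho_P[of "x + y"] Hom_mult[OF rho_T, of x y] by simp
  then have "diag (wt (x + y)) = diag (\<lambda>i. wt x i * wt y i)"
    unfolding rho_diag conj_diag_mult[OF inv_P] conj_conj_inv(1)[OF inv_P] .
  then show ?thesis by (metis diag_nth)
qed

lemma weight_inverse: "wt x i * wt (- x) i = 1"
proof -
  have "diag (wt 0) = mat 1"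
    using rho_P[of 0] rep_zero[OF rho_G] by (simp add: matrix_inv_mult[OF inv_P])
  then have "wt 0 i = 1" by (metis diag_nth diag_one)
  then show ?thesis using weight_add[of x "- x" i] by simp
qed

lemma central_diag: "central \<rho> (conj_diag P d)"
  unfolding central_def rho_diag by (simp add: conj_diag_mult[OF inv_P] mult.commute)

text \<open>Commuting with \<rho> multiplies the (i,j) entry in the basis \<open>P\<close> by the
  same number from both weights; separated weights leave only the diagonal.\<close>

lemma centralE:
  assumes "central \<rho> X"
  obtains d where "X = conj_diag P d"
proof -
  let ?X = "matrix_inv P ** X ** P"
  have comm: "diag (wt x) ** ?X = ?X ** diag (wt x)" for x
  proof -
    have "\<rho> x ** X = X ** \<rho> x"
      using assms unfolding central_def by blast
    then have "matrix_inv P ** (\<rho> x ** X) ** P = matrix_inv P ** (X ** \<rho> x) ** P" by simp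
    then show ?thesis
      by (simp add: rho_diag matrix_mul_assoc[symmetric] matrix_inv_cancel[OF inv_P]
          matrix_inv_mult[OF inv_P])
  qed
  have "?X $ i $ j = 0" if "i \<noteq> j" for i j
  proof -
    obtain x where "wt x i \<noteq> wt x j" using separated[OF \<open>i \<noteq> j\<close>] by blast
    moreover have "wt x i * ?X $ i $ j = ?X $ i $ j * wt x j"
      using arg_cong[OF comm[of x], of "\<lambda>A. A $ i $ j"] by simp
    ultimately show ?thesis by (simp add: mult.commute)
  qed
  then have "?X = diag (\<lambda>i. ?X $ i $ i)"
    by (simp add: vec_eq_iff diag_nth)
  then show ?thesis
    using that conj_conj_inv(2)[OF inv_P, of X] by metis
qed

lemma central_nondegenerate:
  assumes X: "X \<in> \<gg>" "central \<rho> X" and orth: "\<And>Y. Y \<in> \<gg> \<Longrightarrow> central \<rho> Y \<Longrightarrow> trace (X ** Y) = 0"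
  shows "X = 0"
proof -
  obtain \<xi> where \<xi>: "X = conj_diag P \<xi>" using centralE[OF X(2)] .
  have "\<xi> k = 0" for k
  proof -
    let ?Y = "conj_diag P (\<lambda>i. if i = k then 1 else 0)"
    have "0 = trace (S ?Y ** X)"
      using orth[OF S_in central_S[OF rho_G central_diag]] trace_mul_sym[of X "S ?Y"] by simp
    also have "\<dots> = trace (?Y ** X)" by (rule S_trace[OF X(1)])
    also have "\<dots> = trace (diag (\<lambda>i. (if i = k then 1 else 0) * \<xi> i))"
      unfolding \<xi> conj_diag_mult[OF inv_P] by (rule trace_conj[OF inv_P])
    also have "\<dots> = (\<Sum>i\<in>UNIV. if i = k then \<xi> i else 0)"
      unfolding trace_def by (intro sum.cong) (auto simp: diag_nth)
    also have "\<dots> = \<xi> k" by simp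
    finally show ?thesis by simp
  qed
  then have "diag \<xi> = 0" by (simp add: vec_eq_iff diag_nth)
  then show ?thesis by (simp add: \<xi>)
qed

text \<open>On a nontrivial weight space of \<open>Ad \<rho>\<close> a cocycle is determined by its value at a single
  element that acts nontrivially, hence is a coboundary.\<close>

lemma cocycle_decompose:
  assumes v: "v \<in> Z1 \<gg> \<rho>"
  obtains A w where "A \<in> \<gg>" "w \<in> Z1 \<gg> \<rho>" "\<And>x. central \<rho> (w x)" "v = (\<lambda>x. cobdry \<rho> A x + w x)"
proof -
  define V where "V = (\<lambda>x. matrix_inv P ** v x ** P)"
  \<comment> \<open>The eigenvalue of \<open>Ad \<rho> x\<close> on the (i,j) matrix unit of the
    basis \<open>P\<close>.\<close>
  define l where "l = (\<lambda>x i j. wt x i * wt (- x) j)"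
  have P_Ad: "(matrix_inv P ** Ad \<rho> x B ** P) $ i $ j = l x i j * (matrix_inv P ** B ** P) $ i $ j" for x B i j
  proof -
    have "matrix_inv P ** Ad \<rho> x B ** P = diag (wt x) ** (matrix_inv P ** B ** P) ** diag (wt (- x))"
      unfolding Ad_def rho_diag
      by (simp add: matrix_mul_assoc[symmetric] matrix_inv_cancel[OF inv_P] matrix_inv_mult[OF inv_P])
    then show ?thesis by (simp add: l_def)
  qed
  have V_add: "V (x + y) $ i $ j = V x $ i $ j + l x i j * V y $ i $ j" for x y i j
    using P_Ad[of x "v y" i j]
    by (simp add: V_def Z1_add[OF v] matrix_add_ldistrib matrix_mult_add_rdistrib)
  obtain X where X: "\<And>i j. i \<noteq> j \<Longrightarrow> wt (X i j) i \<noteq> wt (X i j) j"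
    using separated by metis
  have l1: "l (X i j) i j \<noteq> 1" if "i \<noteq> j" for i j
    using X[OF that] weight_inverse[of "X i j" j] unfolding l_def
    by (metis mult.commute mult_cancel_left mult_zero_left zero_neq_one)
  \<comment> \<open>Solves \<open>V x = (l x - 1) a\<close> at the chosen \<open>x = X i j\<close>;
    symmetry of \<open>V (x + X i j)\<close> in its two summands extends the equation to all
    \<open>x\<close>.\<close>
  define a where "a = (\<lambda>i j. V (X i j) $ i $ j / (l (X i j) i j - 1))"
  have Va: "V x $ i $ j = (l x i j - 1) * a i j" if "i \<noteq> j" for x i j
  proof -
    have "V x $ i $ j + l x i j * V (X i j) $ i $ j = V (X i j) $ i $ j + l (X i j) i j * V x $ i $ j"
      using V_add[of x "X i j" i j] V_add[of "X i j" x i j] by (simp add: add.commute)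
    then show ?thesis using l1[OF that] unfolding a_def by (simp add: field_simps)
  qed
  define A0 where "A0 = P ** (\<chi> i j. if i = j then 0 else a i j) ** matrix_inv P"
  have A0: "(matrix_inv P ** A0 ** P) $ i $ j = (if i = j then 0 else a i j)" for i j
    by (simp add: A0_def conj_conj_inv[OF inv_P])
  define w0 where "w0 = (\<lambda>x. v x - cobdry \<rho> A0 x)"
  have cen0: "central \<rho> (w0 x)" for x
  proof -
    let ?W = "matrix_inv P ** w0 x ** P"
    have "?W $ i $ j = 0" if "i \<noteq> j" for i j
    proof -
      have "?W $ i $ j = V x $ i $ j - ((matrix_inv P ** Ad \<rho> x A0 ** P) $ i $ j - (matrix_inv P ** A0 ** P) $ i $ j)"
        by (simp add: w0_def cobdry_def V_def matrix_mult_diff matrix_diff_mult)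
      then show ?thesis using that by (simp add: P_Ad A0 Va left_diff_distrib)
    qed
    then have "?W = diag (\<lambda>i. ?W $ i $ i)" by (simp add: vec_eq_iff diag_nth)
    then have "w0 x = conj_diag P (\<lambda>i. ?W $ i $ i)"
      by (metis conj_conj_inv(2)[OF inv_P])
    then show ?thesis by (metis central_diag)
  qed
  \<comment> \<open>\<open>A0\<close> need not lie in \<open>\<gg>\<close>. Since \<open>S\<close>
    fixes \<open>v\<close> and commutes with \<open>Ad\<close>, applying it moves both summands into
    \<open>\<gg>\<close>.\<close>
  have v_eq: "v x = cobdry \<rho> (S A0) x + S (w0 x)" for x
  proof -
    have "v x = S (cobdry \<rho> A0 x + w0 x)" using S_id[OF Z1_in[OF v]] by (simp add: w0_def)
    also have "S (cobdry \<rho> A0 x) = cobdry \<rho> (S A0) x"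
      unfolding cobdry_def S_diff Ad_eq[OF rho_G] by (simp add: S_conj[OF Hom_in[OF rho_G]])
    then have "S (cobdry \<rho> A0 x + w0 x) = cobdry \<rho> (S A0) x + S (w0 x)" by (simp add: S_add)
    finally show ?thesis .
  qed
  show thesis
  proof
    show "S A0 \<in> \<gg>" by (rule S_in)
    show "central \<rho> (S (w0 x))" for x by (rule central_S[OF rho_G cen0])
    show "v = (\<lambda>x. cobdry \<rho> (S A0) x + S (w0 x))" using v_eq by blast
    have "(\<lambda>x. S (w0 x)) = (\<lambda>x. v x - cobdry \<rho> (S A0) x)" using v_eq by simp
    then show "(\<lambda>x. S (w0 x)) \<in> Z1 \<gg> \<rho>"
      using Z1_diff[OF v cobdry_Z1[OF rho_G S_in]] by simp
  qed
qed

lemma central_cocycle_add: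
  assumes "w \<in> Z1 \<gg> \<rho>" "\<And>x. central \<rho> (w x)"
  shows "w (x + y) = w x + w y"
  using Z1_add[OF assms(1)] central_Ad[OF rho_G assms(2)] by simp

text \<open>Nondegeneracy of \<open>omega\<close>. The difference of two representatives is a
  coboundary plus a central cocycle \<open>w\<close>; coboundaries pair to zero, and central test
  cocycles supported on one generator force \<open>w\<close> to vanish on the other.\<close>

lemma cohom_eqI:
  assumes h: "h \<in> H1 \<gg> \<rho>" and h': "h' \<in> H1 \<gg> \<rho>" and "c \<noteq> 0"
    and eq: "\<And>k. k \<in> H1 \<gg> \<rho> \<Longrightarrow> omega c \<rho> h k = omega c \<rho> h' k"
  shows "h = h'"
proof -
  obtain u u' where u: "u \<in> h" "u' \<in> h'" using H1_nonempty h h' by blast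
  have Z: "u \<in> Z1 \<gg> \<rho>" "u' \<in> Z1 \<gg> \<rho>" using H1_in_Z1 h h' u by blast+
  obtain A w where A: "A \<in> \<gg>" and w: "w \<in> Z1 \<gg> \<rho>" "\<And>x. central \<rho> (w x)"
    and d: "(\<lambda>x. u x - u' x) = (\<lambda>x. cobdry \<rho> A x + w x)"
    by (rule cocycle_decompose[OF Z1_diff[OF Z]]) (rule that)
  have pair0: "pairing c \<rho> w v = 0" if v: "v \<in> Z1 \<gg> \<rho>" for v
  proof -
    have "pairing c \<rho> u v = pairing c \<rho> u' v"
      using eq[OF H1_class[OF v]] omega_eq[OF rho_G h u(1) H1_class[OF v] H1_class_self[OF v]]
        omega_eq[OF rho_G h' u(2) H1_class[OF v] H1_class_self[OF v]] by simp
    then have "pairing c \<rho> (\<lambda>x. u x - u' x) v = 0" by (simp add: pairing_diff_left)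
    then show ?thesis unfolding d pairing_add_left by (simp add: pairing_cobdry_left[OF rho_G v])
  qed
  have "w (0, 1) = 0"
  proof (rule central_nondegenerate[OF Z1_in[OF w(1)] w(2)])
    fix Y assume Y: "Y \<in> \<gg>" "central \<rho> Y"
    have "central \<rho> 0" by (simp add: central_def)
    from pair0[OF central_Z1[OF rho_G Y(1) alg_zero Y(2) this]] \<open>c \<noteq> 0\<close> central_Ad[OF rho_G Y(2)]
    show "trace (w (0, 1) ** Y) = 0"
      using central_Ad[OF rho_G \<open>central \<rho> 0\<close>]
      by (simp add: pairing_def cup_def trace_form_def trace_0[simplified])
  qed
  moreover have "w (1, 0) = 0"
  proof (rule central_nondegenerate[OF Z1_in[OF w(1)] w(2)])
    fix Y assume Y: "Y \<in> \<gg>" "central \<rho> Y"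
    have "central \<rho> 0" by (simp add: central_def)
    from pair0[OF central_Z1[OF rho_G alg_zero Y(1) this Y(2)]] \<open>c \<noteq> 0\<close> central_Ad[OF rho_G Y(2)]
    show "trace (w (1, 0) ** Y) = 0"
      using central_Ad[OF rho_G \<open>central \<rho> 0\<close>]
      by (simp add: pairing_def cup_def trace_form_def trace_0[simplified])
  qed
  moreover have "w (- x) = - w x" for x
    using central_cocycle_add[OF w, of 0 0] central_cocycle_add[OF w, of x "- x"]
    by (simp add: eq_neg_iff_add_eq_0 add.commute)
  ultimately have "w x = 0" for x
    by (induction x rule: int_pair_induct) (simp_all add: central_cocycle_add[OF w])
  then have "u x = u' x + cobdry \<rho> A x" for x
    using fun_cong[OF d, of x] by (simp add: algebra_simps)
  then have "(u', u) \<in> cohom \<rho>" by (intro cohomI[OF Z(2,1) A]) auto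
  then show ?thesis using H1_eqI[OF h' h u(2,1)] by simp
qed

section \<open>Independence of the derivative from the lift\<close>

text \<open>A central cocycle integrates to the curve \<gamma> of representations into
  \<open>T\<close>, obtained by exponentiating its diagonal values. A single element of
  \<open>G\<close> conjugates the whole curve into \<open>T0\<close>, where \<open>F\<close> is
  zero.\<close>

lemma deriv_central:
  assumes F: "F \<in> invariant_poly G" and D: "rep_deriv \<rho> F D"
    and T0: "maximal_torus G T0" and van: "\<And>\<sigma>. \<sigma> \<in> Hom T0 \<Longrightarrow> F \<sigma> = 0"
    and w: "w \<in> Z1 \<gg> \<rho>" "\<And>x. central \<rho> (w x)"
  shows "D (\<lambda>x. w x ** \<rho> x) = 0"
proof -
  have "\<exists>\<theta>. \<forall>x. w x = conj_diag P (\<theta> x)"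
    by (rule choice) (use centralE[OF w(2)] in metis)
  then obtain \<theta> where \<theta>: "\<And>x. w x = conj_diag P (\<theta> x)" by blast
  have \<theta>_P: "diag (\<theta> x) = matrix_inv P ** w x ** P" for x
    by (simp add: \<theta> conj_conj_inv[OF inv_P])
  have \<theta>_add: "\<theta> (x + y) i = \<theta> x i + \<theta> y i" for x y i
  proof -
    have "diag (\<theta> (x + y)) = diag (\<theta> x) + diag (\<theta> y)"
      by (simp add: \<theta>_P central_cocycle_add[OF w] matrix_add_ldistrib matrix_mult_add_rdistrib)
    then have "diag (\<theta> (x + y)) $ i $ i = (diag (\<theta> x) + diag (\<theta> y)) $ i $ i" by simp
    then show ?thesis by (simp add: diag_nth)
  qed
  define \<gamma> where "\<gamma> = (\<lambda>t x. conj_diag P (\<lambda>i. exp (t * \<theta> x i) * wt x i))"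
  have \<gamma>_T: "\<gamma> t \<in> Hom T" for t
    unfolding Hom_def
  proof (intro CollectI conjI allI)
    show "\<gamma> t x \<in> T" for x
    proof -
      have "conj_diag P (\<lambda>i. exp (t * \<theta> x i)) \<in> T"
        using exp_T Z1_in[OF w(1), of x] by (simp add: \<theta>)
      then have "(conj_diag P (\<lambda>i. exp (t * \<theta> x i))) ** \<rho> x \<in> T"
        using torus_mult_closed Hom_in[OF rho_T] max_T unfolding maximal_torus_def by blast
      then show ?thesis unfolding rho_diag conj_diag_mult[OF inv_P] \<gamma>_def .
    qed
    show "\<gamma> t (x + y) = \<gamma> t x ** \<gamma> t y" for x y
      unfolding \<gamma>_def conj_diag_mult[OF inv_P]
      by (simp add: \<theta>_add weight_add distrib_left exp_add mult_ac)
  qed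
  obtain g where g: "g \<in> G" "\<And>A. A \<in> T \<Longrightarrow> g ** A ** matrix_inv g \<in> T0"
    using max_torus_conj[OF T0 max_T] by blast
  have F0: "F (\<gamma> t) = 0" for t
  proof -
    have "(\<lambda>x. g ** \<gamma> t x ** matrix_inv g) \<in> Hom T0"
      unfolding Hom_def
    proof (intro CollectI conjI allI)
      show "g ** \<gamma> t x ** matrix_inv g \<in> T0" for x using g(2) Hom_in[OF \<gamma>_T] by blast
      show "g ** \<gamma> t (x + y) ** matrix_inv g =
          g ** \<gamma> t x ** matrix_inv g ** (g ** \<gamma> t y ** matrix_inv g)" for x y
        by (simp add: Hom_mult[OF \<gamma>_T] matrix_mul_assoc[symmetric] matrix_inv_cancel[OF invertible[OF g(1)]])
    qed
    then have "F (\<lambda>x. g ** \<gamma> t x ** matrix_inv g) = 0" by (rule van)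
    then show ?thesis
      using F g(1) Hom_mono[OF \<gamma>_T T_sub_G] unfolding invariant_poly_def by simp
  qed
  show ?thesis
  proof (rule rep_deriv_eventually_const[OF D, of \<gamma>])
    show "\<gamma> 0 = \<rho>" by (simp add: \<gamma>_def rho_diag fun_eq_iff)
    show "\<forall>\<^sub>F t in nhds 0. F (\<gamma> t) = 0" by (simp add: F0)
    show "has_mderiv (\<lambda>t. \<gamma> t x) (w x ** \<rho> x)" for x
    proof -
      have "has_mderiv (\<lambda>t. diag (\<lambda>i. exp (t * \<theta> x i) * wt x i)) (diag (\<lambda>i. \<theta> x i * wt x i))"
        unfolding has_mderiv_def
      proof (intro allI)
        fix i j
        show "((\<lambda>t. diag (\<lambda>i. exp (t * \<theta> x i) * wt x i) $ i $ j) has_field_derivative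
            diag (\<lambda>i. \<theta> x i * wt x i) $ i $ j) (at 0)"
          by (cases "i = j") (auto simp: diag_nth intro!: derivative_eq_intros)
      qed
      from has_mderiv_mult[OF has_mderiv_mult[OF has_mderiv_const this] has_mderiv_const]
      show ?thesis
        by (simp add: \<gamma>_def \<theta> rho_diag conj_diag_mult[OF inv_P])
    qed
  qed
qed

end

text \<open>A coboundary is tangent to a curve of conjugates of \<rho>, along which an invariant
  function is constant.\<close>

lemma deriv_cobdry:
  assumes F: "F \<in> invariant_poly G" and \<rho>: "\<rho> \<in> Hom G" and D: "rep_deriv \<rho> F D" and A: "A \<in> \<gg>"
  shows "D (\<lambda>x. cobdry \<rho> A x ** \<rho> x) = 0"
proof -
  \<comment> \<open>Conjugation by a curve with velocity X moves \<rho> with velocity X\<rho> -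
    \<rho>X, while the coboundary of \<open>A\<close> gives \<rho>A - A\<rho>; hence the
    sign.\<close>
  obtain K where K: "K 0 = mat 1" "has_mderiv K (- A)"
    "\<forall>F\<in>invariant_poly G. \<forall>\<rho>\<in>Hom G. \<forall>\<^sub>F t in nhds 0. F (\<lambda>x. K t ** \<rho> x ** matrix_inv (K t)) = F \<rho>"
    using curve[OF alg_uminus[OF A]] by (elim exE conjE)
  have K0: "matrix_inv (K 0) = mat 1"
    by (simp add: K(1) matrix_inv_unique)
  show ?thesis
  proof (rule rep_deriv_eventually_const[OF D, of "\<lambda>t x. K t ** \<rho> x ** matrix_inv (K t)"])
    show "(\<lambda>x. K 0 ** \<rho> x ** matrix_inv (K 0)) = \<rho>"
      unfolding K0 unfolding K(1) by simp
    show "\<forall>\<^sub>F t in nhds 0. F (\<lambda>x. K t ** \<rho> x ** matrix_inv (K t)) = F \<rho>"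
      using K(3) F \<rho> by blast
    show "has_mderiv (\<lambda>t. K t ** \<rho> x ** matrix_inv (K t)) (cobdry \<rho> A x ** \<rho> x)" for x
    proof -
      have "cobdry \<rho> A x ** \<rho> x = \<rho> x ** A - A ** \<rho> x"
        unfolding cobdry_def Ad_eq[OF \<rho>]
        by (simp add: matrix_diff_mult matrix_mul_assoc[symmetric] matrix_inv_mult rep_invertible[OF \<rho>])
      moreover have "(- A) ** \<rho> x = - (A ** \<rho> x)"
        using matrix_diff_mult[of 0 A "\<rho> x"] by simp
      ultimately show ?thesis
        using has_mderiv_mult[OF has_mderiv_mult[OF K(2) has_mderiv_const[of "\<rho> x"]]
            has_mderiv_inverse(1)[OF K(2,1)]]
        unfolding K0 unfolding K(1) by simp
    qed
  qed
qed

text \<open>To be applied to the difference of two lifts of one function on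
  \<open>X0 G T\<close>.\<close>

lemma deriv_zero:
  assumes F: "F \<in> invariant_poly G" and \<rho>: "\<rho> \<in> Hom G" "dense_rep G \<rho>" and D: "rep_deriv \<rho> F D"
    and T: "maximal_torus G T" and van: "\<And>\<sigma>. \<sigma> \<in> Hom T \<Longrightarrow> F \<sigma> = 0" and u: "u \<in> Z1 \<gg> \<rho>"
  shows "D (\<lambda>x. u x ** \<rho> x) = 0"
proof -
  obtain T' P wt where d: "diagonalized T' \<rho> P wt" using dense_rep_diagonalized[OF \<rho>] by blast
  obtain A w where *: "A \<in> \<gg>" "w \<in> Z1 \<gg> \<rho>" "\<And>x. central \<rho> (w x)" "u = (\<lambda>x. cobdry \<rho> A x + w x)"
    by (rule cocycle_decompose[OF d u]) (rule that)
  have "D (\<lambda>x. u x ** \<rho> x) = D (\<lambda>x. cobdry \<rho> A x ** \<rho> x) + D (\<lambda>x. w x ** \<rho> x)"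
    unfolding *(4) matrix_mult_add_rdistrib by (rule rep_derivD(1)[OF D])
  then show ?thesis
    using deriv_cobdry[OF F \<rho>(1) D *(1)] deriv_central[OF d F D T van *(2,3)] by simp
qed

section \<open>The bracket of two trace functions\<close>

lemma trace_invariant: "(\<lambda>\<rho>. trace (\<rho> g)) \<in> invariant_poly G"
  unfolding invariant_poly_def using trace_rep_poly trace_conj[OF invertible] by simp

lemma tau_eq:
  assumes "x \<in> X0 G T" "\<rho> \<in> x"
  shows "tau G T g x = trace (\<rho> g)"
proof -
  have "(\<lambda>\<rho>. trace (\<rho> g)) ` x = {trace (\<rho> g)}"
    using assms invariant_poly_class[OF trace_invariant assms(1)] by blast
  then show ?thesis using assms(1) by (simp add: tau_def)
qed

lemma lifts_tau: "lifts G T (tau G T g) (\<lambda>\<rho>. trace (\<rho> g))"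
  unfolding lifts_def using trace_invariant tau_eq by blast

text \<open>A coboundary contributes the trace of a commutator.\<close>

lemma trace_cohom:
  assumes "\<rho> \<in> Hom G" "(u, v) \<in> cohom \<rho>"
  shows "trace (u x ** \<rho> x) = trace (v x ** \<rho> x)"
proof -
  obtain A where A: "v = (\<lambda>x. u x + cobdry \<rho> A x)" using assms(2) by (elim cohomE)
  have "cobdry \<rho> A x ** \<rho> x = \<rho> x ** A - A ** \<rho> x"
    unfolding cobdry_def Ad_eq[OF assms(1)]
    by (simp add: matrix_diff_mult matrix_mul_assoc[symmetric] matrix_inv_mult rep_invertible[OF assms(1)])
  then show ?thesis
    by (simp add: A matrix_mult_add_rdistrib trace_add trace_sub trace_mul_sym[of A])
qed

text \<open>The description in \<open>tangent_map\<close> ranges over all lifts and all cocycles of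
  the class. A lift differs from the trace function by an invariant function vanishing on
  \<open>Hom T\<close>, whose derivative is zero by \<open>deriv_zero\<close>; the choice of cocycle
  is settled by \<open>trace_cohom\<close>.\<close>

lemma tangent_map_tau:
  assumes T: "maximal_torus G T" and x: "x \<in> X0 G T" "\<rho> \<in> x" and dense: "dense_rep G \<rho>"
    and h: "h \<in> H1 \<gg> \<rho>" and u: "u \<in> h"
  shows "tangent_map G T \<rho> h (tau G T g) = trace (u g ** \<rho> g)"
proof -
  have \<rho>: "\<rho> \<in> Hom G" using X0_in_Hom x by blast
  let ?\<gamma> = "\<lambda>v t x. \<rho> x + mat t ** v x ** \<rho> x"
  have \<gamma>: "has_mderiv (\<lambda>t. ?\<gamma> v t x) (v x ** \<rho> x)" for v x
    using has_mderiv_linear[of "\<rho> x" "v x ** \<rho> x"] by (simp add: matrix_mul_assoc)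
  have \<gamma>0: "?\<gamma> v 0 = \<rho>" for v by simp
  have der: "((\<lambda>t. F (?\<gamma> v t)) has_field_derivative trace (u g ** \<rho> g)) (at 0)"
    if v: "v \<in> h" and F: "lifts G T (tau G T g) F" for v F
  proof -
    let ?E = "\<lambda>\<rho>. F \<rho> - trace (\<rho> g)"
    have E: "?E \<in> invariant_poly G"
      using F trace_invariant unfolding lifts_def by (intro invariant_poly_diff) auto
    then obtain D where D: "rep_deriv \<rho> ?E D"
      using rep_poly_deriv unfolding invariant_poly_def by blast
    have "?E \<sigma> = 0" if \<sigma>: "\<sigma> \<in> Hom T" for \<sigma>
    proof -
      have "T \<subseteq> G" using T unfolding maximal_torus_def by blast
      then have self: "\<sigma> \<in> git_class G \<sigma>" using git_class_self Hom_mono[OF \<sigma>] by blast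
      have X0: "git_class G \<sigma> \<in> X0 G T" using \<sigma> unfolding X0_def by (rule imageI)
      have "tau G T g (git_class G \<sigma>) = F \<sigma>"
        using F X0 self unfolding lifts_def by blast
      then show ?thesis using tau_eq[OF X0 self] by simp
    qed
    then have "D (\<lambda>x. v x ** \<rho> x) = 0"
      using deriv_zero[OF E \<rho> dense D T _ H1_in_Z1[OF h v]] by blast
    then have 1: "((\<lambda>t. ?E (?\<gamma> v t)) has_field_derivative 0) (at 0)"
    proof -
      have "((\<lambda>t. ?E (?\<gamma> v t)) has_field_derivative D (\<lambda>x. v x ** \<rho> x)) (at 0)"
        by (rule rep_derivD(2)[OF D, where \<gamma> = "?\<gamma> v"]) (rule \<gamma>0, rule \<gamma>)
      then show ?thesis using \<open>D (\<lambda>x. v x ** \<rho> x) = 0\<close> by simp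
    qed
    have 2: "((\<lambda>t. trace (?\<gamma> v t g)) has_field_derivative trace (v g ** \<rho> g)) (at 0)"
      using \<gamma>[where v = v and x = g] unfolding has_mderiv_def trace_def by (intro DERIV_sum) blast
    show ?thesis
      using DERIV_add[OF 1 2] trace_cohom[OF \<rho> H1_cohom[OF h u v]] by simp
  qed
  show ?thesis
    unfolding tangent_map_def
  proof (rule the_equality)
    show "\<exists>v\<in>h. \<exists>F. lifts G T (tau G T g) F \<and>
        ((\<lambda>t. F (?\<gamma> v t)) has_field_derivative trace (u g ** \<rho> g)) (at 0)"
    proof (intro bexI[OF _ u] exI conjI)
      show "lifts G T (tau G T g) (\<lambda>\<rho>. trace (\<rho> g))" by (rule lifts_tau)
      show "((\<lambda>t. trace (?\<gamma> u t g)) has_field_derivative trace (u g ** \<rho> g)) (at 0)"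
        by (rule der[OF u lifts_tau])
    qed
    show "d = trace (u g ** \<rho> g)"
      if "\<exists>v\<in>h. \<exists>F. lifts G T (tau G T g) F \<and> ((\<lambda>t. F (?\<gamma> v t)) has_field_derivative d) (at 0)" for d
      using that der DERIV_unique by blast
  qed
qed

definition ham :: "complex \<Rightarrow> 'n rep \<Rightarrow> int \<Rightarrow> int \<Rightarrow> int \<times> int \<Rightarrow> complex^'n^'n" where
  "ham c \<rho> p q x = mat (of_int (fst x)) ** (mat (of_int q / c) ** S (\<rho> (p, q)))
     + mat (of_int (snd x)) ** (mat (- of_int p / c) ** S (\<rho> (p, q)))"

lemma ham_Z1:
  assumes \<rho>: "\<rho> \<in> Hom G"
  shows "ham c \<rho> p q \<in> Z1 \<gg> \<rho>"
proof -
  have "central \<rho> (mat a ** S (\<rho> (p, q)))" for a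
    using central_S[OF \<rho> central_rep[OF \<rho>]] unfolding central_def
    by (simp add: matrix_mul_assoc mat_mult_commute) (simp add: matrix_mul_assoc[symmetric])
  then show ?thesis
    unfolding ham_def[abs_def] by (intro central_Z1[OF \<rho>] alg_scale S_in)
qed

text \<open>A central \<open>M\<close> absorbs the twist by \<open>Ad\<close>, so the trace against
  \<open>M\<close> turns a cocycle into an additive function on the group, determined by the two
  generators.\<close>

lemma trace_cocycle:
  assumes \<rho>: "\<rho> \<in> Hom G" and v: "v \<in> Z1 \<gg> \<rho>" and M: "central \<rho> M"
  shows "trace (v (p, q) ** M) = of_int p * trace (v (1, 0) ** M) + of_int q * trace (v (0, 1) ** M)"
proof (rule additive_int_pair)
  fix x y
  have "trace (Ad \<rho> x (v y) ** M) = trace (Ad \<rho> x (v y) ** Ad \<rho> x M)"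
    using central_Ad[OF \<rho> M] by simp
  then show "trace (v (x + y) ** M) = trace (v x ** M) + trace (v y ** M)"
    by (simp add: Z1_add[OF v] matrix_mult_add_rdistrib trace_add trace_Ad_Ad[OF \<rho>])
qed

text \<open>\<open>S\<close> disappears because it is paired with elements of \<open>\<gg>\<close>,
  and \<open>Ad\<close> disappears because \<open>\<rho> (p, q)\<close> is central; additivity of
  the trace then assembles the two generators. This is the Hamiltonian equation on cochains.\<close>

lemma ham_pairing:
  assumes \<rho>: "\<rho> \<in> Hom G" and v: "v \<in> Z1 \<gg> \<rho>" and c: "c \<noteq> 0"
  shows "pairing c \<rho> (ham c \<rho> p q) v = trace (v (p, q) ** \<rho> (p, q))"
proof -
  let ?M = "\<rho> (p, q)"
  have *: "trace (S ?M ** Ad \<rho> x (v y)) = trace (v y ** ?M)" for x y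
  proof -
    have "trace (S ?M ** Ad \<rho> x (v y)) = trace (?M ** Ad \<rho> x (v y))"
      by (rule S_trace[OF Ad_alg[OF \<rho> Z1_in[OF v]]])
    also have "\<dots> = trace (Ad \<rho> x ?M ** Ad \<rho> x (v y))"
      using central_Ad[OF \<rho> central_rep[OF \<rho>]] by simp
    also have "\<dots> = trace (v y ** ?M)"
      using trace_mul_sym[of ?M "v y"] by (simp add: trace_Ad_Ad[OF \<rho>])
    finally show ?thesis .
  qed
  have "pairing c \<rho> (ham c \<rho> p q) v =
      c * (of_int q / c * trace (v (0, 1) ** ?M)) - c * (- of_int p / c * trace (v (1, 0) ** ?M))"
    unfolding pairing_def cup_def trace_form_def ham_def
    by (simp add: matrix_mul_assoc[symmetric] trace_mat_mult *)
  also have "\<dots> = trace (v (p, q) ** ?M)"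
    using c by (simp add: trace_cocycle[OF \<rho> v central_rep[OF \<rho>], of p q])
  finally show ?thesis .
qed

text \<open>An invariant \<Phi> takes one value on the whole class, which makes the set inside
  \<open>bracket_at\<close> a singleton. That value is the differential of the first trace function
  evaluated on the Hamiltonian of the second.\<close>

lemma bracket_at_tau:
  assumes T: "maximal_torus G T" and x: "x \<in> X_dense G T" and c: "c \<noteq> 0"
    and \<Phi>: "\<Phi> \<in> invariant_poly G"
    and formula: "\<And>\<rho>. \<rho> \<in> Hom G \<Longrightarrow> \<Phi> \<rho> = 1 / c * of_int (p * s - q * r) * trace (S (\<rho> (r, s)) ** \<rho> (p, q))"
    and \<sigma>: "\<sigma> \<in> x"
  shows "bracket_at G \<gg> T c (tau G T (p, q)) (tau G T (r, s)) x = \<Phi> \<sigma>"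
proof -
  let ?H = "\<lambda>a b \<rho>. hamiltonian G \<gg> T c (tau G T (a, b)) \<rho>"
  have X0: "x \<in> X0 G T" using x unfolding X_dense_def by blast
  have ham: "?H a b \<rho> = cohom \<rho> `` {ham c \<rho> a b}"
    if \<rho>: "\<rho> \<in> x" "dense_rep G \<rho>" for \<rho> a b
    unfolding hamiltonian_def
  proof (rule the_equality)
    have \<rho>G: "\<rho> \<in> Hom G" using X0_in_Hom X0 \<rho> by blast
    let ?h = "cohom \<rho> `` {ham c \<rho> a b}"
    have h: "?h \<in> H1 \<gg> \<rho>" "ham c \<rho> a b \<in> ?h"
      using H1_class H1_class_self ham_Z1[OF \<rho>G] by blast+
    have om: "omega c \<rho> ?h k = tangent_map G T \<rho> k (tau G T (a, b))" if k: "k \<in> H1 \<gg> \<rho>" for k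
    proof -
      obtain v where v: "v \<in> k" using H1_nonempty[OF k] by blast
      show ?thesis
        by (simp add: omega_eq[OF \<rho>G h k v] tangent_map_tau[OF T X0 \<rho> k v]
            ham_pairing[OF \<rho>G H1_in_Z1[OF k v] c])
    qed
    then show "?h \<in> H1 \<gg> \<rho> \<and> (\<forall>k\<in>H1 \<gg> \<rho>. omega c \<rho> ?h k = tangent_map G T \<rho> k (tau G T (a, b)))"
      using h by blast
    obtain T' P wt where d: "diagonalized T' \<rho> P wt" using dense_rep_diagonalized[OF \<rho>G \<rho>(2)] by blast
    fix h' assume "h' \<in> H1 \<gg> \<rho> \<and> (\<forall>k\<in>H1 \<gg> \<rho>. omega c \<rho> h' k = tangent_map G T \<rho> k (tau G T (a, b)))"
    then show "h' = ?h" using cohom_eqI[OF d _ h(1) c] om by simp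
  qed
  have val: "omega c \<rho> (?H p q \<rho>) (?H r s \<rho>) = \<Phi> \<sigma>"
    if \<rho>: "\<rho> \<in> x" "dense_rep G \<rho>" for \<rho>
  proof -
    have \<rho>G: "\<rho> \<in> Hom G" using X0_in_Hom X0 \<rho> by blast
    have Z: "ham c \<rho> p q \<in> Z1 \<gg> \<rho>" "ham c \<rho> r s \<in> Z1 \<gg> \<rho>" using ham_Z1[OF \<rho>G] by blast+
    have "omega c \<rho> (?H p q \<rho>) (?H r s \<rho>)
        = trace (ham c \<rho> r s (p, q) ** \<rho> (p, q))"
      unfolding ham[OF \<rho>] omega_eq[OF \<rho>G H1_class[OF Z(1)] H1_class_self[OF Z(1)]
          H1_class[OF Z(2)] H1_class_self[OF Z(2)]]
      by (rule ham_pairing[OF \<rho>G Z(2) c])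
    also have "\<dots> = 1 / c * of_int (p * s - q * r) * trace (S (\<rho> (r, s)) ** \<rho> (p, q))"
    proof -
      have "trace (ham c \<rho> r s (p, q) ** \<rho> (p, q)) =
          of_int p * (of_int s / c * trace (S (\<rho> (r, s)) ** \<rho> (p, q)))
          + of_int q * (- of_int r / c * trace (S (\<rho> (r, s)) ** \<rho> (p, q)))"
        by (simp only: ham_def fst_conv snd_conv matrix_mult_add_rdistrib trace_add trace_mat_mult
            matrix_mul_assoc[symmetric])
      then show ?thesis using c by (simp add: field_simps)
    qed
    also have "\<dots> = \<Phi> \<rho>" using formula[OF \<rho>G] by simp
    also have "\<dots> = \<Phi> \<sigma>" using invariant_poly_class[OF \<Phi> X0 \<rho>(1) \<sigma>] .
    finally show ?thesis .
  qed
  obtain \<rho> where \<rho>: "\<rho> \<in> x" "dense_rep G \<rho>" using x unfolding X_dense_def by blast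
  let ?B = "\<lambda>\<rho>. omega c \<rho> (?H p q \<rho>) (?H r s \<rho>)"
  have "?B ` {\<rho>. \<rho> \<in> x \<and> dense_rep G \<rho>} = {\<Phi> \<sigma>}"
    using val \<rho> by (intro equalityI image_subsetI) (auto intro!: image_eqI[of _ _ \<rho>])
  then have "{?B \<rho> | \<rho>. \<rho> \<in> x \<and> dense_rep G \<rho>} = {\<Phi> \<sigma>}"
    by (simp add: setcompr_eq_image)
  then show ?thesis unfolding bracket_at_def by simp
qed

text \<open>The function \<Phi> descends to a candidate \<open>h\<close>. A competitor lifts to an
  invariant function that agrees with \<Phi> on the dense representations into \<open>T\<close>,
  hence on all of \<open>Hom T\<close>, and these represent every point of
  \<open>X0 G T\<close>.\<close>

theorem poisson_bracket_tau:
  assumes T: "maximal_torus G T" and x: "x \<in> X0 G T" and c: "c \<noteq> 0"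
    and \<Phi>: "\<Phi> \<in> invariant_poly G"
    and formula: "\<And>\<rho>. \<rho> \<in> Hom G \<Longrightarrow> \<Phi> \<rho> = 1 / c * of_int (p * s - q * r) * trace (S (\<rho> (r, s)) ** \<rho> (p, q))"
    and \<rho>: "\<rho> \<in> x"
  shows "poisson_bracket G \<gg> T c (tau G T (p, q)) (tau G T (r, s)) x = \<Phi> \<rho>"
proof -
  let ?b = "bracket_at G \<gg> T c (tau G T (p, q)) (tau G T (r, s))"
  \<comment> \<open>The chosen representative is immaterial, since \<Phi> is constant on
    classes.\<close>
  define h where "h = restrict (\<lambda>x. \<Phi> (SOME \<rho>. \<rho> \<in> x)) (X0 G T)"
  have h_eq: "h y = \<Phi> \<sigma>" if "y \<in> X0 G T" "\<sigma> \<in> y" for y \<sigma>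
    using that invariant_poly_class[OF \<Phi> that(1) someI[of "\<lambda>\<rho>. \<rho> \<in> y"] that(2)] by (simp add: h_def)
  have TG: "T \<subseteq> G" "torus T" using T unfolding maximal_torus_def by blast+
  have cls: "git_class G \<sigma> \<in> X0 G T" "\<sigma> \<in> git_class G \<sigma>" if "\<sigma> \<in> Hom T" for \<sigma>
    using that git_class_self Hom_mono[OF that TG(1)] unfolding X0_def by blast+
  have bracket: "h y = ?b y" if "y \<in> X_dense G T" for y
  proof -
    have y: "y \<in> X0 G T" using that unfolding X_dense_def by blast
    obtain \<sigma> where \<sigma>: "\<sigma> \<in> y" using \<open>y \<in> X_dense G T\<close> unfolding X_dense_def by blast
    show ?thesis using bracket_at_tau[OF T that c \<Phi> formula \<sigma>] h_eq[OF y \<sigma>] by simp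
  qed
  have "poisson_bracket G \<gg> T c (tau G T (p, q)) (tau G T (r, s)) = h"
    unfolding poisson_bracket_def
  proof (rule the_equality)
    have "lifts G T h \<Phi>" unfolding lifts_def using \<Phi> h_eq by blast
    moreover have "h \<in> extensional (X0 G T)" unfolding h_def by (rule restrict_extensional)
    ultimately have "h \<in> coordinate_ring G T" unfolding coordinate_ring_def by blast
    then show "h \<in> coordinate_ring G T \<and>
        (\<forall>x\<in>X_dense G T. h x = ?b x)"
      using bracket by blast
    fix h' assume h': "h' \<in> coordinate_ring G T \<and>
        (\<forall>x\<in>X_dense G T. h' x = ?b x)"
    then obtain F where F: "lifts G T h' F" and ext: "h' \<in> extensional (X0 G T)"
      unfolding coordinate_ring_def by blast
    have "F \<in> invariant_poly G" using F unfolding lifts_def by blast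
    let ?E = "\<lambda>\<rho>. F \<rho> - \<Phi> \<rho>"
    have E: "?E \<in> rep_poly"
      using invariant_poly_diff[OF \<open>F \<in> invariant_poly G\<close> \<Phi>] unfolding invariant_poly_def by blast
    have E0: "?E \<sigma> = 0" if "\<sigma> \<in> Hom T" for \<sigma>
    proof (rule dense_representations_dense[OF TG(2) _ E _ that])
      show "invertible A" if "A \<in> T" for A using invertible TG(1) that by blast
      show "?E \<tau> = 0" if \<tau>: "\<tau> \<in> Hom T" "zariski_dense_in (range \<tau>) T" for \<tau>
      proof -
        have "git_class G \<tau> \<in> X_dense G T"
          using cls[OF \<tau>(1)] \<tau>(2) T unfolding X_dense_def dense_rep_def by blast
        then have "h' (git_class G \<tau>) = h (git_class G \<tau>)" using h' bracket by simp
        then show ?thesis using F cls[OF \<tau>(1)] h_eq unfolding lifts_def by simp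
      qed
    qed
    show "h' = h"
    proof (rule extensionalityI[OF ext])
      show "h \<in> extensional (X0 G T)" unfolding h_def by (rule restrict_extensional)
      fix y assume y: "y \<in> X0 G T"
      then obtain \<sigma> where \<sigma>: "\<sigma> \<in> Hom T" "y = git_class G \<sigma>" unfolding X0_def by blast
      then show "h' y = h y"
        using E0[OF \<sigma>(1)] cls[OF \<sigma>(1)] F h_eq unfolding lifts_def by simp
    qed
  qed
  then show ?thesis using h_eq[OF x \<rho>] by simp
qed

end

section \<open>Frames\<close>

lemma eigenbasis_diag:
  fixes P :: "'a::field^'n^'n"
  assumes P: "invertible P" and eig: "\<And>i. A *v column i P = d i *s column i P"
  shows "A = conj_diag P d"
proof -
  have "(A ** P) $ i $ j = (P ** diag d) $ i $ j" for i j
    using arg_cong[OF eig[of j], of "\<lambda>v. v $ i"]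
    by (simp add: matrix_vector_mult_def matrix_matrix_mult_def[of A P] column_def mult.commute)
  then have "A ** P = P ** diag d" by (simp add: vec_eq_iff)
  then have "A ** P ** matrix_inv P = conj_diag P d" by simp
  then show ?thesis by (simp add: matrix_mul_assoc[symmetric] matrix_inv_mult[OF P])
qed

lemma spanning_frame:
  fixes E :: "('a::field^'n) set"
  assumes "vec.span E = UNIV"
  shows "\<exists>P :: 'a^'n^'n. invertible P \<and> (\<forall>i. column i P \<in> E)"
proof -
  obtain B where B: "B \<subseteq> E" "vec.independent B" "E \<subseteq> vec.span B" "card B = vec.dim E"
    using vec.basis_exists by blast
  have span: "vec.span B = UNIV"
    using B(1,3) assms by (metis vec.span_eq vec.span_superset order_trans top.extremum_uniqueI vec.span_mono vec.span_span)
  have "finite B" using vec.finiteI_independent[OF B(2)] .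
  have "card B = CARD('n)"
    using B(4) assms vec.dim_span[of E] by (simp add: vec_dim_card card_cart_basis)
  then obtain f where f: "bij_betw f (UNIV :: 'n set) B"
    using \<open>finite B\<close> finite_same_card_bij[of "UNIV :: 'n set" B] by auto
  let ?P = "(\<chi> i j. f j $ i) :: 'a^'n^'n"
  have col: "column j ?P = f j" for j by (simp add: column_def vec_eq_iff)
  have "columns ?P = B"
    unfolding columns_def col using f by (auto simp: bij_betw_def)
  then have "invertible ?P"
    using span matrix_right_invertible_span_columns[of ?P] invertible_right_inverse by blast
  moreover have "column i ?P \<in> E" for i
    unfolding col using f B(1) by (auto simp: bij_betw_def)
  ultimately show ?thesis by blast
qed

section \<open>The special linear group\<close>

lemma mat_diag: "mat a = diag (\<lambda>_. a)"
  by (simp add: mat_def diag_def)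

lemma SL_invertible: "A \<in> SL \<Longrightarrow> invertible A"
  by (simp add: SL_def invertible_det_nz)

text \<open>Scalars do not affect conjugation, so \<open>B\<close> may be normalized to determinant
  1.\<close>

lemma SL_rescale:
  fixes B :: "complex^'n^'n"
  assumes B: "invertible B"
  shows "\<exists>g\<in>SL. \<forall>X. g ** X ** matrix_inv g = B ** X ** matrix_inv B"
proof -
  have "det B \<noteq> 0" using B by (simp add: invertible_det_nz)
  \<comment> \<open>An n-th root of the inverse determinant.\<close>
  define w where "w = exp (- Ln (det B) / of_nat CARD('n))"
  have "w ^ CARD('n) = inverse (det B)"
    unfolding w_def exp_of_nat_mult[symmetric] using \<open>det B \<noteq> 0\<close> by (simp add: exp_minus)
  then have "det (mat w ** B) = 1"
    using \<open>det B \<noteq> 0\<close> by (simp add: det_mul mat_diag det_diag)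
  moreover have "w \<noteq> 0" by (simp add: w_def)
  have inv: "matrix_inv (mat w ** B) = mat (inverse w) ** matrix_inv B"
  proof (rule matrix_inv_unique(2))
    have "mat w ** B ** (mat (inverse w) ** matrix_inv B) = mat w ** (B ** mat (inverse w)) ** matrix_inv B"
      by (simp add: matrix_mul_assoc)
    also have "\<dots> = (mat w ** mat (inverse w)) ** (B ** matrix_inv B)"
      unfolding mat_mult_commute[of B] by (simp add: matrix_mul_assoc)
    also have "\<dots> = mat 1"
      using \<open>w \<noteq> 0\<close> by (simp add: matrix_inv_mult[OF B] mat_diag diag_mult)
    finally show "mat w ** B ** (mat (inverse w) ** matrix_inv B) = mat 1" .
  qed
  have "(mat w ** B) ** X ** matrix_inv (mat w ** B) = B ** X ** matrix_inv B" for X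
  proof -
    have "(mat w ** B) ** X ** matrix_inv (mat w ** B) = mat w ** (B ** X ** mat (inverse w)) ** matrix_inv B"
      by (simp add: inv matrix_mul_assoc)
    also have "\<dots> = (mat w ** mat (inverse w)) ** (B ** X ** matrix_inv B)"
      unfolding mat_mult_commute[of "B ** X"] by (simp add: matrix_mul_assoc)
    also have "\<dots> = B ** X ** matrix_inv B"
      using \<open>w \<noteq> 0\<close> by (simp add: mat_diag diag_mult) (simp add: diag_one)
    finally show ?thesis .
  qed
  ultimately show ?thesis by (intro bexI[of _ "mat w ** B"]) (auto simp: SL_def)
qed

definition SL_torus :: "complex^'n^'n \<Rightarrow> (complex^'n^'n) set" where
  "SL_torus P = (\<lambda>d. conj_diag P d) ` {d. (\<Prod>i\<in>UNIV. d i) = 1}"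

lemma det_conj_diag:
  fixes P :: "complex^'n^'n"
  assumes "invertible P"
  shows "det (conj_diag P d) = (\<Prod>i\<in>UNIV. d i)"
proof -
  have "det P * det (matrix_inv P) = 1"
    using matrix_inv_mult(1)[OF assms] by (metis det_I det_mul)
  then show ?thesis by (simp add: det_mul det_diag mult.commute[of "det P"] mult.assoc)
qed

text \<open>All but one of the n diagonal entries are free coordinates, and the last one is the
  inverse of their product, so the rank is n - 1.\<close>

lemma torus_SL_torus:
  fixes P :: "complex^'n^'n"
  assumes P: "invertible P"
  shows "torus (SL_torus P)"
proof -
  obtain k where n: "CARD('n) = Suc k" using not0_implies_Suc[of "CARD('n)"] by auto
  obtain e where e: "bij_betw e {..<Suc k} (UNIV :: 'n set)"
    using ex_bij_betw_nat_finite[of "UNIV :: 'n set"] n by (auto simp: atLeast0LessThan)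
  have prod_e: "(\<Prod>i\<in>UNIV. d i) = (\<Prod>j<k. d (e j)) * d (e k)" for d :: "'n \<Rightarrow> complex"
    using prod.reindex_bij_betw[OF e, of d] by simp
  define ie where "ie = inv_into {..<Suc k} e"
  have ie: "ie (e j) = j" if "j \<le> k" for j
    unfolding ie_def using bij_betw_inv_into_left[OF e, of j] that by simp
  have ie_le: "e (ie i) = i" "ie i \<le> k" for i
    using bij_betw_inv_into_right[OF e, of i] bij_betwE[OF bij_betw_inv_into[OF e]]
    unfolding ie_def by (auto simp: less_Suc_eq_le)
  define \<psi> where "\<psi> = (\<lambda>z i. if ie i < k then z (ie i) else \<Prod>j<k. inverse (z j) :: complex)"
  have \<psi>_e: "\<psi> z (e j) = (if j < k then z j else \<Prod>j<k. inverse (z j))" if "j \<le> k" for z j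
    using that by (simp add: \<psi>_def ie)
  have prod_\<psi>: "(\<Prod>i\<in>UNIV. \<psi> z i) = 1" if "z \<in> Gm k" for z
    using that unfolding prod_e by (simp add: \<psi>_e Gm_def flip: prod.distrib)
  have gen: "(\<lambda>z. z j) \<in> laurent_poly k" "(\<lambda>z. inverse (z j)) \<in> laurent_poly k" if "j < k" for j
    unfolding laurent_poly_def using that by (intro algebra_gen.gen; blast)+
  have coord: "(\<lambda>d. d i) \<in> algebra_gen {\<lambda>d. d i |i. True}" for i :: 'n
    by (rule algebra_gen.gen) blast
  have "torus ((\<lambda>z. conj_diag P (\<psi> z)) ` Gm k)"
  proof (rule torus_conj_diag[OF P])
    show "\<psi> (\<lambda>i. z i * w i) i = \<psi> z i * \<psi> w i" for z w i
      by (simp add: \<psi>_def flip: prod.distrib)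
    show "\<exists>f\<in>laurent_poly k. \<forall>z\<in>Gm k. f z = \<psi> z i" for i
    proof (cases "ie i < k")
      case True
      then show ?thesis by (intro bexI[OF _ gen(1)[OF True]]) (simp add: \<psi>_def)
    next
      case False
      have "(\<lambda>z. \<Prod>j<k. inverse (z j)) \<in> laurent_poly k"
        using gen(2) unfolding laurent_poly_def by (intro algebra_gen_prod) auto
      then show ?thesis by (rule bexI[rotated]) (use False in \<open>simp add: \<psi>_def\<close>)
    qed
    show "\<exists>Q\<in>algebra_gen {\<lambda>d. d i |i. True}. \<forall>z\<in>Gm k. Q (\<psi> z) = z j" if "j < k" for j
      by (intro bexI[OF _ coord[of "e j"]]) (use that in \<open>simp add: \<psi>_e\<close>)
    show "\<exists>Q\<in>algebra_gen {\<lambda>d. d i |i. True}. \<forall>z\<in>Gm k. Q (\<psi> z) = inverse (z j)" if "j < k" for j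
    proof (rule bexI)
      \<comment> \<open>Determinant 1 makes the reciprocal of an entry the product of the others,
        hence polynomial.\<close>
      show "(\<lambda>d. \<Prod>i\<in>UNIV - {e j}. d i) \<in> algebra_gen {\<lambda>d. d i |i. True}"
        using coord by (intro algebra_gen_prod) auto
      show "\<forall>z\<in>Gm k. (\<Prod>i\<in>UNIV - {e j}. \<psi> z i) = inverse (z j)"
      proof
        fix z assume z: "z \<in> Gm k"
        have "z j * (\<Prod>i\<in>UNIV - {e j}. \<psi> z i) = 1"
          using prod.remove[of UNIV "e j" "\<psi> z"] prod_\<psi>[OF z] that by (simp add: \<psi>_e)
        then show "(\<Prod>i\<in>UNIV - {e j}. \<psi> z i) = inverse (z j)"
          using inverse_unique by metis
      qed
    qed
  qed
  moreover have "(\<lambda>z. conj_diag P (\<psi> z)) ` Gm k = SL_torus P"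
  proof -
    have "\<psi> ` Gm k = {d. (\<Prod>i\<in>UNIV. d i) = 1}"
    proof (intro equalityI subsetI)
      fix d :: "'n \<Rightarrow> complex" assume "d \<in> {d. (\<Prod>i\<in>UNIV. d i) = 1}"
      then have d: "(\<Prod>i\<in>UNIV. d i) = 1" by simp
      then have nz: "d i \<noteq> 0" for i by (metis UNIV_I finite prod_zero_iff zero_neq_one)
      define z where "z = (\<lambda>j. if j < k then d (e j) else 1)"
      have "z \<in> Gm k" using nz by (simp add: z_def Gm_def)
      moreover have "\<psi> z i = d i" for i
      proof (cases "ie i < k")
        case True
        then show ?thesis by (simp add: \<psi>_def z_def ie_le)
      next
        case False
        then have "ie i = k" using ie_le(2)[of i] by simp
        then have "i = e k" using ie_le(1)[of i] by simp
        have "(\<Prod>j<k. d (e j)) * d (e k) = 1" using d unfolding prod_e .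
        then have "d (e k) = inverse (\<Prod>j<k. d (e j))" using inverse_unique by metis
        also have "\<dots> = (\<Prod>j<k. inverse (z j))" by (simp add: z_def flip: prod_inversef)
        finally show ?thesis using False \<open>i = e k\<close> by (simp add: \<psi>_def)
      qed
      ultimately show "d \<in> \<psi> ` Gm k" by (metis ext imageI)
    qed (use prod_\<psi> in auto)
    then show ?thesis unfolding SL_torus_def by (simp only: image_image flip: \<open>\<psi> ` Gm k = _\<close>)
  qed
  ultimately show ?thesis by simp
qed

lemma SL_torus_sub: "invertible P \<Longrightarrow> SL_torus P \<subseteq> SL"
  by (auto simp: SL_torus_def SL_def det_conj_diag)

text \<open>A basis of common eigenvectors puts \<open>T\<close> inside a torus of the same group,
  and maximality gives equality.\<close>

lemma max_torus_SL:
  fixes T :: "(complex^'n^'n) set"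
  assumes "maximal_torus SL T"
  shows "\<exists>P. invertible P \<and> T = SL_torus P"
proof -
  have T: "torus T" "T \<subseteq> SL" and max: "\<And>T'. torus T' \<Longrightarrow> T \<subseteq> T' \<Longrightarrow> T' \<subseteq> SL \<Longrightarrow> T' = T"
    using assms unfolding maximal_torus_def by blast+
  have "invertible A" if "A \<in> T" for A using T(2) SL_invertible that by blast
  from torus_eigenvectors_span[OF T(1) this]
  obtain P :: "complex^'n^'n" where P: "invertible P" "\<And>i. column i P \<in> common_eigenvectors T"
    using spanning_frame by blast
  have "T \<subseteq> SL_torus P"
  proof
    fix A assume A: "A \<in> T"
    have "\<forall>i. \<exists>a. A *v column i P = a *s column i P"
      using P(2) A unfolding common_eigenvectors_def by blast
    then obtain d where d: "\<And>i. A *v column i P = d i *s column i P" by metis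
    have "A = conj_diag P d" by (rule eigenbasis_diag[OF P(1) d])
    moreover from this have "(\<Prod>i\<in>UNIV. d i) = 1"
      using T(2) A det_conj_diag[OF P(1), of d] by (auto simp: SL_def)
    ultimately show "A \<in> SL_torus P" unfolding SL_torus_def by blast
  qed
  then have "SL_torus P = T" using max torus_SL_torus[OF P(1)] SL_torus_sub[OF P(1)] by blast
  then show ?thesis using P(1) by blast
qed

lemma invariant_polyD:
  "F \<in> invariant_poly G \<Longrightarrow> \<rho> \<in> Hom G \<Longrightarrow> g \<in> G \<Longrightarrow> F (\<lambda>x. g ** \<rho> x ** matrix_inv g) = F \<rho>"
  unfolding invariant_poly_def by blast

lemma mat_add: "mat (a + b) = mat a + (mat b :: 'a::monoid_add^'n^'n)"
  by (simp add: vec_eq_iff mat_def)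

lemma trace_mat: "trace (mat a :: complex^'n^'n) = of_nat CARD('n) * a"
  by (simp add: trace_def mat_def)

lemma classical_group_SL:
  "classical_group (SL :: (complex^'n^'n) set) sl (\<lambda>X. X - mat (trace X / of_nat CARD('n)))"
proof
  let ?S = "\<lambda>X :: complex^'n^'n. X - mat (trace X / of_nat CARD('n))"
  show "invertible A" if "A \<in> SL" for A :: "complex^'n^'n" using SL_invertible that .
  show "?S X \<in> sl" for X by (simp add: sl_def trace_sub trace_mat)
  show "?S X = X" if "X \<in> sl" for X using that by (simp add: sl_def)
  show "?S (X + Y) = ?S X + ?S Y" for X Y
    by (simp add: trace_add add_divide_distrib mat_add)
  show "?S (mat a ** X) = mat a ** ?S X" for a X
    by (simp only: trace_mat_mult matrix_mult_diff) (simp add: mat_diag diag_mult)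
  show "?S (A ** X ** matrix_inv A) = A ** ?S X ** matrix_inv A" if "A \<in> SL" for A X
  proof -
    have inv: "invertible A" using that SL_invertible by blast
    have "A ** mat a ** matrix_inv A = mat a" for a
      using matrix_inv_mult(1)[OF inv] unfolding mat_mult_commute[of A] by (simp flip: matrix_mul_assoc)
    then show ?thesis
      by (simp add: trace_conj[OF inv] matrix_mult_diff matrix_diff_mult)
  qed
  show "trace (?S X ** Y) = trace (X ** Y)" if "Y \<in> sl" for X Y
    using that by (simp add: matrix_diff_mult trace_sub trace_mat_mult sl_def)
  show "\<exists>K. K 0 = mat 1 \<and> has_mderiv K A \<and>
      (\<forall>F\<in>invariant_poly SL. \<forall>\<rho>\<in>Hom SL.
        \<forall>\<^sub>F t in nhds 0. F (\<lambda>x. K t ** \<rho> x ** matrix_inv (K t)) = F \<rho>)" for A :: "complex^'n^'n"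
  proof (intro exI conjI ballI)
    \<comment> \<open>This line need not stay in \<open>SL\<close>, but close to 0 it is invertible,
      and \<open>SL_rescale\<close> replaces it by an element of \<open>SL\<close> with the same
      conjugation.\<close>
    show *: "mat 1 + mat 0 ** A = mat 1" "has_mderiv (\<lambda>t. mat 1 + mat t ** A) A"
      by (simp_all add: has_mderiv_linear)
    fix F :: "'n rep \<Rightarrow> complex" and \<rho> :: "'n rep"
    assume F: "F \<in> invariant_poly SL" and \<rho>: "\<rho> \<in> Hom SL"
    show "\<forall>\<^sub>F t in nhds 0. F (\<lambda>x. (mat 1 + mat t ** A) ** \<rho> x ** matrix_inv (mat 1 + mat t ** A)) = F \<rho>"
      using has_mderiv_inverse(2)[OF *(2,1)]
    proof eventually_elim
      case (elim t)
      obtain g where "g \<in> SL" "\<forall>X. g ** X ** matrix_inv g =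
          (mat 1 + mat t ** A) ** X ** matrix_inv (mat 1 + mat t ** A)"
        using SL_rescale[OF elim] by blast
      then show ?case using invariant_polyD[OF F \<rho>, of g] by simp
    qed
  qed
  show "\<exists>P :: complex^'n^'n. invertible P \<and>
      (\<forall>A\<in>T. \<exists>d. A = conj_diag P d) \<and>
      (\<forall>i j. i \<noteq> j \<longrightarrow> (\<exists>d. d i \<noteq> d j \<and> conj_diag P d \<in> T)) \<and>
      (\<forall>\<xi> t. conj_diag P \<xi> \<in> sl \<longrightarrow> conj_diag P (\<lambda>i. exp (t * \<xi> i)) \<in> T)"
    if T: "maximal_torus SL T" for T
  proof -
    obtain P where P: "invertible P" "T = SL_torus P" using max_torus_SL[OF T] by blast
    show ?thesis
    proof (intro exI[of _ P] conjI allI impI ballI)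
      show "invertible P" by fact
      show "\<exists>d. A = conj_diag P d" if "A \<in> T" for A
        using that unfolding P(2) SL_torus_def by blast
      show "\<exists>d. d i \<noteq> d j \<and> conj_diag P d \<in> T" if "i \<noteq> j" for i j
      proof (intro exI conjI)
        let ?d = "\<lambda>x. (if x = i then 2 else 1) * (if x = j then 1/2 else 1) :: complex"
        show "?d i \<noteq> ?d j" using that by simp
        have "(\<Prod>x\<in>UNIV. ?d x) = 1" by (simp add: prod.distrib)
        then show "conj_diag P ?d \<in> T" unfolding P(2) SL_torus_def by blast
      qed
      show "conj_diag P (\<lambda>i. exp (t * \<xi> i)) \<in> T"
        if "conj_diag P \<xi> \<in> sl" for \<xi> t
      proof -
        have "(\<Sum>i\<in>UNIV. \<xi> i) = 0"
          using that trace_conj[OF P(1), of "diag \<xi>"] by (simp add: sl_def trace_def diag_nth)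
        then have "(\<Prod>i\<in>UNIV. exp (t * \<xi> i)) = 1"
          by (simp flip: exp_sum sum_distrib_left)
        then show ?thesis unfolding P(2) SL_torus_def by blast
      qed
    qed
  qed
  show "\<exists>g\<in>SL. \<forall>A\<in>T'. g ** A ** matrix_inv g \<in> T"
    if T: "maximal_torus SL T" "maximal_torus SL T'" for T T' :: "(complex^'n^'n) set"
  proof -
    obtain P where P: "invertible P" "T = SL_torus P" using max_torus_SL[OF T(1)] by blast
    obtain P' where P': "invertible P'" "T' = SL_torus P'" using max_torus_SL[OF T(2)] by blast
    let ?B = "P ** matrix_inv P'"
    have B: "invertible ?B" "matrix_inv ?B = P' ** matrix_inv P"
      using P(1) P'(1) by (simp_all add: invertible_mult invertible_matrix_inv matrix_inv_prod)
    obtain g where g: "g \<in> SL" "\<forall>X. g ** X ** matrix_inv g = ?B ** X ** matrix_inv ?B"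
      using SL_rescale[OF B(1)] by blast
    have "?B ** A ** matrix_inv ?B \<in> T" if "A \<in> T'" for A
    proof -
      obtain d where d: "A = conj_diag P' d" "(\<Prod>i\<in>UNIV. d i) = 1"
        using \<open>A \<in> T'\<close> unfolding P'(2) SL_torus_def by blast
      have "?B ** A ** matrix_inv ?B = conj_diag P d"
        unfolding d(1) B(2) by (simp add: matrix_mul_assoc[symmetric] matrix_inv_cancel[OF P'(1)])
      then show ?thesis using d(2) unfolding P(2) SL_torus_def by blast
    qed
    then show ?thesis using g by (intro bexI[of _ g]) auto
  qed
qed

section \<open>Bilinear forms\<close>

text \<open>Bilinear over the complex numbers, without conjugation.\<close>

definition dotp :: "'a::comm_semiring_1^'n \<Rightarrow> 'a^'n \<Rightarrow> 'a" where
  "dotp x y = (\<Sum>i\<in>UNIV. x $ i * y $ i)"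

lemma dotp_commute: "dotp x y = dotp y x"
  by (simp add: dotp_def mult.commute)

lemma dotp_adjoint: "dotp (A *v x) y = dotp x (transpose A *v y)"
proof -
  have "dotp (A *v x) y = (\<Sum>i\<in>UNIV. \<Sum>j\<in>UNIV. A $ i $ j * x $ j * y $ i)"
    by (simp add: dotp_def matrix_vector_mult_def sum_distrib_right)
  also have "\<dots> = (\<Sum>j\<in>UNIV. \<Sum>i\<in>UNIV. A $ i $ j * x $ j * y $ i)"
    by (rule sum.swap)
  also have "\<dots> = dotp x (transpose A *v y)"
    by (simp add: dotp_def matrix_vector_mult_def sum_distrib_left transpose_def mult_ac)
  finally show ?thesis .
qed

definition bil :: "'a::comm_semiring_1^'n^'n \<Rightarrow> 'a^'n \<Rightarrow> 'a^'n \<Rightarrow> 'a" where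
  "bil J x y = dotp x (J *v y)"

lemma bil_add_left: "bil J (x + y) z = bil J x z + bil J y z"
  by (simp add: bil_def dotp_def distrib_right sum.distrib)

lemma bil_scale_left: "bil J (a *s x) z = a * bil J x z"
  by (simp add: bil_def dotp_def sum_distrib_left mult.assoc)

lemma bil_add_right: "bil J x (y + z) = bil J x y + bil J x z"
  by (simp add: bil_def dotp_def matrix_vector_right_distrib distrib_left sum.distrib)

lemma matrix_vector_mult_smult: "J *v (a *s z) = a *s (J *v (z :: 'a::comm_semiring_1^'n))"
  by (simp add: vec_eq_iff matrix_vector_mult_def sum_distrib_left mult_ac)

lemma bil_scale_right: "bil J x (a *s z) = a * bil J x z"
  by (simp add: bil_def dotp_def matrix_vector_mult_smult sum_distrib_left mult_ac)

lemma bil_diff_left: "bil J (x - y) z = bil J x z - bil (J :: 'a::comm_ring_1^'n^'n) y z"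
  using bil_add_left[of J "x - y" y z] by simp

lemma bil_diff_right: "bil J x (y - z) = bil J x y - bil (J :: 'a::comm_ring_1^'n^'n) x z"
  using bil_add_right[of J x "y - z" z] by simp

lemma bil_zero_left: "bil J 0 z = 0"
  by (simp add: bil_def dotp_def)

lemma bil_zero_right: "bil J z 0 = 0"
  by (simp add: bil_def dotp_def)

lemma bil_sum_left: "bil J (\<Sum>i\<in>I. f i) z = (\<Sum>i\<in>I. bil J (f i) z)"
  by (induction I rule: infinite_finite_induct) (simp_all add: bil_zero_left bil_add_left)

lemma bil_sum_right: "bil J z (\<Sum>i\<in>I. f i) = (\<Sum>i\<in>I. bil J z (f i))"
  by (induction I rule: infinite_finite_induct) (simp_all add: bil_zero_right bil_add_right)

lemmas bil_simps = bil_add_left bil_scale_left bil_add_right bil_scale_right bil_diff_left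
  bil_diff_right bil_zero_left bil_zero_right bil_sum_left bil_sum_right

lemma bil_column:
  fixes P :: "'a::comm_ring_1^'n^'n"
  shows "bil J (column i P) (column j P) = (transpose P ** J ** P) $ i $ j"
  unfolding matrix_mul_assoc[symmetric]
  by (simp add: bil_def dotp_def column_def matrix_vector_mult_def matrix_matrix_mult_def
      transpose_def)

lemma bil_isometry:
  assumes "A \<in> Sp J"
  shows "bil J (A *v x) (A *v y) = bil J x y"
  using assms unfolding bil_def dotp_adjoint Sp_def by (simp add: matrix_vector_mul_assoc matrix_mul_assoc)

text \<open>The involution \<open>\<iota>\<close> pairs the vectors of a hyperbolic basis, \<open>R\<close> contains one index from each
  pair, and in odd dimension one vector remains unpaired.\<close>

locale pairing_data =
  fixes \<iota> :: "'n::finite \<Rightarrow> 'n" and R :: "'n set"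
  assumes iota_iota: "\<iota> (\<iota> i) = i"
    and one_fixed: "\<iota> i = i \<Longrightarrow> \<iota> j = j \<Longrightarrow> i = j"
    and R_iota: "\<iota> i \<noteq> i \<Longrightarrow> \<iota> i \<in> R \<longleftrightarrow> i \<notin> R" and R_fixed: "\<iota> i = i \<Longrightarrow> i \<notin> R"

lemma pairing_data_exists: "\<exists>\<iota> R. pairing_data \<iota> (R :: 'n::finite set)"
proof -
  define n where "n = CARD('n)"
  obtain h where h: "bij_betw h (UNIV :: 'n set) {0..<n}"
    using ex_bij_betw_finite_nat[of "UNIV :: 'n set"] by (auto simp: n_def)
  \<comment> \<open>Exchanges 2m and 2m + 1 among 0, ..., n - 1; for odd n the last index stays
    fixed. The even members of the genuine pairs will form \<open>R\<close>.\<close>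
  define j where "j = (\<lambda>x. if even x then (if Suc x < n then Suc x else x) else x - 1)"
  define g where "g = inv_into UNIV h"
  have h_lt: "h i < n" for i using h by (auto simp: bij_betw_def)
  have gh: "g (h i) = i" for i unfolding g_def using h by (simp add: bij_betw_def)
  have hg: "h (g x) = x" if "x < n" for x
    unfolding g_def using bij_betw_inv_into_right[OF h, of x] that by simp
  have jj: "j (j x) = x" "j x < n" if "x < n" for x
    using that by (auto simp: j_def)
  have eq: "g x = g y \<longleftrightarrow> x = y" if "x < n" "y < n" for x y
    using hg[OF that(1)] hg[OF that(2)] by metis
  have fixed: "g (j (h i)) = i \<longleftrightarrow> j (h i) = h i" for i
    using hg[OF jj(2)[OF h_lt[of i]]] gh[of i] by metis
  have "pairing_data (\<lambda>i. g (j (h i))) {i. even (h i) \<and> Suc (h i) < n}"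
  proof
    show "g (j (h (g (j (h i))))) = i" for i
      by (simp add: hg jj h_lt gh)
    show "i = k" if "g (j (h i)) = i" "g (j (h k)) = k" for i k
    proof -
      have *: "j (h i) = h i" "j (h k) = h k" using that fixed by blast+
      have "Suc x = n" if "j x = x" "x < n" for x
        using that by (cases "even x"; cases "Suc x < n") (auto simp: j_def elim: oddE)
      then have "h i = h k" using * h_lt by (metis Suc_inject)
      then show ?thesis using gh by metis
    qed
    fix i
    show "g (j (h i)) \<in> {i. even (h i) \<and> Suc (h i) < n} \<longleftrightarrow> i \<notin> {i. even (h i) \<and> Suc (h i) < n}"
      if "g (j (h i)) \<noteq> i"
    proof -
      have "j (h i) \<noteq> h i" using that fixed by blast
      then show ?thesis using h_lt[of i] hg[OF jj(2)[OF h_lt[of i]]]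
        by (auto simp: j_def split: if_splits elim: oddE)
    qed
    show "i \<notin> {i. even (h i) \<and> Suc (h i) < n}" if "g (j (h i)) = i"
      using that unfolding fixed by (auto simp: j_def)
  qed
  then show ?thesis by blast
qed

text \<open>The value \<epsilon> = 1 stands for a symmetric form, \<epsilon> = -1 for a symplectic
  one.\<close>

locale form_data = pairing_data \<iota> R
  for \<iota> :: "'n::finite \<Rightarrow> 'n" and R +
  fixes J :: "complex^'n^'n" and \<epsilon> :: complex
  assumes J_inv: "invertible J" and J_sym: "transpose J = mat \<epsilon> ** J"
    and eps: "\<epsilon> = 1 \<or> \<epsilon> = -1"
begin

abbreviation B where "B \<equiv> bil J"

text \<open>The nonzero Gram entries of a hyperbolic basis: 1 in one order of a pair, \<epsilon> in
  the other by symmetry of the form, and 1 for the unpaired vector.\<close>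

definition sg :: "'n \<Rightarrow> complex" where
  "sg i = (if i \<in> R \<or> \<iota> i = i then 1 else \<epsilon>)"

lemma eps_sq: "\<epsilon> * \<epsilon> = 1"
  using eps by auto

lemma sg_nz: "sg i \<noteq> 0"
  using eps by (auto simp: sg_def)

lemma B_sym: "B y x = \<epsilon> * B x y"
proof -
  have "B y x = dotp (J *v x) y" unfolding bil_def by (rule dotp_commute)
  also have "\<dots> = dotp x ((mat \<epsilon> ** J) *v y)" by (simp only: dotp_adjoint J_sym)
  also have "\<dots> = \<epsilon> * B x y"
    unfolding mat_mult_vector bil_def by (simp add: dotp_def sum_distrib_left mult_ac)
  finally show ?thesis .
qed

end

section \<open>Hyperbolic bases of common eigenvectors\<close>

locale form_torus = form_data \<iota> R J \<epsilon>
  for \<iota> :: "'n::finite \<Rightarrow> 'n" and R J \<epsilon> +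
  fixes T :: "(complex^'n^'n) set"
  assumes T_Sp: "T \<subseteq> Sp J" and T_sqrt: "A \<in> T \<Longrightarrow> \<exists>B\<in>T. A = B ** B"
    and T_span: "vec.span (common_eigenvectors T) = UNIV"
begin

abbreviation E where "E \<equiv> common_eigenvectors T"

lemma B_isometry: "A \<in> T \<Longrightarrow> B (A *v x) (A *v y) = B x y"
  using T_Sp bil_isometry by blast

text \<open>Testing on eigenvectors suffices because they span.\<close>

lemma B_nondegenerate:
  assumes "\<And>y. y \<in> E \<Longrightarrow> B x y = 0"
  shows "x = 0"
proof -
  have "y \<in> vec.span E \<Longrightarrow> B x y = 0" for y
    by (induction y rule: vec.span_induct_alt) (simp_all add: bil_simps assms)
  then have *: "B x y = 0" for y using T_span by blast
  have "x $ i = 0" for i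
  proof -
    have "J *v (matrix_inv J *v axis i 1) = axis i 1"
      by (simp add: matrix_vector_mul_assoc matrix_inv_mult[OF J_inv])
    then have "dotp x (axis i 1) = 0"
      using *[of "matrix_inv J *v axis i 1"] unfolding bil_def by simp
    then show ?thesis by (simp add: dotp_def axis_def if_distrib cong: if_cong)
  qed
  then show ?thesis by (simp add: vec_eq_iff)
qed

lemma E_scale: "x \<in> E \<Longrightarrow> a *s x \<in> E"
  unfolding common_eigenvectors_def by (auto simp: vec.scale vector_smult_assoc mult.commute)

text \<open>The weight space of the trivial character. Sums of its members are again common
  eigenvectors, which fails in \<open>E\<close>; orthogonalization therefore takes place
  here.\<close>

definition inv_vecs :: "(complex^'n) set" where
  "inv_vecs = {x. \<forall>A\<in>T. A *v x = x}"

lemma inv_vecs_E: "x \<in> inv_vecs \<Longrightarrow> x \<in> E"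
  unfolding inv_vecs_def common_eigenvectors_def by (auto intro: exI[of _ 1])

lemma inv_vecs_add: "x \<in> inv_vecs \<Longrightarrow> y \<in> inv_vecs \<Longrightarrow> x + y \<in> inv_vecs"
  unfolding inv_vecs_def by (simp add: matrix_vector_right_distrib)

lemma inv_vecs_scale: "x \<in> inv_vecs \<Longrightarrow> a *s x \<in> inv_vecs"
  unfolding inv_vecs_def by (simp add: vec.scale)

lemma inv_vecs_diff: "x \<in> inv_vecs \<Longrightarrow> y \<in> inv_vecs \<Longrightarrow> x - y \<in> inv_vecs"
  unfolding inv_vecs_def by (simp add: vec.diff)

text \<open>Isometries let two weight vectors pair nontrivially only if their weights are inverse to
  each other.\<close>

lemma eigen_mult:
  assumes "A \<in> T" "A *v x = a *s x" "A *v y = b *s y" "B x y \<noteq> 0"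
  shows "a * b = 1"
  using B_isometry[OF assms(1), of x y] assms(2-4) by (simp add: bil_simps) (simp add: mult.commute)

text \<open>Every element of \<open>T\<close> is a square, so a character of \<open>T\<close> with values \<open>\<plusminus>1\<close> is trivial.\<close>

lemma anisotropic_inv:
  assumes x: "x \<in> E" "B x x \<noteq> 0"
  shows "x \<in> inv_vecs"
  unfolding inv_vecs_def
proof (intro CollectI ballI)
  fix A assume "A \<in> T"
  then obtain C where C: "C \<in> T" "A = C ** C" using T_sqrt by blast
  obtain c where c: "C *v x = c *s x" using x(1) C(1) unfolding common_eigenvectors_def by blast
  have "c * c = 1" by (rule eigen_mult[OF C(1) c c x(2)])
  then show "A *v x = x"
    by (simp add: C(2) c vec.scale vector_smult_assoc flip: matrix_vector_mul_assoc)
qed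

text \<open>A hyperbolic family of eigenvectors whose index set is a union of pairs, possibly with
  the fixed index, so that it can be enlarged one pair at a time.\<close>

definition partial_frame :: "'n set \<Rightarrow> ('n \<Rightarrow> complex^'n) \<Rightarrow> bool" where
  "partial_frame S e \<longleftrightarrow> (\<forall>i\<in>S. \<iota> i \<in> S) \<and> (\<forall>i\<in>S. e i \<in> E) \<and>
     (\<forall>i\<in>S. \<forall>j\<in>S. B (e i) (e j) = (if j = \<iota> i then sg i else 0))"

context
  fixes S e
  assumes pf: "partial_frame S e"
begin

lemma S_iota: "i \<in> S \<Longrightarrow> \<iota> i \<in> S" and e_E: "i \<in> S \<Longrightarrow> e i \<in> E"
  and e_gram: "i \<in> S \<Longrightarrow> j \<in> S \<Longrightarrow> B (e i) (e j) = (if j = \<iota> i then sg i else 0)"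
  using pf unfolding partial_frame_def by blast+

lemma iota_S: "\<iota> i \<in> S \<longleftrightarrow> i \<in> S"
  using S_iota iota_iota by metis

definition W :: "(complex^'n) set" where
  "W = {x. \<forall>j\<in>S. B x (e j) = 0}"

lemma W_left: "x \<in> W \<Longrightarrow> j \<in> S \<Longrightarrow> B (e j) x = 0"
  unfolding W_def by (simp add: B_sym[of "e j"])

lemma W_right: "x \<in> W \<Longrightarrow> j \<in> S \<Longrightarrow> B x (e j) = 0"
  unfolding W_def by simp

lemma W_add: "x \<in> W \<Longrightarrow> y \<in> W \<Longrightarrow> x + y \<in> W"
  and W_diff: "x \<in> W \<Longrightarrow> y \<in> W \<Longrightarrow> x - y \<in> W" and W_scale: "x \<in> W \<Longrightarrow> a *s x \<in> W"
  unfolding W_def by (simp_all add: bil_simps)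

text \<open>The orthogonal projection onto the complement \<open>W\<close> of the frame. The
  coefficient of \<open>e i\<close> is read off at the partner index, because
  \<open>e (\<iota> i)\<close> is dual to \<open>e i\<close> up to the factor
  \<open>sg i\<close>.\<close>

definition pr :: "complex^'n \<Rightarrow> complex^'n" where
  "pr x = x - (\<Sum>i\<in>S. (B x (e (\<iota> i)) / sg i) *s e i)"

lemma pr_W: "pr x \<in> W"
  unfolding W_def
proof (intro CollectI ballI)
  fix j assume j: "j \<in> S"
  have "(\<Sum>i\<in>S. B x (e (\<iota> i)) / sg i * B (e i) (e j)) =
      (\<Sum>i\<in>S. if i = \<iota> j then B x (e j) else 0)"
  proof (rule sum.cong[OF refl])
    fix i assume i: "i \<in> S"
    have "j = \<iota> i \<longleftrightarrow> i = \<iota> j" using iota_iota by metis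
    then show "B x (e (\<iota> i)) / sg i * B (e i) (e j) = (if i = \<iota> j then B x (e j) else 0)"
      using e_gram[OF i j] sg_nz[of i] iota_iota[of j] by auto
  qed
  also have "\<dots> = B x (e j)" using j S_iota by simp
  finally show "B (pr x) (e j) = 0" unfolding pr_def by (simp add: bil_simps)
qed

lemma pr_span: "x - pr x \<in> vec.span (e ` S)"
proof -
  have "x - pr x = (\<Sum>i\<in>S. (B x (e (\<iota> i)) / sg i) *s e i)" by (simp add: pr_def)
  also have "\<dots> \<in> vec.span (e ` S)"
    by (intro vec.span_sum vec.span_scale vec.span_base imageI)
  finally show ?thesis .
qed

lemma B_pr: "x \<in> W \<Longrightarrow> B x (pr y) = B x y"
  unfolding pr_def by (simp add: bil_simps W_right)

text \<open>Whenever \<open>e i\<close> occurs in the correction, both \<open>x\<close> and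
  \<open>e i\<close> pair with \<open>e (\<iota> i)\<close>, so they have the same weight and the
  difference stays in one weight space.\<close>

lemma pr_E:
  assumes x: "x \<in> E"
  shows "pr x \<in> E"
  unfolding common_eigenvectors_def
proof (intro CollectI ballI)
  fix A assume A: "A \<in> T"
  obtain a where a: "A *v x = a *s x" using x A unfolding common_eigenvectors_def by blast
  have "A *v ((B x (e (\<iota> i)) / sg i) *s e i) = a *s ((B x (e (\<iota> i)) / sg i) *s e i)" if i: "i \<in> S" for i
  proof (cases "B x (e (\<iota> i)) = 0")
    case True then show ?thesis by (simp add: vec.scale)
  next
    case False
    obtain b where b: "A *v e i = b *s e i" using e_E[OF i] A unfolding common_eigenvectors_def by blast
    obtain c where c: "A *v e (\<iota> i) = c *s e (\<iota> i)"
      using e_E[OF S_iota[OF i]] A unfolding common_eigenvectors_def by blast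
    have "a * c = 1" by (rule eigen_mult[OF A a c False])
    moreover have "b * c = 1"
      by (rule eigen_mult[OF A b c]) (simp add: e_gram[OF i S_iota[OF i]] sg_nz)
    ultimately have "a = b" by (metis mult.commute mult.left_commute mult.right_neutral)
    then show ?thesis by (simp add: vec.scale b vector_smult_assoc mult.commute)
  qed
  then have "A *v pr x = a *s pr x"
    unfolding pr_def by (simp add: vec.diff vec.sum a vector_ssub_ldistrib vec.scale_sum_right)
  then show "\<exists>a. A *v pr x = a *s pr x" by blast
qed

lemma exists_partner:
  assumes "v \<in> W" "v \<noteq> 0"
  obtains f where "f \<in> W" "f \<in> E" "B v f \<noteq> 0"
proof -
  obtain x where "x \<in> E" "B v x \<noteq> 0" using B_nondegenerate assms(2) by blast
  then show ?thesis using that[of "pr x"] pr_W pr_E B_pr[OF assms(1)] by simp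
qed

text \<open>A dimension count: if all projected eigenvectors lay in the span of \<open>X\<close>,
  then the frame together with \<open>X\<close> would span the whole space.\<close>

lemma exists_outside:
  assumes "finite X" "card S + card X < CARD('n)"
  obtains x where "x \<in> W" "x \<in> E" "x \<notin> vec.span X"
proof -
  have "\<exists>x\<in>E. pr x \<notin> vec.span X"
  proof (rule ccontr)
    assume "\<not> ?thesis"
    then have *: "pr x \<in> vec.span X" if "x \<in> E" for x using that by blast
    have "x \<in> vec.span (e ` S \<union> X)" if "x \<in> E" for x
    proof -
      have "x - pr x \<in> vec.span (e ` S \<union> X)" "pr x \<in> vec.span (e ` S \<union> X)"
        using pr_span[of x] *[OF that] vec.span_mono[of "e ` S" "e ` S \<union> X"]
          vec.span_mono[of X "e ` S \<union> X"] by blast+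
      from vec.span_add[OF this] show ?thesis by simp
    qed
    then have "E \<subseteq> vec.span (e ` S \<union> X)" by blast
    then have "vec.span E \<subseteq> vec.span (e ` S \<union> X)"
      by (metis vec.span_mono vec.span_span)
    then have "vec.dim (UNIV :: (complex^'n) set) \<le> card (e ` S \<union> X)"
      using T_span assms(1) by (intro vec.dim_le_card) auto
    also have "\<dots> \<le> card S + card X"
      using card_Un_le[of "e ` S" X] card_image_le[of S e] by simp
    finally show False using assms(2) by (simp add: vec_dim_card card_cart_basis)
  qed
  then show ?thesis using that pr_W pr_E by blast
qed

text \<open>A vector of \<open>W\<close> pairs with \<open>y\<close> as it does with
  \<open>pr y\<close>, and the latter is orthogonal to the span of the frame.\<close>

lemma span_W_disjoint:
  assumes "v \<in> W" "v \<in> vec.span (e ` S)"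
  shows "v = 0"
proof (rule B_nondegenerate)
  fix y
  have "x \<in> vec.span (e ` S) \<Longrightarrow> B x (pr y) = 0" for x
    by (induction x rule: vec.span_induct_alt) (auto simp: bil_simps W_left[OF pr_W])
  from this[OF assms(2)] show "B v y = 0" using B_pr[OF assms(1)] by simp
qed

lemma frame_independent: "vec.independent (e ` S)" and frame_inj: "inj_on e S"
proof -
  show "inj_on e S"
  proof (rule inj_onI)
    fix i j assume ij: "i \<in> S" "j \<in> S" "e i = e j"
    then have "B (e j) (e (\<iota> i)) = sg i" using e_gram[OF ij(1) S_iota[OF ij(1)]] by simp
    then have "\<iota> i = \<iota> j" using e_gram[OF ij(2) S_iota[OF ij(1)]] sg_nz[of i] by (metis (full_types))
    then show "i = j" using iota_iota by metis
  qed
  show "vec.independent (e ` S)"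
    unfolding vec.dependent_def
  proof clarify
    fix j assume j: "j \<in> S" "e j \<in> vec.span (e ` S - {e j})"
    have "x \<in> vec.span (e ` S - {e j}) \<Longrightarrow> B x (e (\<iota> j)) = 0" for x
    proof (induction x rule: vec.span_induct_alt)
      case (step c x y)
      then obtain i where i: "i \<in> S" "x = e i" "i \<noteq> j" by blast
      then have "\<iota> j \<noteq> \<iota> i" using iota_iota by metis
      then show ?case using step i e_gram[OF i(1) S_iota[OF j(1)]] by (simp add: bil_simps)
    qed (simp add: bil_simps)
    from this[OF j(2)] show False
      using e_gram[OF j(1) S_iota[OF j(1)]] sg_nz[of j] by simp
  qed
qed

text \<open>A partner \<open>f\<close> of the isotropic \<open>v\<close> is made isotropic by
  subtracting a multiple of \<open>v\<close>. The result is still an eigenvector: if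
  \<open>f\<close> is already isotropic nothing is subtracted, and otherwise \<open>f\<close> has
  trivial weight, which forces the same on \<open>v\<close>.\<close>

lemma extend_pair:
  assumes v: "v \<in> W" "v \<in> E" "v \<noteq> 0" "B v v = 0" and i: "i \<notin> S" "i \<in> R"
  shows "\<exists>S' e'. partial_frame S' e' \<and> S \<subset> S'"
proof -
  obtain f where f: "f \<in> W" "f \<in> E" "B v f \<noteq> 0" using exists_partner[OF v(1,3)] .
  \<comment> \<open>Cancels the square of \<open>f\<close> when \<epsilon> = 1; when \<epsilon> = -1
    the form is alternating and \<open>a\<close> is 0.\<close>
  define a where "a = B f f / (2 * B v f)"
  define w where "w = inverse (B v f) *s (f - a *s v)"
  have "f - a *s v \<in> E"
  proof (cases "B f f = 0")
    case True then show ?thesis using f(2) by (simp add: a_def)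
  next
    case False
    have fi: "f \<in> inv_vecs" by (rule anisotropic_inv[OF f(2) False])
    have "v \<in> inv_vecs"
      unfolding inv_vecs_def
    proof (intro CollectI ballI)
      fix A assume A: "A \<in> T"
      obtain b where b: "A *v v = b *s v" using v(2) A unfolding common_eigenvectors_def by blast
      have "A *v f = 1 *s f" using fi A unfolding inv_vecs_def by simp
      from eigen_mult[OF A b this f(3)] b show "A *v v = v" by simp
    qed
    then show ?thesis using fi by (intro inv_vecs_E inv_vecs_diff inv_vecs_scale)
  qed
  then have wE: "w \<in> E" unfolding w_def by (rule E_scale)
  have wW: "w \<in> W" unfolding w_def using f(1) v(1) by (intro W_scale W_diff)
  have vw: "B v w = 1" using f(3) v(4) by (simp add: w_def bil_simps)
  have fv: "B f v = \<epsilon> * B v f" by (rule B_sym)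
  have ff: "B f f = \<epsilon> * B f f" by (rule B_sym)
  have "B (f - a *s v) (f - a *s v) = B f f - a * (1 + \<epsilon>) * B v f"
    by (simp add: bil_simps v(4) fv algebra_simps)
  also have "\<dots> = 0"
    using eps f(3) ff by (auto simp: a_def field_simps)
  finally have "B (f - a *s v) (f - a *s v) = 0" .
  then have ww: "B w w = 0" by (simp only: w_def bil_scale_left bil_scale_right) simp
  have wv: "B w v = \<epsilon>" using B_sym[of w v] vw by simp
  have ii: "\<iota> i \<noteq> i" using R_fixed i(2) by blast
  have oi: "sg i = 1" "sg (\<iota> i) = \<epsilon>"
    using i(2) ii R_iota[OF ii] iota_iota[of i] by (auto simp: sg_def)
  have iS: "\<iota> i \<notin> S" using i(1) iota_S by blast
  define e' where "e' = e(i := v, \<iota> i := w)"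
  have e': "e' i = v" "e' (\<iota> i) = w" "\<And>j. j \<in> S \<Longrightarrow> e' j = e j"
    using ii i(1) iS by (auto simp: e'_def)
  have *: "\<iota> j \<noteq> i" "\<iota> j \<noteq> \<iota> i" "j \<noteq> \<iota> i" "j \<noteq> i" if "j \<in> S" for j
    using that i(1) iS iota_S iota_iota by metis+
  have "partial_frame (insert i (insert (\<iota> i) S)) e'"
    unfolding partial_frame_def
  proof (intro conjI ballI)
    show "\<iota> j \<in> insert i (insert (\<iota> i) S)" if "j \<in> insert i (insert (\<iota> i) S)" for j
      using that S_iota iota_iota by auto
    show "e' j \<in> E" if "j \<in> insert i (insert (\<iota> i) S)" for j
      using that e' v(2) wE e_E by auto
    show "B (e' j) (e' k) = (if k = \<iota> j then sg j else 0)"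
      if "j \<in> insert i (insert (\<iota> i) S)" "k \<in> insert i (insert (\<iota> i) S)" for j k
      using that
      by (elim insertE) (simp_all add: e' e_gram W_left[OF v(1)] W_left[OF wW] W_right[OF v(1)]
          W_right[OF wW] * *[symmetric] ii ii[symmetric] oi iota_iota v(4) vw wv ww)
  qed
  then show ?thesis using i(1) by blast
qed

text \<open>If every eigenvector of \<open>W\<close> were anisotropic, all of them would have
  trivial weight. Two independent ones, made orthogonal, then have an isotropic combination that is
  again an eigenvector.\<close>

lemma isotropic_exists:
  assumes "card S + 2 \<le> CARD('n)"
  obtains v where "v \<in> W" "v \<in> E" "v \<noteq> 0" "B v v = 0"
proof (rule ccontr)
  note found = that
  assume "\<not> thesis"
  then have an: "x \<in> W \<Longrightarrow> x \<in> E \<Longrightarrow> x \<noteq> 0 \<Longrightarrow> B x x \<noteq> 0" for x using found[of x] by blast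
  obtain v where v: "v \<in> W" "v \<in> E" "v \<notin> vec.span {}" using exists_outside[of "{}"] assms by auto
  then have vv: "B v v \<noteq> 0" using an by auto
  have vi: "v \<in> inv_vecs" by (rule anisotropic_inv[OF v(2) vv])
  obtain f where f: "f \<in> W" "f \<in> E" "f \<notin> vec.span {v}" using exists_outside[of "{v}"] assms by auto
  then have "f \<noteq> 0" using vec.span_zero by blast
  then have fi: "f \<in> inv_vecs" using anisotropic_inv[OF f(2)] an f by blast
  define w where "w = f - (B f v / B v v) *s v"
  have "w \<noteq> 0"
  proof
    assume "w = 0"
    then have "f = (B f v / B v v) *s v" by (simp add: w_def)
    then have "f \<in> vec.span {v}" by (metis vec.span_base vec.span_scale singletonI)
    then show False using f(3) by blast
  qed
  have w: "w \<in> W" "w \<in> inv_vecs"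
    unfolding w_def using f(1) v(1) fi vi by (auto intro: W_diff W_scale inv_vecs_diff inv_vecs_scale)
  have wv: "B w v = 0" using vv by (simp add: w_def bil_simps)
  have vw: "B v w = 0" using B_sym[of v w] wv by simp
  have ww: "B w w \<noteq> 0" using an[OF w(1) inv_vecs_E[OF w(2)] \<open>w \<noteq> 0\<close>] .
  \<comment> \<open>For orthogonal \<open>v\<close> and \<open>w\<close> the two squares cancel,
    since \<i> squared is -1.\<close>
  define x where "x = csqrt (B w w) *s v + (\<i> * csqrt (B v v)) *s w"
  have "x \<in> W" "x \<in> inv_vecs"
    unfolding x_def using v(1) vi w by (auto intro: W_add W_scale inv_vecs_add inv_vecs_scale)
  moreover have "B x x = 0"
  proof -
    have "B x x = (csqrt (B w w))\<^sup>2 * B v v - (csqrt (B v v))\<^sup>2 * B w w"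
      unfolding x_def by (simp add: bil_simps vw wv power2_eq_square algebra_simps)
    then show ?thesis by simp
  qed
  moreover have "x \<noteq> 0"
  proof
    assume "x = 0"
    then have "B x v = 0" by (simp add: bil_simps)
    then show False using ww vv by (simp add: x_def bil_simps wv)
  qed
  ultimately show False using an inv_vecs_E by blast
qed

text \<open>The complement of the frame is a line. A spanning vector of square zero would be
  orthogonal to the frame and to itself, hence to everything; so it can be normalized to square
  1.\<close>

lemma extend_fixed:
  assumes i: "i \<notin> S" "\<iota> i = i" and S: "\<And>j. j \<notin> S \<Longrightarrow> j = i"
  shows "\<exists>S' e'. partial_frame S' e' \<and> S \<subset> S'"
proof -
  have UNIV: "insert i S = UNIV" using S by blast
  then have card: "Suc (card S) = CARD('n)" using i(1) by (metis card_insert_disjoint finite)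
  obtain v where v: "v \<in> W" "v \<in> E" "v \<notin> vec.span {}"
    using exists_outside[of "{}"] card by auto
  have vv: "B v v \<noteq> 0"
  proof
    assume vv: "B v v = 0"
    have nsp: "v \<notin> vec.span (e ` S)" using span_W_disjoint[OF v(1)] v(3) by auto
    then have ind: "vec.independent (insert v (e ` S))"
      using frame_independent by (simp add: vec.independent_insertI)
    have "v \<notin> e ` S" using nsp vec.span_base by blast
    then have "card (insert v (e ` S)) = CARD('n)"
      using card card_image[OF frame_inj] by simp
    then have "UNIV \<subseteq> vec.span (insert v (e ` S))"
      by (intro vec.card_ge_dim_independent[OF _ ind]) (simp_all add: vec_dim_card card_cart_basis)
    moreover have "x \<in> vec.span (insert v (e ` S)) \<Longrightarrow> B v x = 0" for x
      by (induction x rule: vec.span_induct_alt) (auto simp: bil_simps vv W_right[OF v(1)])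
    ultimately have "v = 0" by (intro B_nondegenerate) blast
    then show False using v(3) by simp
  qed
  have "\<epsilon> = 1" using eps vv B_sym[of v v] by auto
  define w where "w = inverse (csqrt (B v v)) *s v"
  have ww: "B w w = 1"
  proof -
    have "csqrt (B v v) * csqrt (B v v) = B v v" by (metis power2_csqrt power2_eq_square)
    moreover have "B w w = inverse (csqrt (B v v) * csqrt (B v v)) * B v v"
      by (simp add: w_def bil_simps)
    ultimately show ?thesis using vv by simp
  qed
  have w: "w \<in> W" "w \<in> E" unfolding w_def using v by (auto intro: W_scale E_scale)
  have "partial_frame (insert i S) (e(i := w))"
    unfolding partial_frame_def
  proof (intro conjI ballI)
    show "\<iota> j \<in> insert i S" for j by (simp add: UNIV)
    show "(e(i := w)) j \<in> E" if "j \<in> insert i S" for j using that w e_E by auto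
    have *: "\<iota> j \<noteq> i" "j \<noteq> i" if "j \<in> S" for j using that i iota_S by metis+
    show "B ((e(i := w)) j) ((e(i := w)) k) = (if k = \<iota> j then sg j else 0)"
      if "j \<in> insert i S" "k \<in> insert i S" for j k
      using that * i ww by (auto simp: e_gram W_left[OF w(1)] W_right[OF w(1)] sg_def)
  qed
  then show ?thesis using i(1) by blast
qed

end

lemma extend_frame:
  assumes pf: "partial_frame S e" and "S \<noteq> UNIV"
  shows "\<exists>S' e'. partial_frame S' e' \<and> S \<subset> S'"
proof (cases "\<exists>i. i \<notin> S \<and> \<iota> i \<noteq> i")
  case True
  then obtain i0 where i0: "i0 \<notin> S" "\<iota> i0 \<noteq> i0" by blast
  then have "\<iota> i0 \<notin> S" using iota_S[OF pf] by blast
  \<comment> \<open>Exactly one member of the missing pair lies in \<open>R\<close>, and it receives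
    the first vector.\<close>
  then obtain i where i: "i \<notin> S" "\<iota> i \<notin> S" "\<iota> i \<noteq> i" "i \<in> R"
    using i0 R_iota[OF i0(2)] iota_iota by metis
  have "card S + 2 = card (insert i (insert (\<iota> i) S))" using i by simp
  also have "\<dots> \<le> CARD('n)" by (rule card_mono) auto
  finally show ?thesis using isotropic_exists[OF pf] extend_pair[OF pf] i(1,4) by metis
next
  case False
  then obtain i where i: "i \<notin> S" "\<iota> i = i" using \<open>S \<noteq> UNIV\<close> by blast
  show ?thesis by (rule extend_fixed[OF pf i]) (use False one_fixed i(2) in blast)
qed

lemma frame_exists: "\<exists>e. partial_frame UNIV e"
proof -
  have "\<exists>e. partial_frame UNIV e" if "partial_frame S e" for S e
    using that
  proof (induction "card (- S)" arbitrary: S e rule: less_induct)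
    case less
    show ?case
    proof (cases "S = UNIV")
      case False
      then obtain S' e' where *: "partial_frame S' e'" "S \<subset> S'" using extend_frame[OF less.prems] by blast
      then have "card (- S') < card (- S)" by (intro psubset_card_mono) auto
      then show ?thesis using less.hyps *(1) by blast
    qed (use less in blast)
  qed
  moreover have "partial_frame {} e" for e by (simp add: partial_frame_def)
  ultimately show ?thesis by blast
qed

end

section \<open>The groups preserving a form\<close>

lemma mult_mat_left:
  fixes A B :: "'a::comm_semiring_1^'n^'n"
  shows "A ** (mat a ** B) = mat a ** (A ** B)"
  unfolding matrix_mul_assoc mat_mult_commute[of A] ..

lemma mat_mat_mult: "mat a ** (mat b ** A) = mat (a * b) ** (A :: 'a::comm_semiring_1^'n^'n)"
  by (simp add: vec_eq_iff mult.assoc)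

lemma transpose_mat: "transpose (mat a) = mat a"
  by (simp add: transpose_def mat_def vec_eq_iff)

lemma transpose_add: "transpose (A + B) = transpose A + transpose (B :: 'a::ab_group_add^'n^'n)"
  by (simp add: transpose_def vec_eq_iff)

lemma transpose_diff: "transpose (A - B) = transpose A - transpose (B :: 'a::ab_group_add^'n^'n)"
  by (simp add: transpose_def vec_eq_iff)

lemma transpose_diag: "transpose (diag d) = diag d"
  by (simp add: transpose_def diag_def vec_eq_iff)

lemma trace_transpose: "trace (transpose A) = trace A"
  by (simp add: trace_def transpose_def)

context form_data
begin

text \<open>The adjoint for the form: \<open>B (X *v x) y = B x (adj X *v y)\<close>. Thus
  \<open>Sp J\<close> is described by \<open>adj A\<close> being the inverse of \<open>A\<close>,
  and \<open>sp J\<close> by \<open>adj A = - A\<close>.\<close>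

definition adj :: "complex^'n^'n \<Rightarrow> complex^'n^'n" where
  "adj X = matrix_inv J ** transpose X ** J"

lemma transpose_inv_J: "transpose (matrix_inv J) = mat \<epsilon> ** matrix_inv J"
proof -
  have "mat 1 = transpose (J ** matrix_inv J)"
    by (simp add: matrix_inv_mult[OF J_inv] transpose_mat)
  also have "\<dots> = mat \<epsilon> ** (transpose (matrix_inv J) ** J)"
    by (simp add: matrix_transpose_mul J_sym mult_mat_left)
  finally have "transpose (matrix_inv J) ** J = mat \<epsilon>"
    using eps_sq mat_mat_mult[of \<epsilon> \<epsilon> "transpose (matrix_inv J) ** J"]
    by (metis matrix_mul_lid matrix_mul_rid)
  then have "transpose (matrix_inv J) ** J ** matrix_inv J = mat \<epsilon> ** matrix_inv J" by simp
  then show ?thesis by (simp add: matrix_mul_assoc[symmetric] matrix_inv_mult[OF J_inv])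
qed

lemma adj_mult: "adj (X ** Y) = adj Y ** adj X"
  by (simp add: adj_def matrix_transpose_mul matrix_mul_assoc[symmetric] matrix_inv_cancel[OF J_inv])

text \<open>Transposing \<open>J\<close> and its inverse yields two factors \<epsilon>, which
  cancel.\<close>

lemma adj_adj: "adj (adj X) = X"
proof -
  have "adj (adj X) = matrix_inv J ** ((mat \<epsilon> ** J) ** (X ** (mat \<epsilon> ** matrix_inv J))) ** J"
    by (simp add: adj_def matrix_transpose_mul transpose_inv_J J_sym)
  also have "(mat \<epsilon> ** J) ** (X ** (mat \<epsilon> ** matrix_inv J)) = J ** (X ** matrix_inv J)"
    by (simp only: mult_mat_left[of X] mult_mat_left[of J] matrix_mul_assoc[symmetric] mat_mat_mult
        eps_sq matrix_mul_lid)
  also have "matrix_inv J ** (J ** (X ** matrix_inv J)) ** J = X"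
    by (simp add: matrix_mul_assoc[symmetric] matrix_inv_cancel[OF J_inv] matrix_inv_mult[OF J_inv])
  finally show ?thesis .
qed

lemma adj_one: "adj (mat 1) = mat 1"
  by (simp add: adj_def transpose_mat matrix_inv_mult[OF J_inv])

lemma adj_add: "adj (X + Y) = adj X + adj Y"
  by (simp add: adj_def transpose_add matrix_add_ldistrib matrix_mult_add_rdistrib)

lemma adj_diff: "adj (X - Y) = adj X - adj Y"
  by (simp add: adj_def transpose_diff matrix_mult_diff matrix_diff_mult)

lemma adj_scale: "adj (mat a ** X) = mat a ** adj X"
  by (simp add: adj_def matrix_transpose_mul transpose_mat mat_mult_commute[of "transpose X"]
      mult_mat_left[of "matrix_inv J"] matrix_mul_assoc[symmetric])

lemma det_adj: "det (adj X) = det X"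
proof -
  have "det (matrix_inv J) * det J = 1"
    using matrix_inv_mult(2)[OF J_inv] by (metis det_I det_mul)
  then show ?thesis by (simp add: adj_def det_mul mult.commute[of "det (matrix_inv J)"] mult.assoc)
qed

lemma trace_adj: "trace (adj X) = trace X"
  using trace_conj[OF invertible_matrix_inv(1)[OF J_inv], of "transpose X"]
  by (simp add: adj_def invertible_matrix_inv(2)[OF J_inv] trace_transpose)

lemma Sp_iff: "A \<in> Sp J \<longleftrightarrow> adj A ** A = mat 1"
proof -
  have "adj A ** A = matrix_inv J ** (transpose A ** J ** A)"
    by (simp add: adj_def matrix_mul_assoc)
  then show ?thesis unfolding Sp_def
    by (metis (mono_tags, lifting) J_inv matrix_inv_cancel(1) matrix_inv_mult(2) matrix_mul_rid mem_Collect_eq)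
qed

lemma sp_iff: "A \<in> sp J \<longleftrightarrow> adj A = - A"
proof -
  have 1: "J ** (adj A + A) = transpose A ** J + J ** A"
    by (simp add: adj_def matrix_add_ldistrib matrix_mul_assoc[symmetric] matrix_inv_cancel[OF J_inv])
  have 2: "J ** X = 0 \<longleftrightarrow> X = 0" for X :: "complex^'n^'n"
    using matrix_inv_cancel(2)[OF J_inv, of X] by auto
  have "A \<in> sp J \<longleftrightarrow> adj A + A = 0"
    unfolding sp_def using 2[of "adj A + A"] unfolding 1 by simp
  then show ?thesis by (simp add: eq_neg_iff_add_eq_0)
qed

lemma Sp_invertible: "A \<in> Sp J \<Longrightarrow> invertible A"
  using Sp_iff invertible_left_inverse by blast

lemma Sp_inv: "A \<in> Sp J \<Longrightarrow> matrix_inv A = adj A"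
  using Sp_iff matrix_left_right_inverse matrix_inv_unique(2) by blast

lemma adj_inv: "A \<in> Sp J \<Longrightarrow> adj (matrix_inv A) = A"
  by (simp add: Sp_inv adj_adj)

section \<open>The standard torus of a hyperbolic basis\<close>

text \<open>The Gram matrix of a hyperbolic basis, a signed permutation matrix.\<close>

definition K :: "complex^'n^'n" where
  "K = (\<chi> i j. if j = \<iota> i then sg i else 0)"

lemma sg_sq: "sg i * sg i = 1"
  using eps_sq by (simp add: sg_def)

lemma K_orth: "transpose K ** K = mat 1"
proof -
  have "(transpose K ** K) $ i $ j = mat 1 $ i $ j" for i j
  proof -
    have "(transpose K ** K) $ i $ j = (\<Sum>k\<in>UNIV. (if i = \<iota> k then sg k else 0) * (if j = \<iota> k then sg k else 0))"
      by (simp add: matrix_matrix_mult_def transpose_def K_def)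
    also have "\<dots> = (\<Sum>k\<in>UNIV. if k = \<iota> i then (if i = j then 1 else 0) else 0)"
    proof (rule sum.cong[OF refl])
      fix k
      have "i = \<iota> k \<longleftrightarrow> k = \<iota> i" using iota_iota by metis
      then show "(if i = \<iota> k then sg k else 0) * (if j = \<iota> k then sg k else 0) =
          (if k = \<iota> i then (if i = j then 1 else 0) else 0)"
        using sg_sq[of k] iota_iota[of i] by auto
    qed
    finally show ?thesis by (simp add: mat_def)
  qed
  then show ?thesis by (simp add: vec_eq_iff)
qed

definition gram :: "complex^'n^'n \<Rightarrow> bool" where
  "gram P \<longleftrightarrow> transpose P ** J ** P = K"

lemma gram_invertible: "gram P \<Longrightarrow> invertible P"
proof -
  assume "gram P"
  then have "(transpose K ** transpose P ** J) ** P = mat 1"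
    using K_orth by (simp add: gram_def matrix_mul_assoc[symmetric])
  then show ?thesis using invertible_left_inverse by blast
qed

text \<open>Eigenvalues on paired vectors are inverse to each other. The clause at a fixed index
  picks 1 from the two signs left open by the first clause.\<close>

definition weights :: "('n \<Rightarrow> complex) set" where
  "weights = {d. (\<forall>i. d i * d (\<iota> i) = 1) \<and> (\<forall>i. \<iota> i = i \<longrightarrow> d i = 1)}"

definition form_T :: "complex^'n^'n \<Rightarrow> (complex^'n^'n) set" where
  "form_T P = (\<lambda>d. conj_diag P d) ` weights"

lemma diag_K_diag:
  assumes "\<And>i. d i * d (\<iota> i) = 1"
  shows "diag d ** K ** diag d = K"
  using assms by (simp add: vec_eq_iff K_def mult_ac)

lemma gram_conj:
  assumes "gram P" "gram P'"
  shows "P ** matrix_inv P' \<in> Sp J"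
proof -
  have i': "invertible P'" using gram_invertible[OF assms(2)] .
  have "transpose (matrix_inv P') ** transpose P' = mat 1"
    using matrix_inv_mult(1)[OF i'] by (metis matrix_transpose_mul transpose_mat)
  have "transpose (P ** matrix_inv P') ** J ** (P ** matrix_inv P') =
      transpose (matrix_inv P') ** (transpose P ** J ** P) ** matrix_inv P'"
    by (simp add: matrix_transpose_mul matrix_mul_assoc)
  also have "\<dots> = transpose (matrix_inv P') ** (transpose P' ** J ** P') ** matrix_inv P'"
    using assms by (simp add: gram_def)
  also have "\<dots> = (transpose (matrix_inv P') ** transpose P') ** J ** (P' ** matrix_inv P')"
    by (simp only: matrix_mul_assoc)
  also have "\<dots> = J"
    by (simp add: \<open>transpose (matrix_inv P') ** transpose P' = mat 1\<close> matrix_inv_mult[OF i'])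
  finally show ?thesis unfolding Sp_def by simp
qed

lemma gram_diag:
  assumes P: "gram P" and d: "\<And>i. d i * d (\<iota> i) = 1"
  shows "gram (P ** diag d)"
proof -
  have "transpose (P ** diag d) ** J ** (P ** diag d) = diag d ** (transpose P ** J ** P) ** diag d"
    by (simp add: matrix_transpose_mul transpose_diag matrix_mul_assoc)
  then show ?thesis using P diag_K_diag[of d, OF d] by (simp add: gram_def)
qed

text \<open>Rescaling a hyperbolic basis by weights preserves its Gram matrix, and a change between
  bases with equal Gram matrices is an isometry.\<close>

lemma form_T_Sp:
  assumes P: "gram P"
  shows "form_T P \<subseteq> Sp J"
  using gram_conj[OF gram_diag[OF P] P] unfolding form_T_def weights_def by blast

text \<open>Roots are chosen on \<open>R\<close> and inverted on the partners. Independent choices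
  on both members of a pair could multiply to -1.\<close>

lemma weights_sqrt:
  assumes d: "d \<in> weights"
  obtains e where "e \<in> weights" "\<And>i. d i = e i * e i"
proof -
  define e where "e = (\<lambda>i. if i \<in> R then csqrt (d i) else if \<iota> i \<in> R then inverse (csqrt (d (\<iota> i))) else 1)"
  have d1: "d i * d (\<iota> i) = 1" and df: "\<iota> i = i \<Longrightarrow> d i = 1" for i
    using d unfolding weights_def by blast+
  have nz: "d i \<noteq> 0" for i using d1[of i] by auto
  have sq: "csqrt z * csqrt z = z" for z by (metis power2_csqrt power2_eq_square)
  have fx: "\<iota> i = i" if "i \<notin> R" "\<iota> i \<notin> R" for i using R_iota that by blast
  have RR: "\<iota> i \<notin> R" if "i \<in> R" for i using R_iota R_fixed that by blast
  have "e i * e (\<iota> i) = 1" for i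
    using RR[of i] nz by (auto simp: e_def iota_iota)
  then have "e \<in> weights"
    unfolding weights_def using R_fixed by (auto simp: e_def)
  moreover have "d i = e i * e i" for i
  proof -
    have "inverse (csqrt (d (\<iota> i))) * inverse (csqrt (d (\<iota> i))) = d i"
      using d1[of i] sq[of "d (\<iota> i)"] nz
      by (metis inverse_mult_distrib inverse_unique mult.commute)
    then show ?thesis using sq[of "d i"] fx[of i] df[of i] by (auto simp: e_def)
  qed
  ultimately show ?thesis using that by blast
qed

text \<open>The relations within pairs yield only that the square of the product is 1. Applied to
  square roots of the weights, they give the product itself.\<close>

lemma prod_weights:
  assumes "d \<in> weights"
  shows "(\<Prod>i\<in>UNIV. d i) = 1"
proof -
  obtain e where e: "e \<in> weights" "\<And>i. d i = e i * e i" by (rule weights_sqrt[OF assms]) (rule that)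
  have "bij \<iota>" using iota_iota by (metis bijI')
  then have "(\<Prod>i\<in>UNIV. e (\<iota> i)) = (\<Prod>i\<in>UNIV. e i)"
    by (rule prod.reindex_bij_betw)
  then have "(\<Prod>i\<in>UNIV. e i) * (\<Prod>i\<in>UNIV. e i) = (\<Prod>i\<in>UNIV. e i * e (\<iota> i))"
    by (simp add: prod.distrib)
  also have "\<dots> = 1" using e(1) by (simp add: weights_def)
  finally show ?thesis by (simp add: e(2) prod.distrib)
qed

lemma form_T_det: "gram P \<Longrightarrow> A \<in> form_T P \<Longrightarrow> det A = 1"
  using det_conj_diag[OF gram_invertible] prod_weights unfolding form_T_def by auto

text \<open>The entries at \<open>R\<close> are the coordinates, and their reciprocals are the
  entries at the partner indices, so both are polynomial.\<close>

lemma torus_form_T: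
  assumes P: "gram P"
  shows "torus (form_T P)"
proof -
  define k where "k = card R"
  obtain b where b: "bij_betw b {..<k} R"
    using ex_bij_betw_nat_finite[of R] by (auto simp: k_def atLeast0LessThan)
  define ib where "ib = inv_into {..<k} b"
  have ib_b: "ib (b j) = j" if "j < k" for j
    unfolding ib_def using bij_betw_inv_into_left[OF b, of j] that by simp
  have b_ib: "b (ib i) = i" "ib i < k" if "i \<in> R" for i
    using bij_betw_inv_into_right[OF b that] bij_betwE[OF bij_betw_inv_into[OF b]] that
    unfolding ib_def by auto
  have b_R: "b j \<in> R" if "j < k" for j using bij_betwE[OF b] that by blast
  have RR: "\<iota> i \<notin> R" if "i \<in> R" for i using R_iota R_fixed that by blast
  have fx: "\<iota> i = i" if "i \<notin> R" "\<iota> i \<notin> R" for i using R_iota that by blast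
  define \<psi> where "\<psi> = (\<lambda>z i. if i \<in> R then z (ib i) else if \<iota> i \<in> R then inverse (z (ib (\<iota> i))) else 1 :: complex)"
  have gen: "(\<lambda>z. z j) \<in> laurent_poly k" "(\<lambda>z. inverse (z j)) \<in> laurent_poly k" if "j < k" for j
    unfolding laurent_poly_def using that by (intro algebra_gen.gen; blast)+
  have coord: "(\<lambda>d. d i) \<in> algebra_gen {\<lambda>d. d i |i. True}" for i :: 'n
    by (rule algebra_gen.gen) blast
  have "torus ((\<lambda>z. conj_diag P (\<psi> z)) ` Gm k)"
  proof (rule torus_conj_diag[OF gram_invertible[OF P]])
    show "\<psi> (\<lambda>i. z i * w i) i = \<psi> z i * \<psi> w i" for z w i
      by (simp add: \<psi>_def)
    show "\<exists>f\<in>laurent_poly k. \<forall>z\<in>Gm k. f z = \<psi> z i" for i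
    proof -
      consider "i \<in> R" | "i \<notin> R" "\<iota> i \<in> R" | "i \<notin> R" "\<iota> i \<notin> R" by blast
      then show ?thesis
      proof cases
        case 1
        then show ?thesis by (intro bexI[OF _ gen(1)[OF b_ib(2)[OF 1]]]) (simp add: \<psi>_def)
      next
        case 2
        then show ?thesis by (intro bexI[OF _ gen(2)[OF b_ib(2)[OF 2(2)]]]) (simp add: \<psi>_def)
      next
        case 3
        then show ?thesis
          by (intro bexI[of _ "\<lambda>_. 1"]) (simp_all add: \<psi>_def laurent_poly_def algebra_gen.const)
      qed
    qed
    show "\<exists>Q\<in>algebra_gen {\<lambda>d. d i |i. True}. \<forall>z\<in>Gm k. Q (\<psi> z) = z j" if "j < k" for j
      by (intro bexI[OF _ coord[of "b j"]]) (simp add: \<psi>_def b_R ib_b that)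
    show "\<exists>Q\<in>algebra_gen {\<lambda>d. d i |i. True}. \<forall>z\<in>Gm k. Q (\<psi> z) = inverse (z j)" if "j < k" for j
      by (intro bexI[OF _ coord[of "\<iota> (b j)"]]) (simp add: \<psi>_def b_R[OF that] RR[OF b_R[OF that]] ib_b that iota_iota)
  qed
  moreover have "\<psi> ` Gm k = weights"
  proof (intro equalityI subsetI)
    fix d assume "d \<in> \<psi> ` Gm k"
    then obtain z where z: "z \<in> Gm k" "d = \<psi> z" by blast
    have "z j \<noteq> 0" for j using z(1) by (simp add: Gm_def)
    then have "d i * d (\<iota> i) = 1" for i
      using RR[of i] by (auto simp: z(2) \<psi>_def iota_iota)
    then show "d \<in> weights"
      unfolding weights_def using R_fixed by (auto simp: z(2) \<psi>_def)
  next
    fix d assume "d \<in> weights"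
    then have d: "d i * d (\<iota> i) = 1" "\<iota> i = i \<Longrightarrow> d i = 1" for i
      unfolding weights_def by blast+
    have nz: "d i \<noteq> 0" for i using d(1)[of i] by auto
    define z where "z = (\<lambda>j. if j < k then d (b j) else 1)"
    have "z \<in> Gm k" using nz by (simp add: z_def Gm_def)
    moreover have "\<psi> z i = d i" for i
    proof -
      consider "i \<in> R" | "i \<notin> R" "\<iota> i \<in> R" | "i \<notin> R" "\<iota> i \<notin> R" by blast
      then show ?thesis
      proof cases
        case 1 then show ?thesis by (simp add: \<psi>_def z_def b_ib)
      next
        case 2
        then have "\<psi> z i = inverse (d (\<iota> i))" by (simp add: \<psi>_def z_def b_ib)
        also have "\<dots> = d i" using d(1)[of i] inverse_unique[of "d (\<iota> i)" "d i"] by (simp add: mult.commute)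
        finally show ?thesis .
      next
        case 3 then show ?thesis using d(2)[OF fx] by (simp add: \<psi>_def)
      qed
    qed
    ultimately show "d \<in> \<psi> ` Gm k" by (metis ext imageI)
  qed
  ultimately show ?thesis unfolding form_T_def by (simp only: image_image flip: \<open>\<psi> ` Gm k = _\<close>)
qed

lemma gram_columns: "gram P \<longleftrightarrow> (\<forall>i j. B (column i P) (column j P) = (if j = \<iota> i then sg i else 0))"
  unfolding bil_column gram_def by (simp add: vec_eq_iff K_def)

end

context form_torus
begin

lemma gram_frame_exists: "\<exists>P. gram P \<and> (\<forall>i. column i P \<in> E)"
proof -
  obtain e where e: "partial_frame UNIV e" using frame_exists by blast
  have "column i (\<chi> i j. e j $ i) = e i" for i by (simp add: column_def vec_eq_iff)
  then show ?thesis
    using e unfolding partial_frame_def gram_columns by (intro exI[of _ "\<chi> i j. e j $ i"]) simp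
qed

text \<open>At the unpaired index an isometry has eigenvalue 1 or -1. Writing \<open>A\<close> as a
  square inside \<open>T\<close> makes it 1.\<close>

lemma frame_torus:
  assumes P: "gram P" "\<And>i. column i P \<in> E"
  shows "T \<subseteq> form_T P"
proof
  have ev: "\<exists>d. \<forall>i. A *v column i P = d i *s column i P" if "A \<in> T" for A
    using P(2) that unfolding common_eigenvectors_def by (intro choice) blast
  have pair: "d i * d (\<iota> i) = 1" if "A \<in> T" "\<forall>i. A *v column i P = d i *s column i P" for A d i
    using eigen_mult[OF that(1), of "column i P" "d i" "column (\<iota> i) P" "d (\<iota> i)"] that(2)
      P(1) sg_nz[of i] unfolding gram_columns by simp
  fix A assume A: "A \<in> T"
  obtain C where C: "C \<in> T" "A = C ** C" using T_sqrt[OF A] by blast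
  obtain c where c: "\<forall>i. C *v column i P = c i *s column i P" using ev[OF C(1)] by blast
  have Ac: "A *v column i P = (c i * c i) *s column i P" for i
    by (simp add: C(2) c vec.scale vector_smult_assoc flip: matrix_vector_mul_assoc)
  have "A = conj_diag P (\<lambda>i. c i * c i)"
    by (rule eigenbasis_diag[OF gram_invertible[OF P(1)] Ac])
  moreover have "(\<lambda>i. c i * c i) \<in> weights"
    unfolding weights_def
  proof (intro CollectI conjI allI impI)
    show "c i * c i * (c (\<iota> i) * c (\<iota> i)) = 1" for i
      by (rule pair[OF A]) (use Ac in simp)
    show "c i * c i = 1" if "\<iota> i = i" for i
      using pair[OF C(1) c, of i] that by simp
  qed
  ultimately show "A \<in> form_T P" unfolding form_T_def by blast
qed

text \<open>In the orthogonal case the determinant of an adapted frame can be chosen with either sign: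
  interchange two paired basis vectors, or negate the unpaired one.\<close>

lemma gram_frame_neg_det:
  assumes P: "gram P" "\<And>i. column i P \<in> E" and "\<epsilon> = 1"
  shows "\<exists>P'. gram P' \<and> (\<forall>i. column i P' \<in> E) \<and> det P' = - det P"
proof -
  fix i0 :: 'n
  have sg1: "sg i = 1" for i unfolding sg_def using \<open>\<epsilon> = 1\<close> by simp
  show ?thesis
  proof (cases "\<iota> i0 = i0")
    case True
    let ?d = "\<lambda>i. if i = i0 then -1 else 1 :: complex"
    have "\<iota> i = i0 \<longleftrightarrow> i = i0" for i using True iota_iota by metis
    then have "gram (P ** diag ?d)" by (intro gram_diag[OF P(1)]) auto
    moreover have "column i (P ** diag ?d) = ?d i *s column i P" for i
      by (simp add: column_def vec_eq_iff)
    then have "column i (P ** diag ?d) \<in> E" for i using E_scale[OF P(2)] by simp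
    moreover have "det (P ** diag ?d) = - det P" by (simp add: det_mul det_diag)
    ultimately show ?thesis by blast
  next
    case False
    define p where "p = Transposition.transpose i0 (\<iota> i0)"
    let ?P = "(\<chi> i j. P $ i $ p j) :: complex^'n^'n"
    have p_iota: "p (\<iota> i) = \<iota> (p i)" for i
      unfolding p_def Transposition.transpose_def using iota_iota by auto metis+
    have "p (p i) = i" for i by (simp add: p_def)
    then have p_inj: "p i = p j \<longleftrightarrow> i = j" for i j by metis
    have col: "column j ?P = column (p j) P" for j by (simp add: column_def)
    have "gram ?P"
      using P(1) unfolding gram_columns col sg1 by (simp add: p_inj flip: p_iota)
    moreover have "column i ?P \<in> E" for i unfolding col by (rule P(2))
    moreover have "det ?P = - det P"
    proof -
      have "p permutes UNIV" unfolding p_def by (rule permutes_swap_id) auto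
      from det_permute_columns[OF this, of P] show ?thesis
        using False by (simp add: p_def sign_swap_id)
    qed
    ultimately show ?thesis by blast
  qed
qed

end

section \<open>The orthogonal and symplectic groups\<close>

locale form_group = form_data \<iota> R J \<epsilon>
  for \<iota> :: "'n::finite \<Rightarrow> 'n" and R J \<epsilon> +
  fixes G :: "(complex^'n^'n) set"
  assumes G: "\<epsilon> = 1 \<and> G = {A \<in> Sp J. det A = 1} \<or> \<epsilon> = -1 \<and> G = Sp J"
begin

lemma G_Sp: "G \<subseteq> Sp J" and Sp_det_G: "A \<in> Sp J \<Longrightarrow> det A = 1 \<Longrightarrow> A \<in> G"
  using G by auto

lemma form_torus_max:
  assumes "maximal_torus G T"
  shows "form_torus \<iota> R J \<epsilon> T"
proof
  have T: "torus T" "T \<subseteq> G" using assms unfolding maximal_torus_def by blast+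
  show "T \<subseteq> Sp J" using T(2) G_Sp by blast
  show "\<exists>B\<in>T. A = B ** B" if "A \<in> T" for A using torus_sqrt[OF T(1) that] .
  show "vec.span (common_eigenvectors T) = UNIV"
    using torus_eigenvectors_span[OF T(1)] Sp_invertible T(2) G_Sp by blast
qed

text \<open>The torus is contained in the diagonal group of the adapted basis, itself a torus of
  \<open>G\<close>, so maximality applies.\<close>

lemma max_torus_eq:
  assumes T: "maximal_torus G T" and P: "gram P" "\<And>i. column i P \<in> common_eigenvectors T"
  shows "T = form_T P"
proof -
  have "T \<subseteq> form_T P" by (rule form_torus.frame_torus[OF form_torus_max[OF T] P])
  moreover have "form_T P \<subseteq> G"
    using form_T_Sp[OF P(1)] form_T_det[OF P(1)] Sp_det_G by blast
  ultimately show ?thesis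
    using T torus_form_T[OF P(1)] unfolding maximal_torus_def by blast
qed

lemma max_torus_frame:
  assumes "maximal_torus G T"
  obtains P where "gram P" "\<And>i. column i P \<in> common_eigenvectors T" "T = form_T P"
  using form_torus.gram_frame_exists[OF form_torus_max[OF assms]] max_torus_eq[OF assms] by blast

text \<open>The change between adapted bases of the two tori is an isometry conjugating one torus
  into the other. In the orthogonal case it has determinant 1 only if both bases have the same
  determinant, which is arranged first.\<close>

lemma max_tori_conj:
  assumes T: "maximal_torus G T" and T': "maximal_torus G T'"
  shows "\<exists>g\<in>G. \<forall>A\<in>T'. g ** A ** matrix_inv g \<in> T"
proof -
  obtain P where P: "gram P" "T = form_T P" using max_torus_frame[OF T] by blast
  have "\<exists>P'. gram P' \<and> (\<forall>i. column i P' \<in> common_eigenvectors T') \<and> (\<epsilon> = 1 \<longrightarrow> det P' = det P)"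
  proof -
    obtain P' where P': "gram P'" "\<And>i. column i P' \<in> common_eigenvectors T'"
      using max_torus_frame[OF T'] by blast
    \<comment> \<open>The Gram identity fixes the square of the determinant, so two adapted bases
      have determinants equal up to sign.\<close>
    have det: "det P * det P * det J = det K" if "gram P" for P
      using that unfolding gram_def by (metis det_mul det_transpose mult.assoc mult.commute)
    have "det J \<noteq> 0" using J_inv by (simp add: invertible_det_nz)
    then have "det P' * det P' = det P * det P"
      using det[OF P(1)] det[OF P'(1)] by (metis mult_cancel_right)
    then have "det P' = det P \<or> det P' = - det P" by (simp add: square_eq_iff)
    then show ?thesis
    proof
      assume "det P' = - det P"
      then show ?thesis
        using form_torus.gram_frame_neg_det[OF form_torus_max[OF T'] P'] P' by (metis minus_minus)
    qed (use P' in blast)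
  qed
  then obtain P' where P': "gram P'" "\<And>i. column i P' \<in> common_eigenvectors T'"
    "\<epsilon> = 1 \<Longrightarrow> det P' = det P" by blast
  have T'_eq: "T' = form_T P'" by (rule max_torus_eq[OF T' P'(1,2)])
  let ?g = "P ** matrix_inv P'"
  have inv: "invertible P" "invertible P'" using gram_invertible P(1) P'(1) by blast+
  have g: "?g \<in> Sp J" by (rule gram_conj[OF P(1) P'(1)])
  have "?g \<in> G"
  proof (cases "\<epsilon> = 1")
    case True
    have "det P' * det (matrix_inv P') = 1"
      using matrix_inv_mult(1)[OF inv(2)] by (metis det_I det_mul)
    then have "det ?g = 1" using P'(3)[OF True] by (simp add: det_mul)
    then show ?thesis using g Sp_det_G by blast
  next
    case False
    then show ?thesis using g G by blast
  qed
  moreover have "?g ** A ** matrix_inv ?g \<in> T" if "A \<in> T'" for A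
  proof -
    obtain d where d: "A = conj_diag P' d" "d \<in> weights"
      using \<open>A \<in> T'\<close> unfolding T'_eq form_T_def by blast
    have "?g ** A ** matrix_inv ?g = conj_diag P d"
      unfolding d(1) by (simp add: matrix_inv_prod inv invertible_matrix_inv
          matrix_mul_assoc[symmetric] matrix_inv_cancel)
    then show ?thesis using d(2) unfolding P(2) form_T_def by blast
  qed
  ultimately show ?thesis by blast
qed

text \<open>The involution \<open>adj\<close> preserves the trace form; this is the projection onto
  its (-1)-eigenspace, which is \<open>sp J\<close>.\<close>

definition S :: "complex^'n^'n \<Rightarrow> complex^'n^'n" where
  "S X = mat (1/2) ** (X - adj X)"

text \<open>The Cayley transform replaces the matrix exponential as a source of curves in \<open>G\<close>.\<close>

lemma cayley:
  assumes C: "C \<in> sp J" and inv: "invertible (mat 1 - C)"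
  shows "(mat 1 + C) ** matrix_inv (mat 1 - C) \<in> G"
proof (rule Sp_det_G)
  have adjC: "adj (mat 1 - C) = mat 1 + C" "adj (mat 1 + C) = mat 1 - C"
    using C by (simp_all add: adj_diff adj_add adj_one sp_iff)
  have det: "det (mat 1 + C) = det (mat 1 - C)"
    using det_adj[of "mat 1 - C"] by (simp add: adjC)
  then have inv': "invertible (mat 1 + C)" using inv by (simp add: invertible_det_nz)
  have comm: "(mat 1 - C) ** (mat 1 + C) = (mat 1 + C) ** (mat 1 - C)"
    by (simp add: matrix_mult_diff matrix_diff_mult matrix_add_ldistrib matrix_mult_add_rdistrib)
  have adj_inv: "adj (matrix_inv (mat 1 - C)) ** (mat 1 + C) = mat 1"
  proof -
    have "adj ((mat 1 - C) ** matrix_inv (mat 1 - C)) = mat 1"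
      by (simp add: matrix_inv_mult[OF inv] adj_one)
    then show ?thesis by (simp add: adj_mult adjC)
  qed
  have "adj ((mat 1 + C) ** matrix_inv (mat 1 - C)) ** ((mat 1 + C) ** matrix_inv (mat 1 - C))
      = adj (matrix_inv (mat 1 - C)) ** ((mat 1 - C) ** (mat 1 + C)) ** matrix_inv (mat 1 - C)"
    by (simp add: adj_mult adjC matrix_mul_assoc)
  also have "\<dots> = (adj (matrix_inv (mat 1 - C)) ** (mat 1 + C)) ** ((mat 1 - C) ** matrix_inv (mat 1 - C))"
    unfolding comm by (simp add: matrix_mul_assoc)
  also have "\<dots> = mat 1" by (simp add: adj_inv matrix_inv_mult[OF inv])
  finally show "(mat 1 + C) ** matrix_inv (mat 1 - C) \<in> Sp J" by (simp add: Sp_iff)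
  have "det (mat 1 - C) * det (matrix_inv (mat 1 - C)) = 1"
    using matrix_inv_mult(1)[OF inv] by (metis det_I det_mul)
  then show "det ((mat 1 + C) ** matrix_inv (mat 1 - C)) = 1" by (simp add: det_mul det)
qed

sublocale classical_group G "sp J" S
proof
  show "invertible A" if "A \<in> G" for A using that G_Sp Sp_invertible by blast
  show "S X \<in> sp J" for X
    by (simp add: sp_iff S_def adj_scale adj_diff adj_adj vec_eq_iff) (simp add: field_simps)
  show "S X = X" if "X \<in> sp J" for X
    using that by (simp add: sp_iff S_def vec_eq_iff)
  show "S (X + Y) = S X + S Y" for X Y
    by (simp add: S_def adj_add vec_eq_iff algebra_simps)
  show "S (mat a ** X) = mat a ** S X" for a X
    by (simp add: S_def adj_scale vec_eq_iff algebra_simps)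
  show "S (A ** X ** matrix_inv A) = A ** S X ** matrix_inv A" if "A \<in> G" for A X
  proof -
    have A: "A \<in> Sp J" using that G_Sp by blast
    have "adj (A ** X ** matrix_inv A) = A ** adj X ** matrix_inv A"
      by (simp add: adj_mult adj_inv[OF A] Sp_inv[OF A] adj_adj matrix_mul_assoc)
    then show ?thesis
      by (simp add: S_def mult_mat_left[of A] matrix_mult_diff matrix_diff_mult matrix_mul_assoc[symmetric])
  qed
  show "trace (S X ** Y) = trace (X ** Y)" if "Y \<in> sp J" for X Y
  proof -
    have "trace (adj X ** Y) = trace (adj (adj Y ** X))" by (simp add: adj_mult adj_adj)
    also have "\<dots> = trace (adj Y ** X)" by (rule trace_adj)
    also have "\<dots> = trace ((0 - Y) ** X)" using that by (simp add: sp_iff)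
    also have "\<dots> = - trace (X ** Y)"
      unfolding matrix_diff_mult trace_sub using trace_mul_sym[of X Y] by (simp add: trace_def)
    finally show ?thesis
      by (simp add: S_def matrix_mul_assoc[symmetric] trace_mat_mult matrix_diff_mult trace_sub)
  qed
  show "\<exists>K. K 0 = mat 1 \<and> has_mderiv K A \<and>
      (\<forall>F\<in>invariant_poly G. \<forall>\<rho>\<in>Hom G.
        \<forall>\<^sub>F t in nhds 0. F (\<lambda>x. K t ** \<rho> x ** matrix_inv (K t)) = F \<rho>)" if A: "A \<in> sp J" for A
  proof -
    \<comment> \<open>The Cayley transform of t C has velocity 2 C at 0, hence the factor
      1/2.\<close>
    let ?C = "mat (1/2) ** A"
    let ?M = "\<lambda>t. mat 1 + mat t ** (- ?C)"
    let ?K = "\<lambda>t. (mat 1 + mat t ** ?C) ** matrix_inv (?M t)"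
    have M: "has_mderiv ?M (- ?C)" "?M 0 = mat 1" by (rule has_mderiv_linear) simp
    have inv1: "matrix_inv (mat 1 :: complex^'n^'n) = mat 1" by (simp add: matrix_inv_unique)
    have M_eq: "?M t = mat 1 - mat t ** ?C" for t by (simp add: vec_eq_iff)
    show ?thesis
    proof (intro exI[of _ ?K] conjI ballI)
      show "?K 0 = mat 1" by (simp add: inv1)
      have "has_mderiv ?K (?C ** matrix_inv (?M 0) + (mat 1 + mat 0 ** ?C) ** (- (- ?C)))"
        by (rule has_mderiv_mult[OF has_mderiv_linear has_mderiv_inverse(1)[OF M]])
      moreover have "?C ** matrix_inv (?M 0) + (mat 1 + mat 0 ** ?C) ** (- (- ?C)) = A"
        by (simp add: inv1) (simp add: vec_eq_iff)
      ultimately show "has_mderiv ?K A" by simp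
      fix F :: "'n rep \<Rightarrow> complex" and \<rho> :: "'n rep"
      assume F: "F \<in> invariant_poly G" and \<rho>: "\<rho> \<in> Hom G"
      show "\<forall>\<^sub>F t in nhds 0. F (\<lambda>x. ?K t ** \<rho> x ** matrix_inv (?K t)) = F \<rho>"
        using has_mderiv_inverse(2)[OF M]
      proof eventually_elim
        case (elim t)
        have "mat t ** ?C \<in> sp J" using A by (simp add: sp_iff adj_scale) (simp add: vec_eq_iff)
        from cayley[OF this] elim have "?K t \<in> G" unfolding M_eq by blast
        then show ?case by (rule invariant_polyD[OF F \<rho>])
      qed
    qed
  qed
  show "\<exists>P :: complex^'n^'n. invertible P \<and>
      (\<forall>A\<in>T. \<exists>d. A = conj_diag P d) \<and>
      (\<forall>i j. i \<noteq> j \<longrightarrow> (\<exists>d. d i \<noteq> d j \<and> conj_diag P d \<in> T)) \<and>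
      (\<forall>\<xi> t. conj_diag P \<xi> \<in> sp J \<longrightarrow> conj_diag P (\<lambda>i. exp (t * \<xi> i)) \<in> T)"
    if T: "maximal_torus G T" for T
  proof -
    obtain P where P: "gram P" "T = form_T P" using max_torus_frame[OF T] by blast
    \<comment> \<open>The value 2 at \<open>i\<close> forces 1/2 at its partner, so \<open>i\<close>
      must not be fixed; of two different indices at most one is.\<close>
    have sep: "\<exists>d\<in>weights. d i \<noteq> d j" if "i \<noteq> j" "\<iota> i \<noteq> i" for i j
    proof
      let ?d = "\<lambda>x. if x = i then 2 else if x = \<iota> i then 1/2 else 1 :: complex"
      have "\<iota> x = i \<longleftrightarrow> x = \<iota> i" "\<iota> x = \<iota> i \<longleftrightarrow> x = i" for x using iota_iota by metis+
      then show "?d \<in> weights" using that(2) by (auto simp: weights_def)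
      show "?d i \<noteq> ?d j" using that by simp
    qed
    show ?thesis
    proof (intro exI[of _ P] conjI allI impI ballI)
      show "invertible P" using gram_invertible[OF P(1)] .
      show "\<exists>d. A = conj_diag P d" if "A \<in> T" for A
        using that unfolding P(2) form_T_def by blast
      show "\<exists>d. d i \<noteq> d j \<and> conj_diag P d \<in> T" if "i \<noteq> j" for i j
      proof -
        have "\<iota> i \<noteq> i \<or> \<iota> j \<noteq> j" using one_fixed that by blast
        then obtain d where "d \<in> weights" "d i \<noteq> d j" using sep[of i j] sep[of j i] \<open>i \<noteq> j\<close> by metis
        then show ?thesis unfolding P(2) form_T_def by blast
      qed
      show "conj_diag P (\<lambda>i. exp (t * \<xi> i)) \<in> T"
        if X: "conj_diag P \<xi> \<in> sp J" for \<xi> t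
      proof -
        have inv: "invertible P" using gram_invertible[OF P(1)] .
        let ?X = "conj_diag P \<xi>"
        have "transpose (matrix_inv P ** P) = mat 1"
          by (simp add: matrix_inv_mult[OF inv] transpose_mat)
        then have PP: "transpose P ** transpose (matrix_inv P) = mat 1"
          by (simp add: matrix_transpose_mul)
        \<comment> \<open>Expressed in the basis \<open>P\<close>, membership in \<open>sp J\<close>
          says that the eigenvalues of \<open>?X\<close> at paired indices are opposite, and
          exponentiation turns this into the condition on weights.\<close>
        have "transpose P ** (transpose ?X ** J + J ** ?X) ** P
            = (transpose P ** transpose (matrix_inv P)) ** diag \<xi> ** (transpose P ** J ** P)
              + (transpose P ** J ** P) ** diag \<xi> ** (matrix_inv P ** P)"
          by (simp add: matrix_transpose_mul transpose_diag matrix_add_ldistrib matrix_mult_add_rdistrib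
              matrix_mul_assoc)
        also have "\<dots> = diag \<xi> ** K + K ** diag \<xi>"
          using P(1) by (simp add: PP matrix_inv_mult[OF inv] gram_def)
        finally have eq: "diag \<xi> ** K + K ** diag \<xi> = 0"
          using X by (simp add: sp_def)
        have sum0: "\<xi> i + \<xi> (\<iota> i) = 0" for i
        proof -
          have "(diag \<xi> ** K + K ** diag \<xi>) $ i $ \<iota> i = 0" by (simp only: eq zero_index)
          then have "(\<xi> i + \<xi> (\<iota> i)) * sg i = 0" by (simp add: K_def algebra_simps)
          then show ?thesis using sg_nz by simp
        qed
        have "exp (t * \<xi> i) * exp (t * \<xi> (\<iota> i)) = 1" for i
          by (simp add: sum0 flip: exp_add distrib_left)
        moreover have "exp (t * \<xi> i) = 1" if "\<iota> i = i" for i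
          using sum0[of i] that by simp
        ultimately have "(\<lambda>i. exp (t * \<xi> i)) \<in> weights" by (simp add: weights_def)
        then show ?thesis unfolding P(2) form_T_def by blast
      qed
    qed
  qed
  show "\<exists>g\<in>G. \<forall>A\<in>T'. g ** A ** matrix_inv g \<in> T"
    if "maximal_torus G T" "maximal_torus G T'" for T T' using max_tori_conj[OF that] .
qed

theorem poisson_bracket_form:
  assumes T: "maximal_torus G T" and x: "x \<in> X0 G T" and c: "c \<noteq> 0"
  shows "poisson_bracket G (sp J) T c (tau G T (p, q)) (tau G T (r, s)) x =
    1 / (2 * c) * of_int (p * s - q * r) * (tau G T (p + r, q + s) x - tau G T (p - r, q - s) x)"
proof -
  let ?\<Phi> = "\<lambda>\<rho>. 1 / (2 * c) * of_int (p * s - q * r) * (trace (\<rho> (p + r, q + s)) - trace (\<rho> (p - r, q - s)))"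
  obtain \<rho> where \<rho>: "\<rho> \<in> x" using x git_class_self Hom_mono T unfolding X0_def maximal_torus_def by blast
  have "poisson_bracket G (sp J) T c (tau G T (p, q)) (tau G T (r, s)) x = ?\<Phi> \<rho>"
  proof (rule poisson_bracket_tau[OF T x c _ _ \<rho>])
    show "?\<Phi> \<in> invariant_poly G"
      by (intro invariant_poly_mult invariant_poly_diff invariant_poly_const trace_invariant)
    fix \<sigma> assume \<sigma>: "\<sigma> \<in> Hom G"
    have "\<sigma> (r, s) \<in> Sp J" using Hom_in[OF \<sigma>] G_Sp by blast
    \<comment> \<open>For an isometry the adjoint is the inverse, here the value at the opposite
      group element, which produces the term with (p - r, q - s).\<close>
    then have "adj (\<sigma> (r, s)) = \<sigma> (- (r, s))" by (simp only: rep_uminus[OF \<sigma>] Sp_inv)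
    then have "S (\<sigma> (r, s)) ** \<sigma> (p, q) = mat (1/2) ** (\<sigma> ((r, s) + (p, q)) - \<sigma> (- (r, s) + (p, q)))"
      by (simp only: S_def Hom_mult[OF \<sigma>] matrix_diff_mult matrix_mul_assoc[symmetric])
    then have tr: "trace (S (\<sigma> (r, s)) ** \<sigma> (p, q)) =
        1/2 * (trace (\<sigma> (p + r, q + s)) - trace (\<sigma> (p - r, q - s)))"
      by (simp add: trace_mat_mult trace_sub add.commute)
    show "?\<Phi> \<sigma> = 1 / c * of_int (p * s - q * r) * trace (S (\<sigma> (r, s)) ** \<sigma> (p, q))"
      unfolding tr by simp
  qed
  then show ?thesis by (simp add: tau_eq[OF x \<rho>])
qed

end

lemma SO_eq: "SO = {A \<in> Sp (mat 1). det A = 1}"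
  by (auto simp: SO_def Sp_def)

lemma so_eq: "so = sp (mat 1)"
  by (simp add: so_def sp_def)

lemma poisson_bracket_SL:
  fixes T :: "(complex^'n^'n) set"
  assumes T: "maximal_torus SL T" and x: "x \<in> X0 SL T" and c: "c \<noteq> 0"
  shows "poisson_bracket SL sl T c (tau SL T (p, q)) (tau SL T (r, s)) x =
    1 / c * of_int (p * s - q * r) *
      (tau SL T (p + r, q + s) x - tau SL T (p, q) x * tau SL T (r, s) x / of_nat CARD('n))"
proof -
  interpret classical_group "SL :: (complex^'n^'n) set" sl "\<lambda>X. X - mat (trace X / of_nat CARD('n))"
    by (rule classical_group_SL)
  \<comment> \<open>The division by n is written as a constant factor so that \<Phi> is visibly
    built from constants, products and differences of invariant functions.\<close>
  let ?\<Phi> = "\<lambda>\<rho> :: 'n rep. 1 / c * of_int (p * s - q * r) *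
    (trace (\<rho> (p + r, q + s)) - 1 / of_nat CARD('n) * (trace (\<rho> (p, q)) * trace (\<rho> (r, s))))"
  obtain \<rho> where \<rho>: "\<rho> \<in> x" using x git_class_self Hom_mono T unfolding X0_def maximal_torus_def by blast
  have "poisson_bracket SL sl T c (tau SL T (p, q)) (tau SL T (r, s)) x = ?\<Phi> \<rho>"
  proof (rule poisson_bracket_tau[OF T x c _ _ \<rho>])
    show "?\<Phi> \<in> invariant_poly SL"
      by (intro invariant_poly_mult invariant_poly_diff invariant_poly_const trace_invariant)
    fix \<sigma> :: "'n rep" assume \<sigma>: "\<sigma> \<in> Hom SL"
    have "\<sigma> (p + r, q + s) = \<sigma> (r, s) ** \<sigma> (p, q)"
      using Hom_mult[OF \<sigma>, of "(r, s)" "(p, q)"] by (simp add: add.commute)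
    then show "?\<Phi> \<sigma> = 1 / c * of_int (p * s - q * r) *
        trace ((\<sigma> (r, s) - mat (trace (\<sigma> (r, s)) / of_nat CARD('n))) ** \<sigma> (p, q))"
      by (simp add: matrix_diff_mult trace_sub trace_mat_mult)
  qed
  then show ?thesis by (simp add: tau_eq[OF x \<rho>])
qed

theorem proposition6p2:
  fixes c :: complex and p q r s :: int
  assumes "c \<noteq> 0"
  shows
    "(\<forall>T :: (complex^'n^'n) set. maximal_torus SL T \<longrightarrow>
       (\<forall>x\<in>X0 SL T.
          poisson_bracket SL sl T c (tau SL T (p, q)) (tau SL T (r, s)) x =
          1 / c * of_int (p * s - q * r) *
            (tau SL T (p + r, q + s) x
              - tau SL T (p, q) x * tau SL T (r, s) x / of_nat CARD('n))))
   \<and> (\<forall>T :: (complex^'n^'n) set. maximal_torus SO T \<longrightarrow>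
       (\<forall>x\<in>X0 SO T.
          poisson_bracket SO so T c (tau SO T (p, q)) (tau SO T (r, s)) x =
          1 / (2 * c) * of_int (p * s - q * r) *
            (tau SO T (p + r, q + s) x - tau SO T (p - r, q - s) x)))
   \<and> (\<forall>(J :: complex^('n + 'n)^('n + 'n)) T. symplectic_form J \<and> maximal_torus (Sp J) T \<longrightarrow>
       (\<forall>x\<in>X0 (Sp J) T.
          poisson_bracket (Sp J) (sp J) T c (tau (Sp J) T (p, q)) (tau (Sp J) T (r, s)) x =
          1 / (2 * c) * of_int (p * s - q * r) *
            (tau (Sp J) T (p + r, q + s) x - tau (Sp J) T (p - r, q - s) x)))"
proof (intro conjI allI impI ballI, goal_cases)
  case (1 T x)
  then show ?case by (rule poisson_bracket_SL[OF _ _ assms])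
next
  case (2 T x)
  obtain \<iota> and R :: "'n set" where "pairing_data \<iota> R" using pairing_data_exists by blast
  then interpret pairing_data \<iota> R .
  \<comment> \<open>\<open>SO\<close> is the isometry group of the standard symmetric form with
    determinant 1; over the complex numbers this form has hyperbolic bases.\<close>
  interpret form_group \<iota> R "mat 1" 1 SO
    by unfold_locales (auto simp: SO_eq transpose_mat invertible_def intro: exI[of _ "mat 1"])
  show ?case
    using poisson_bracket_form[OF 2 assms] by (simp only: so_eq)
next
  case (3 J T x)
  obtain \<iota> and R :: "('n + 'n) set" where "pairing_data \<iota> R" using pairing_data_exists by blast
  then interpret pairing_data \<iota> R .
  have "transpose J = mat (-1) ** J"
    using 3(1) by (simp add: symplectic_form_def vec_eq_iff)
  then interpret form_group \<iota> R J "-1" "Sp J"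
    using 3(1) by unfold_locales (auto simp: symplectic_form_def)
  show ?case
    by (rule poisson_bracket_form[OF conjunct2[OF 3(1)] 3(2) assms])
qed

end
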